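(* Let $p\geq 2$ and $s>s_p^\star$, where $s_p^\star=1/4$ if $p\leq 4$ and $s_p^\star=1/2-1/p$ if $p>4$. Let $R_s(x)=\sum_{n=1}^\infty n^{-2s}e^{2\pi i n^2 x}$ on $\mathbb T=\mathbb R/\mathbb Z$. Then, as $N\to\infty$, \[ F_{R_s,p}(N)\simeq \begin{cases} 1, & p<4,\\ \log N, & p=4,\\ N^{p/4-1}, & p>4,\end{cases} \] where the implicit constants do not depend on $N$.
   Context: $\mathbb T=\mathbb R/\mathbb Z$ and $\|\cdot\|_p$ denotes the $L^p(\mathbb T)$ norm. For $s\le 1/2$ the series defining $R_s$ is not absolutely convergent; $R_s$ is then understood as the limit in $L^p(\mathbb T)$ of its partial sums. For $f(x)=\sum_{n\in\mathbb Z}a_ne^{2\pi i n x}$, the high-pass filter is $f_{\geq N}(x)=\sum_{|n|\geq N}a_ne^{2\pi i n x}$; for $R_s$ this means $(R_s)_{\ge N}(x)=\sum_{n\ge1,\ n^2\ge N} n^{-2s}e^{2\pi i n^2x}$. The flatness in the sense of high-pass filters is $F_{f,p}(N)=\|f_{\geq N}\|_{p}^p/\|f_{\geq N}\|_{2}^p$. $A\simeq B$ means $c B\le A\le CB$ for constants $c,C>0$. *)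

theory Defs
  imports "HOL-Analysis.Analysis"
begin

text \<open>Functions on the torus R/Z are represented as functions real => complex,
  integrated over one period [0,1].\<close>

definition Lp_pow :: "real \<Rightarrow> (real \<Rightarrow> complex) \<Rightarrow> ennreal" where
  "Lp_pow p f = (\<integral>\<^sup>+ x \<in> {0..1}. ennreal (cmod (f x) powr p) \<partial>lborel)"

definition Lp_limit :: "real \<Rightarrow> (nat \<Rightarrow> real \<Rightarrow> complex) \<Rightarrow> (real \<Rightarrow> complex) \<Rightarrow> bool" where
  "Lp_limit p S g \<longleftrightarrow> g \<in> borel_measurable lborel \<and>
     (\<lambda>M. Lp_pow p (\<lambda>x. S M x - g x)) \<longlonglongrightarrow> 0"

definition Rs_high_partial :: "real \<Rightarrow> nat \<Rightarrow> nat \<Rightarrow> real \<Rightarrow> complex" where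
  "Rs_high_partial s N M x =
     sum (\<lambda>n. complex_of_real (real n powr (- 2 * s)) * cis (2 * pi * real (n ^ 2) * x))
       {n. 1 \<le> n \<and> N \<le> n ^ 2 \<and> n \<le> M}"

definition flatness :: "real \<Rightarrow> (real \<Rightarrow> complex) \<Rightarrow> real" where
  "flatness p g = enn2real (Lp_pow p g) / (enn2real (Lp_pow 2 g)) powr (p/2)"

definition s_star :: "real \<Rightarrow> real" where
  "s_star p = (if p \<le> 4 then 1/4 else 1/2 - 1/p)"

definition flat_rate :: "real \<Rightarrow> nat \<Rightarrow> real" where
  "flat_rate p N = (if p < 4 then 1 else if p = 4 then ln (real N) else real N powr (p/4 - 1))"

end

theory Submission
  imports Defs "HOL-Number_Theory.Totient"
begin

text \<open>
  Write \<open>L = \<lceil>sqrt N\<rceil>\<close>. Since the \<open>L\<^sup>2\<close> norm of the tail is of size \<open>L\<^bsup>1/2 - 2s\<^esup>\<close> by orthogonality, the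
  theorem amounts to a two-sided estimate of its \<open>L\<^sup>p\<close> norm.

  Upper bound. For a quadratic exponential sum with a tent-shaped weight of width \<open>w\<close>, Weyl
  differencing loses no logarithm: with \<open>x = a/q + \<beta>\<close> given by Dirichlet's theorem
  (\<open>q \<lesssim> w\<close>, \<open>\<bar>\<beta>\<bar> \<le> 1/(8 w q)\<close>) its square is at most a constant times
  \<open>w + (w\<^sup>2/q) (1 + w\<^sup>2 \<bar>\<beta>\<bar>)\<^bsup>-\<eta>\<^esup>\<close> for any \<open>\<eta> < 1\<close>. Taking \<open>\<eta> > 2/p\<close> and integrating over all arcs gives the
  \<open>L\<^sup>p\<close> norm for every \<open>p > 2\<close>, the three regimes coming from \<open>\<Sum>q \<lesssim> w. q\<^bsup>1 - p/2\<^esup>\<close>. A sharply cut interval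
  is a superposition of tents of geometrically decreasing widths, and partial summation together
  with a dyadic decomposition yields the weighted tails. The same bounds show that the partial sums
  are Cauchy, and Fatou's lemma provides the limit.

  Lower bound. For \<open>p < 4\<close> this is Jensen's inequality. For \<open>p = 4\<close> the coefficients are positive, so it suffices
  to count solutions of \<open>n\<^sub>1\<^sup>2 + n\<^sub>2\<^sup>2 = n\<^sub>3\<^sup>2 + n\<^sub>4\<^sup>2\<close> of size \<open>L\<close>; there are at least \<open>c L\<^sup>2 log L\<close> of them, by summing
  greatest common divisors. For \<open>p > 4\<close> one tests against a Fejer kernel.
\<close>

section \<open>The \<open>L\<^sup>p\<close> norm on the unit interval\<close>

lemma powr_ge_tangent:
  fixes b z p :: real
  assumes "0 < b" "0 \<le> z" "1 \<le> p"
  shows "b powr p * (1 + p * (z / b - 1)) \<le> z powr p"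
proof (cases "z = 0")
  case True
  then show ?thesis using assms by (simp add: mult_nonneg_nonpos)
next
  case False
  define t where "t = z / b"
  have "t > 0" using assms False by (simp add: t_def)
  have "(t powr p) powr (1/p) * 1 powr (1 - 1/p) \<le> 1/p * t powr p + (1 - 1/p) * 1"
    by (rule Youngs_inequality_0) (use assms \<open>t > 0\<close> in auto)
  then have "p * t \<le> p * (1/p * t powr p + (1 - 1/p))"
    using assms \<open>t > 0\<close> by (intro mult_left_mono) (auto simp: powr_powr)
  then have "1 + p * (t - 1) \<le> t powr p"
    using assms by (simp add: algebra_simps)
  then have "b powr p * (1 + p * (t - 1)) \<le> b powr p * t powr p"
    by (rule mult_left_mono) simp
  also have "\<dots> = z powr p" using assms by (simp add: t_def powr_divide)
  finally show ?thesis by (simp add: t_def)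
qed

lemma powr_convex_nonneg:
  fixes p :: real
  assumes "1 \<le> p"
  shows "convex_on {0..} (\<lambda>x. x powr p)"
proof (rule convex_onI)
  fix t x y :: real assume t: "0 < t" "t < 1" and "x \<in> {0..}" "y \<in> {0..}"
  then have xy: "0 \<le> x" "0 \<le> y" by auto
  define z where "z = (1 - t) * x + t * y"
  have "z powr p \<le> (1 - t) * x powr p + t * y powr p"
  proof (cases "z = 0")
    case False
    moreover have "z \<ge> 0" unfolding z_def using t xy by (intro add_nonneg_nonneg) auto
    ultimately have "z > 0" by simp
    then have "z powr p = (1 - t) * (z powr p * (1 + p * (x / z - 1)))
        + t * (z powr p * (1 + p * (y / z - 1)))"
      by (simp add: field_simps) (simp add: z_def algebra_simps)
    also have "\<dots> \<le> (1 - t) * x powr p + t * y powr p"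
      using t xy \<open>z > 0\<close> assms by (intro add_mono mult_left_mono powr_ge_tangent) auto
    finally show ?thesis .
  qed (use t in simp)
  then show "((1 - t) *\<^sub>R x + t *\<^sub>R y) powr p \<le> (1 - t) * x powr p + t * y powr p"
    by (simp add: z_def)
qed simp

lemma powr_add_le_weighted:
  fixes a b u v p :: real
  assumes "0 < a" "0 < b" "0 \<le> u" "0 \<le> v" "1 \<le> p"
  shows "(u + v) powr p
    \<le> (a + b) powr p * (a / (a + b) * (u / a) powr p + b / (a + b) * (v / b) powr p)"
proof -
  have "(u + v) / (a + b) = a / (a + b) * (u / a) + b / (a + b) * (v / b)"
    using assms by (simp add: add_divide_distrib)
  moreover have "(a / (a + b) * (u / a) + b / (a + b) * (v / b)) powr p
      \<le> a / (a + b) * (u / a) powr p + b / (a + b) * (v / b) powr p"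
  proof -
    have "1 - b / (a + b) = a / (a + b)" using assms by (simp add: field_simps)
    then show ?thesis
      using convex_onD[OF powr_convex_nonneg[OF \<open>1 \<le> p\<close>], of "b / (a + b)" "u / a" "v / b"] assms by simp
  qed
  ultimately have "(a + b) powr p * ((u + v) / (a + b)) powr p
      \<le> (a + b) powr p * (a / (a + b) * (u / a) powr p + b / (a + b) * (v / b) powr p)"
    by (intro mult_left_mono) auto
  then show ?thesis using assms by (simp add: powr_divide)
qed

text \<open>The inequality \<open>\<parallel>f\<parallel>\<^sub>p \<le> a\<close>, in a form that needs no separate finiteness hypothesis.\<close>

definition Lp_bound :: "real \<Rightarrow> (real \<Rightarrow> complex) \<Rightarrow> real \<Rightarrow> bool" where
  "Lp_bound p f a \<longleftrightarrow> f \<in> borel_measurable borel \<and> 0 \<le> a \<and> Lp_pow p f \<le> ennreal (a powr p)"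

lemma Lp_bound_measurable: "Lp_bound p f a \<Longrightarrow> f \<in> borel_measurable borel"
  and Lp_bound_nonneg: "Lp_bound p f a \<Longrightarrow> 0 \<le> a"
  and Lp_bound_Lp_pow_le: "Lp_bound p f a \<Longrightarrow> Lp_pow p f \<le> ennreal (a powr p)"
  by (auto simp: Lp_bound_def)

lemma Lp_bound_mono: "Lp_bound p f a \<Longrightarrow> a \<le> b \<Longrightarrow> 0 \<le> p \<Longrightarrow> Lp_bound p f b"
  unfolding Lp_bound_def by (meson dual_order.trans ennreal_leI powr_mono2)

lemma Lp_bound_zero: "Lp_bound p (\<lambda>x. 0) 0"
  by (simp add: Lp_bound_def Lp_pow_def)

lemma Lp_bound_one: "Lp_bound p (\<lambda>x. 1) 1"
  by (simp add: Lp_bound_def Lp_pow_def)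

lemma Lp_bound_field_le_epsilon:
  assumes bound: "\<And>\<epsilon>. \<epsilon> > 0 \<Longrightarrow> Lp_bound p f (a + \<epsilon>)" and "0 \<le> a" "0 < p"
  shows "Lp_bound p f a"
proof -
  have "(\<lambda>n. ennreal ((a + inverse (real (Suc n))) powr p)) \<longlonglongrightarrow> ennreal ((a + 0) powr p)"
    using assms by (intro tendsto_ennrealI tendsto_powr' tendsto_intros LIMSEQ_inverse_real_of_nat)
      (auto intro!: always_eventually)
  moreover have "Lp_pow p f \<le> ennreal ((a + inverse (real (Suc n))) powr p)" for n
    by (rule Lp_bound_Lp_pow_le[OF bound]) simp
  ultimately have "Lp_pow p f \<le> ennreal ((a + 0) powr p)"
    using LIMSEQ_le_const by blast
  then show ?thesis
    using assms(2) Lp_bound_measurable[OF bound[of 1]] by (simp add: Lp_bound_def)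
qed

lemma Lp_pow_le_of_pointwise:
  assumes f: "Lp_bound p f a" and g: "Lp_bound r g b" and "0 \<le> A" "0 \<le> B"
    and pointwise: "\<And>x. cmod (h x) powr q \<le> A * cmod (f x) powr p + B * cmod (g x) powr r"
  shows "Lp_pow q h \<le> ennreal (A * a powr p + B * b powr r)"
proof -
  note [measurable] = Lp_bound_measurable[OF f] Lp_bound_measurable[OF g]
  have "Lp_pow q h
      \<le> (\<integral>\<^sup>+ x. ennreal A * (ennreal (cmod (f x) powr p) * indicator {0..1} x)
             + ennreal B * (ennreal (cmod (g x) powr r) * indicator {0..1} x) \<partial>lborel)"
    unfolding Lp_pow_def using assms
    by (intro nn_integral_mono)
      (auto simp: indicator_def ennreal_mult[symmetric] simp flip: ennreal_plus intro!: ennreal_leI)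
  also have "\<dots> = ennreal A * Lp_pow p f + ennreal B * Lp_pow r g"
    unfolding Lp_pow_def by (subst nn_integral_add) (auto simp: nn_integral_cmult)
  also have "\<dots> \<le> ennreal A * ennreal (a powr p) + ennreal B * ennreal (b powr r)"
    by (intro add_mono mult_left_mono Lp_bound_Lp_pow_le f g) auto
  also have "\<dots> = ennreal (A * a powr p + B * b powr r)"
    using assms by (simp add: ennreal_mult)
  finally show ?thesis .
qed

lemma Lp_bound_add_pos:
  assumes f: "Lp_bound p f a" and g: "Lp_bound p g b" and "0 < a" "0 < b" "1 \<le> p"
  shows "Lp_bound p (\<lambda>x. f x + g x) (a + b)"
proof -
  define A where "A = (a + b) powr p * (a / (a + b) / a powr p)"
  define B where "B = (a + b) powr p * (b / (a + b) / b powr p)"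
  have "Lp_pow p (\<lambda>x. f x + g x) \<le> ennreal (A * a powr p + B * b powr p)"
  proof (rule Lp_pow_le_of_pointwise[OF f g])
    fix x
    have "cmod (f x + g x) powr p \<le> (cmod (f x) + cmod (g x)) powr p"
      using assms by (intro powr_mono2 norm_triangle_ineq) auto
    also have "\<dots> \<le> A * cmod (f x) powr p + B * cmod (g x) powr p"
      using powr_add_le_weighted[of a b "cmod (f x)" "cmod (g x)" p] assms
      by (simp add: A_def B_def powr_divide algebra_simps)
    finally show "cmod (f x + g x) powr p \<le> A * cmod (f x) powr p + B * cmod (g x) powr p" .
  qed (use assms in \<open>auto simp: A_def B_def\<close>)
  also have "A * a powr p + B * b powr p = (a + b) powr p * ((a + b) / (a + b))"
    using assms unfolding A_def B_def add_divide_distrib distrib_left by simp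
  finally show ?thesis
    using assms by (auto simp: Lp_bound_def)
qed

lemma Lp_bound_add:
  assumes f: "Lp_bound p f a" and g: "Lp_bound p g b" and "1 \<le> p"
  shows "Lp_bound p (\<lambda>x. f x + g x) (a + b)"
proof (rule Lp_bound_field_le_epsilon)
  fix \<epsilon> :: real assume "\<epsilon> > 0"
  have nonneg: "0 \<le> a" "0 \<le> b" by (fact Lp_bound_nonneg[OF f] Lp_bound_nonneg[OF g])+
  have "Lp_bound p (\<lambda>x. f x + g x) ((a + \<epsilon> / 2) + (b + \<epsilon> / 2))"
  proof (rule Lp_bound_add_pos)
    show "Lp_bound p f (a + \<epsilon> / 2)" "Lp_bound p g (b + \<epsilon> / 2)"
      using \<open>\<epsilon> > 0\<close> \<open>1 \<le> p\<close> by (auto intro: Lp_bound_mono[OF f] Lp_bound_mono[OF g])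
  qed (use nonneg \<open>\<epsilon> > 0\<close> \<open>1 \<le> p\<close> in auto)
  then show "Lp_bound p (\<lambda>x. f x + g x) (a + b + \<epsilon>)" by (simp add: add_ac)
qed (use assms Lp_bound_nonneg[OF f] Lp_bound_nonneg[OF g] in auto)

lemma Lp_bound_sum:
  assumes "finite I" "\<And>i. i \<in> I \<Longrightarrow> Lp_bound p (f i) (a i)" "1 \<le> p"
  shows "Lp_bound p (\<lambda>x. \<Sum>i\<in>I. f i x) (\<Sum>i\<in>I. a i)"
  using assms by (induction I rule: finite_induct) (auto intro: Lp_bound_zero Lp_bound_add)

lemma Lp_bound_cmult:
  assumes f: "Lp_bound p f a"
  shows "Lp_bound p (\<lambda>x. c * f x) (cmod c * a)"
proof -
  note [measurable] = Lp_bound_measurable[OF f]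
  have "Lp_pow p (\<lambda>x. c * f x) \<le> ennreal (cmod c powr p * a powr p + 0 * a powr p)"
    by (rule Lp_pow_le_of_pointwise[OF f f]) (auto simp: norm_mult powr_mult)
  then show ?thesis
    using Lp_bound_nonneg[OF f] by (simp add: Lp_bound_def powr_mult)
qed

lemma Lp_bound_diff:
  assumes "Lp_bound p f a" "Lp_bound p g b" "1 \<le> p"
  shows "Lp_bound p (\<lambda>x. f x - g x) (a + b)"
  using Lp_bound_add[OF assms(1) Lp_bound_cmult[OF assms(2), of "-1"]] assms(3) by simp

lemma Lp_bound_minus_commute: "Lp_bound p (\<lambda>x. f x - g x) a \<longleftrightarrow> Lp_bound p (\<lambda>x. g x - f x) a"
  using borel_measurable_uminus_eq[of "\<lambda>x. f x - g x" borel]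
  by (simp add: Lp_bound_def Lp_pow_def norm_minus_commute)

lemma Lp_bound_lower_exponent:
  assumes f: "Lp_bound p f a" and "0 < q" "q \<le> p"
  shows "Lp_bound q f a"
proof (rule Lp_bound_field_le_epsilon)
  fix \<epsilon> :: real assume "\<epsilon> > 0"
  define b where "b = a + \<epsilon>"
  have b: "b > 0" using \<open>\<epsilon> > 0\<close> Lp_bound_nonneg[OF f] by (simp add: b_def)
  have f_b: "Lp_bound p f b" using \<open>\<epsilon> > 0\<close> assms by (intro Lp_bound_mono[OF f]) (auto simp: b_def)
  define A where "A = q / p * (b powr q / b powr p)"
  define B where "B = (1 - q / p) * b powr q"
  have "Lp_pow q f \<le> ennreal (A * b powr p + B * 1 powr p)"
  proof (rule Lp_pow_le_of_pointwise[OF f_b Lp_bound_one])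
    fix x
    define t where "t = cmod (f x) powr q"
    have "(b powr q) powr (p/q) * (1 + p/q * (t / b powr q - 1)) \<le> t powr (p/q)"
      using assms b by (intro powr_ge_tangent) (auto simp: t_def)
    then have "A * (b powr p * (1 + p/q * (t / b powr q - 1))) \<le> A * cmod (f x) powr p"
      using assms by (intro mult_left_mono) (auto simp: A_def t_def powr_powr)
    also have "A * (b powr p * (1 + p/q * (t / b powr q - 1))) = t - B"
      using assms b by (simp add: A_def B_def field_simps)
    finally show "cmod (f x) powr q \<le> A * cmod (f x) powr p + B * cmod 1 powr p"
      by (simp add: t_def)
  qed (use assms in \<open>auto simp: A_def B_def\<close>)
  also have "A * b powr p + B * 1 powr p = b powr q"
    using assms b by (simp add: A_def B_def field_simps)
  finally show "Lp_bound q f (a + \<epsilon>)"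
    using b Lp_bound_measurable[OF f] by (simp add: Lp_bound_def b_def)
qed (use assms Lp_bound_nonneg[OF f] in auto)

definition Lp_norm :: "real \<Rightarrow> (real \<Rightarrow> complex) \<Rightarrow> real" where
  "Lp_norm p f = enn2real (Lp_pow p f) powr (1 / p)"

lemma Lp_norm_nonneg: "0 \<le> Lp_norm p f"
  by (simp add: Lp_norm_def)

lemma Lp_norm_powr: "0 < p \<Longrightarrow> Lp_norm p f powr p = enn2real (Lp_pow p f)"
  by (simp add: Lp_norm_def powr_powr)

lemma Lp_norm_le:
  assumes "Lp_bound p f a" "0 < p"
  shows "Lp_norm p f \<le> a"
proof -
  have "Lp_norm p f \<le> (a powr p) powr (1 / p)"
    unfolding Lp_norm_def using assms by (intro powr_mono2 enn2real_leI) (auto simp: Lp_bound_def)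
  then show ?thesis using assms by (simp add: powr_powr Lp_bound_def)
qed

lemma Lp_bound_Lp_norm:
  assumes "Lp_bound p f a" "0 < p"
  shows "Lp_bound p f (Lp_norm p f)"
proof -
  have "Lp_pow p f < \<infinity>" using Lp_bound_Lp_pow_le[OF assms(1)] by (rule le_less_trans) simp
  then show ?thesis
    using assms by (simp add: Lp_bound_def Lp_norm_powr Lp_norm_nonneg)
qed

lemma Lp_norm_mono_exponent:
  assumes "Lp_bound p f a" "0 < q" "q \<le> p"
  shows "Lp_norm q f \<le> Lp_norm p f"
  using Lp_bound_lower_exponent[OF Lp_bound_Lp_norm[OF assms(1)]] assms by (auto intro: Lp_norm_le)

lemma le_enn2real_Lp_pow:
  assumes "Lp_bound p f a" "ennreal v \<le> Lp_pow p f"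
  shows "v \<le> enn2real (Lp_pow p f)"
proof -
  have "Lp_pow p f < \<infinity>" using Lp_bound_Lp_pow_le[OF assms(1)] by (rule le_less_trans) simp
  then have "enn2real (ennreal v) \<le> enn2real (Lp_pow p f)"
    by (intro enn2real_mono assms(2)) simp
  moreover have "v \<le> enn2real (ennreal v)" by (cases "0 \<le> v") (auto simp: ennreal_neg)
  ultimately show ?thesis by linarith
qed

lemma powr_le_enn2real_Lp_pow:
  assumes bound: "Lp_bound p f a" and "0 < q" "q \<le> p" "0 \<le> v" and v: "ennreal v \<le> Lp_pow q f"
  shows "v powr (p / q) \<le> enn2real (Lp_pow p f)"
proof -
  have "v \<le> Lp_norm q f powr q"
    using le_enn2real_Lp_pow[OF Lp_bound_lower_exponent[OF bound] v] assms by (simp add: Lp_norm_powr)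
  also have "\<dots> \<le> Lp_norm p f powr q"
    using assms by (intro powr_mono2 Lp_norm_mono_exponent[OF bound] Lp_norm_nonneg) auto
  finally have "v powr (p / q) \<le> (Lp_norm p f powr q) powr (p / q)"
    using assms by (intro powr_mono2) auto
  then show ?thesis using assms by (simp add: powr_powr Lp_norm_powr)
qed

section \<open>Limits in \<open>L\<^sup>p\<close>\<close>

lemma Lp_limit_iff_eventually_Lp_bound:
  assumes [measurable]: "\<And>M. S M \<in> borel_measurable borel" and "0 < p"
  shows "Lp_limit p S g \<longleftrightarrow> g \<in> borel_measurable borel \<and>
    (\<forall>\<epsilon>>0. \<forall>\<^sub>F M in sequentially. Lp_bound p (\<lambda>x. S M x - g x) \<epsilon>)"
proof (intro iffI conjI allI impI)
  assume lim: "Lp_limit p S g"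
  then show "g \<in> borel_measurable borel" by (simp add: Lp_limit_def)
  note [measurable] = this
  fix \<epsilon> :: real assume "\<epsilon> > 0"
  have "\<forall>\<^sub>F M in sequentially. Lp_pow p (\<lambda>x. S M x - g x) < ennreal (\<epsilon> powr p)"
    using lim \<open>\<epsilon> > 0\<close> unfolding Lp_limit_def by (intro order_tendstoD(2)) auto
  then show "\<forall>\<^sub>F M in sequentially. Lp_bound p (\<lambda>x. S M x - g x) \<epsilon>"
    by eventually_elim (use \<open>\<epsilon> > 0\<close> in \<open>auto simp: Lp_bound_def\<close>)
next
  assume bound: "g \<in> borel_measurable borel \<and>
    (\<forall>\<epsilon>>0. \<forall>\<^sub>F M in sequentially. Lp_bound p (\<lambda>x. S M x - g x) \<epsilon>)"
  have "(\<lambda>M. Lp_pow p (\<lambda>x. S M x - g x)) \<longlonglongrightarrow> 0"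
  proof (rule order_tendstoI)
    fix y :: ennreal assume "0 < y"
    then obtain r where r: "0 < ennreal r" "ennreal r < y"
      using dense[of 0 y] by (metis ennreal_cases less_top_ennreal order_less_imp_not_less top_greatest leD)
    have "\<forall>\<^sub>F M in sequentially. Lp_bound p (\<lambda>x. S M x - g x) (r powr (1 / p))"
      using bound r(1) by simp
    then show "\<forall>\<^sub>F M in sequentially. Lp_pow p (\<lambda>x. S M x - g x) < y"
      by eventually_elim (use r \<open>0 < p\<close> in \<open>auto simp: Lp_bound_def powr_powr\<close>)
  qed simp
  then show "Lp_limit p S g" using bound by (simp add: Lp_limit_def)
qed

lemma Lp_limit_lower_exponent:
  assumes "Lp_limit p S g" "\<And>M. S M \<in> borel_measurable borel" "0 < q" "q \<le> p"
  shows "Lp_limit q S g"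
proof -
  have "\<forall>\<^sub>F M in sequentially. Lp_bound p (\<lambda>x. S M x - g x) \<epsilon>" if "\<epsilon> > 0" for \<epsilon>
    using assms that by (auto simp: Lp_limit_iff_eventually_Lp_bound)
  moreover have "g \<in> borel_measurable borel" using assms(1) by (simp add: Lp_limit_def)
  ultimately show ?thesis
    using assms by (auto simp: Lp_limit_iff_eventually_Lp_bound intro: eventually_mono Lp_bound_lower_exponent)
qed

lemma Lp_bound_Lp_limit:
  assumes lim: "Lp_limit p S g" and bound: "\<And>M. Lp_bound p (S M) a" and "1 \<le> p"
  shows "Lp_bound p g a"
proof (rule Lp_bound_field_le_epsilon)
  fix \<epsilon> :: real assume "\<epsilon> > 0"
  have "\<forall>\<^sub>F M in sequentially. Lp_bound p (\<lambda>x. S M x - g x) \<epsilon>"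
    using lim \<open>\<epsilon> > 0\<close> \<open>1 \<le> p\<close> Lp_bound_measurable[OF bound]
    by (simp add: Lp_limit_iff_eventually_Lp_bound)
  then obtain M where "Lp_bound p (\<lambda>x. S M x - g x) \<epsilon>"
    using eventually_happens'[OF sequentially_bot] by blast
  from Lp_bound_diff[OF bound this \<open>1 \<le> p\<close>, of M] show "Lp_bound p g (a + \<epsilon>)" by simp
qed (use Lp_bound_nonneg[OF bound] \<open>1 \<le> p\<close> in auto)

lemma Lp_norm_tendsto:
  assumes lim: "Lp_limit p S g" and bound: "\<And>M. Lp_bound p (S M) a" and "1 \<le> p"
  shows "(\<lambda>M. Lp_norm p (S M)) \<longlonglongrightarrow> Lp_norm p g"
proof (rule tendstoI)
  fix \<epsilon> :: real assume "\<epsilon> > 0"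
  have norm_S: "Lp_bound p (S M) (Lp_norm p (S M))" for M
    using \<open>1 \<le> p\<close> by (intro Lp_bound_Lp_norm[OF bound]) simp
  have norm_g: "Lp_bound p g (Lp_norm p g)"
    using \<open>1 \<le> p\<close> by (intro Lp_bound_Lp_norm[OF Lp_bound_Lp_limit[OF assms]]) simp
  have "\<forall>\<^sub>F M in sequentially. Lp_bound p (\<lambda>x. S M x - g x) (\<epsilon> / 2)"
    using lim \<open>\<epsilon> > 0\<close> \<open>1 \<le> p\<close> Lp_bound_measurable[OF bound]
    by (simp add: Lp_limit_iff_eventually_Lp_bound)
  then show "\<forall>\<^sub>F M in sequentially. dist (Lp_norm p (S M)) (Lp_norm p g) < \<epsilon>"
  proof eventually_elim
    case (elim M)
    have "Lp_norm p g \<le> Lp_norm p (S M) + \<epsilon> / 2"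
      using Lp_norm_le[OF Lp_bound_diff[OF norm_S[of M] elim]] \<open>1 \<le> p\<close> by simp
    moreover have "Lp_norm p (S M) \<le> Lp_norm p g + \<epsilon> / 2"
      using Lp_norm_le[OF Lp_bound_add[OF norm_g elim]] \<open>1 \<le> p\<close> by simp
    ultimately show ?case using \<open>\<epsilon> > 0\<close> by (auto simp: dist_real_def)
  qed
qed

lemma enn2real_Lp_pow_tendsto:
  assumes "Lp_limit p S g" "\<And>M. Lp_bound p (S M) a" "1 \<le> p"
  shows "(\<lambda>M. enn2real (Lp_pow p (S M))) \<longlonglongrightarrow> enn2real (Lp_pow p g)"
proof -
  have "(\<lambda>M. Lp_norm p (S M) powr p) \<longlonglongrightarrow> Lp_norm p g powr p"
    using Lp_norm_tendsto[OF assms] assms(3)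
    by (intro tendsto_powr') (auto intro: always_eventually Lp_norm_nonneg)
  then show ?thesis using assms(3) by (simp add: Lp_norm_powr)
qed

lemma AE_convergent_of_summable_Lp_bound:
  assumes bound: "\<And>k. Lp_bound p (\<lambda>x. S (Suc k) x - S k x) (a k)" and "summable a" "1 \<le> p"
  shows "AE x in lborel. x \<in> {0..1} \<longrightarrow> convergent (\<lambda>k. S k x)"
proof -
  define f where "f k x = S (Suc k) x - S k x" for k x
  have L1: "Lp_bound 1 (f k) (a k)" for k
    unfolding f_def using \<open>1 \<le> p\<close> by (intro Lp_bound_lower_exponent[OF bound]) auto
  note [measurable] = Lp_bound_measurable[OF L1]
  have "(\<integral>\<^sup>+ x. (\<Sum>k. ennreal (cmod (f k x)) * indicator {0..1} x) \<partial>lborel)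
     = (\<Sum>k. \<integral>\<^sup>+ x. ennreal (cmod (f k x)) * indicator {0..1} x \<partial>lborel)"
    by (rule nn_integral_suminf) measurable
  also have "\<dots> \<le> (\<Sum>k. ennreal (a k))"
    using Lp_bound_Lp_pow_le[OF L1] Lp_bound_nonneg[OF L1] by (intro suminf_le) (auto simp: Lp_pow_def)
  also have "\<dots> = ennreal (\<Sum>k. a k)"
    using \<open>summable a\<close> Lp_bound_nonneg[OF L1] by (intro suminf_ennreal_eq summable_sums) auto
  also have "\<dots> < \<infinity>" by simp
  finally have finite_integral: "(\<integral>\<^sup>+ x. (\<Sum>k. ennreal (cmod (f k x)) * indicator {0..1} x) \<partial>lborel) \<noteq> \<infinity>"
    by simp
  have "AE x in lborel. (\<Sum>k. ennreal (cmod (f k x)) * indicator {0..1} x) \<noteq> \<infinity>"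
    by (rule nn_integral_PInf_AE[OF _ finite_integral]) measurable
  then show ?thesis
  proof (rule AE_mp, intro AE_I2 impI)
    fix x :: real assume "(\<Sum>k. ennreal (cmod (f k x)) * indicator {0..1} x) \<noteq> \<infinity>" "x \<in> {0..1}"
    then have "summable (\<lambda>k. f k x)"
      by (intro summable_norm_cancel[OF summable_suminf_not_top]) auto
    then have "convergent (\<lambda>k. \<Sum>j<k. f j x)" by (simp add: summable_iff_convergent)
    moreover have "(\<Sum>j<k. f j x) + S 0 x = S k x" for k
      unfolding f_def by (subst sum_lessThan_telescope) simp
    ultimately show "convergent (\<lambda>k. S k x)"
      using convergent_add[OF _ convergent_const, of "\<lambda>k. \<Sum>j<k. f j x" "S 0 x"] by simp
  qed
qed

lemma Lp_bound_Fatou: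
  assumes conv: "AE x in lborel. x \<in> {0..1} \<longrightarrow> (\<lambda>k. f k x) \<longlonglongrightarrow> g x"
    and bound: "\<And>k. Lp_bound p (f k) a" and [measurable]: "g \<in> borel_measurable borel" and "0 < p"
  shows "Lp_bound p g a"
proof -
  note [measurable] = Lp_bound_measurable[OF bound]
  have "Lp_pow p g \<le> (\<integral>\<^sup>+ x. liminf (\<lambda>k. ennreal (cmod (f k x) powr p) * indicator {0..1} x) \<partial>lborel)"
    unfolding Lp_pow_def
  proof (rule nn_integral_mono_AE, rule AE_mp[OF conv], intro AE_I2 impI)
    fix x :: real assume "x \<in> {0..1} \<longrightarrow> (\<lambda>k. f k x) \<longlonglongrightarrow> g x"
    then have "(\<lambda>k. ennreal (cmod (f k x) powr p) * indicator {0..1} x)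
        \<longlonglongrightarrow> ennreal (cmod (g x) powr p) * indicator {0..1} x"
      using \<open>0 < p\<close> by (cases "x \<in> {0..1}")
        (auto intro!: tendsto_ennrealI tendsto_powr' tendsto_intros always_eventually)
    then show "ennreal (cmod (g x) powr p) * indicator {0..1} x
       \<le> liminf (\<lambda>k. ennreal (cmod (f k x) powr p) * indicator {0..1} x)"
      by (simp add: lim_imp_Liminf)
  qed
  also have "\<dots> \<le> liminf (\<lambda>k. Lp_pow p (f k))"
    unfolding Lp_pow_def by (rule nn_integral_liminf) measurable
  also have "\<dots> \<le> ennreal (a powr p)"
    by (rule Liminf_le) (auto intro: always_eventually Lp_bound_Lp_pow_le[OF bound])
  finally show ?thesis using Lp_bound_nonneg[OF bound] by (simp add: Lp_bound_def)
qed

lemma ex_Lp_limit_of_Cauchy: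
  assumes cauchy: "\<And>M N. L \<le> M \<Longrightarrow> M \<le> N \<Longrightarrow> Lp_bound p (\<lambda>x. S N x - S M x) (\<epsilon> M)"
    and "\<epsilon> \<longlonglongrightarrow> 0" and [measurable]: "\<And>M. S M \<in> borel_measurable borel" and "1 \<le> p"
  shows "\<exists>g. Lp_limit p S g"
proof -
  have "\<forall>k. \<exists>N. \<forall>M\<ge>N. \<epsilon> M < (1/2) ^ k"
    using order_tendstoD(2)[OF \<open>\<epsilon> \<longlonglongrightarrow> 0\<close>] by (auto simp: eventually_sequentially)
  then obtain N where N: "\<And>k M. N k \<le> M \<Longrightarrow> \<epsilon> M < (1/2) ^ k" by metis
  define r where "r k = L + k + (\<Sum>i\<le>k. N i)" for k
  have r: "k \<le> r k" "L \<le> r k" "N k \<le> r k" "r k \<le> r (Suc k)" for k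
    using member_le_sum[of k "{..k}" N] by (auto simp: r_def)
  have step: "Lp_bound p (\<lambda>x. S (r (Suc k)) x - S (r k) x) ((1/2) ^ k)" for k
    using N[OF r(3), of k] r \<open>1 \<le> p\<close> by (intro Lp_bound_mono[OF cauchy]) auto
  define g where "g x = lim (\<lambda>k. S (r k) x)" for x
  have [measurable]: "g \<in> borel_measurable borel" unfolding g_def by measurable
  have conv: "AE x in lborel. x \<in> {0..1} \<longrightarrow> (\<lambda>k. S (r k) x) \<longlonglongrightarrow> g x"
    using AE_convergent_of_summable_Lp_bound[of p "\<lambda>k. S (r k)", OF step _ \<open>1 \<le> p\<close>]
    by (auto simp: g_def convergent_LIMSEQ_iff)
  have bound: "Lp_bound p (\<lambda>x. g x - S M x) (\<epsilon> M)" if "L \<le> M" for M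
  proof (rule Lp_bound_Fatou)
    show "AE x in lborel. x \<in> {0..1} \<longrightarrow> (\<lambda>k. S (r (k + M)) x - S M x) \<longlonglongrightarrow> g x - S M x"
      using conv by eventually_elim (auto intro!: tendsto_intros LIMSEQ_ignore_initial_segment)
    show "Lp_bound p (\<lambda>x. S (r (k + M)) x - S M x) (\<epsilon> M)" for k
      using that r(1)[of "k + M"] by (intro cauchy) auto
  qed (use \<open>1 \<le> p\<close> in auto)
  have "\<forall>\<^sub>F M in sequentially. Lp_bound p (\<lambda>x. S M x - g x) \<delta>" if "\<delta> > 0" for \<delta>
    using order_tendstoD(2)[OF \<open>\<epsilon> \<longlonglongrightarrow> 0\<close> that] eventually_ge_at_top[of L]
  proof eventually_elim
    case (elim M)
    then have "Lp_bound p (\<lambda>x. g x - S M x) \<delta>"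
      using \<open>1 \<le> p\<close> by (intro Lp_bound_mono[OF bound]) auto
    then show ?case by (subst Lp_bound_minus_commute)
  qed
  then have "Lp_limit p S g"
    using \<open>1 \<le> p\<close> by (simp add: Lp_limit_iff_eventually_Lp_bound)
  then show ?thesis by blast
qed

section \<open>Trigonometric polynomials\<close>

definition unit_exp :: "real \<Rightarrow> complex" where
  "unit_exp x = cis (2 * pi * x)"

lemma unit_exp_add: "unit_exp (x + y) = unit_exp x * unit_exp y"
  by (simp add: unit_exp_def cis_mult algebra_simps)

lemma cnj_unit_exp: "cnj (unit_exp x) = unit_exp (- x)"
  by (simp add: unit_exp_def cis_cnj)

lemma norm_unit_exp [simp]: "cmod (unit_exp x) = 1"
  by (simp add: unit_exp_def)

lemma unit_exp_int [simp]: "unit_exp (of_int k) = 1"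
  by (auto simp: unit_exp_def complex_eq_iff intro: cos_int_2pin sin_int_2pin)

lemma unit_exp_0 [simp]: "unit_exp 0 = 1"
  by (simp add: unit_exp_def)

lemma unit_exp_add_int: "unit_exp (of_int k + x) = unit_exp x"
  by (simp add: unit_exp_add)

lemma unit_exp_power: "unit_exp x ^ n = unit_exp (real n * x)"
  by (simp add: unit_exp_def Complex.DeMoivre mult_ac)

lemma continuous_on_unit_exp [continuous_intros]:
  "continuous_on S f \<Longrightarrow> continuous_on S (\<lambda>x. unit_exp (f x))"
  unfolding unit_exp_def by (intro continuous_intros)

lemma norm_one_minus_unit_exp: "cmod (1 - unit_exp x) = 2 * \<bar>sin (pi * x)\<bar>"
  using dist_exp_i_1[of "2 * pi * x"] by (simp add: unit_exp_def cis_conv_exp norm_minus_commute)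

lemma has_integral_unit_exp:
  "((\<lambda>x. unit_exp (of_int k * x)) has_integral (if k = 0 then 1 else 0)) {0..1}"
proof (cases "k = 0")
  case True
  then show ?thesis using has_integral_const_real[of "1::complex" 0 1] by simp
next
  case False
  define \<omega> where "\<omega> = 2 * pi * of_int k"
  have "\<omega> \<noteq> 0" using False by (simp add: \<omega>_def)
  have "((\<lambda>x. cis (\<omega> * x) / (\<i> * of_real \<omega>)) has_vector_derivative
      unit_exp (of_int k * x)) (at x within {0..1})" for x
  proof -
    have "((\<lambda>x. cis (\<omega> * x) / (\<i> * of_real \<omega>)) has_vector_derivative
        (of_real \<omega> * \<i> * cis (\<omega> * x)) / (\<i> * of_real \<omega>)) (at x within {0..1})"
      unfolding has_vector_derivative_def
      by (rule has_derivative_eq_rhs, (rule derivative_intros)+)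
         (use \<open>\<omega> \<noteq> 0\<close> in \<open>auto simp: fun_eq_iff scaleR_conv_of_real field_simps\<close>)
    then show ?thesis using \<open>\<omega> \<noteq> 0\<close> by (simp add: unit_exp_def \<omega>_def mult.assoc)
  qed
  then have "((\<lambda>x. unit_exp (of_int k * x)) has_integral
      (cis (\<omega> * 1) / (\<i> * of_real \<omega>) - cis (\<omega> * 0) / (\<i> * of_real \<omega>))) {0..1}"
    by (intro fundamental_theorem_of_calculus) auto
  moreover have "cis (\<omega> * 1) = 1" using unit_exp_int[of k] by (simp add: unit_exp_def \<omega>_def)
  ultimately show ?thesis using False by simp
qed

lemma has_integral_trig_poly_mult_cnj:
  fixes k :: "'i \<Rightarrow> int" and l :: "'j \<Rightarrow> int" and c :: "'i \<Rightarrow> complex" and d :: "'j \<Rightarrow> complex"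
  assumes "finite I" "finite J"
  shows "((\<lambda>x. (\<Sum>i\<in>I. c i * unit_exp (of_int (k i) * x)) * cnj (\<Sum>j\<in>J. d j * unit_exp (of_int (l j) * x)))
    has_integral (\<Sum>i\<in>I. \<Sum>j\<in>J. if k i = l j then c i * cnj (d j) else 0)) {0..1}"
proof -
  have "(\<Sum>i\<in>I. c i * unit_exp (of_int (k i) * x)) * cnj (\<Sum>j\<in>J. d j * unit_exp (of_int (l j) * x))
      = (\<Sum>i\<in>I. \<Sum>j\<in>J. c i * cnj (d j) * unit_exp (of_int (k i - l j) * x))" for x
  proof -
    have "unit_exp (of_int (k i - l j) * x)
        = unit_exp (of_int (k i) * x) * unit_exp (- (of_int (l j) * x))" for i j
      by (simp flip: unit_exp_add add: algebra_simps)
    then show ?thesis by (simp add: sum_product cnj_unit_exp mult_ac)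
  qed
  moreover have "((\<lambda>x. \<Sum>i\<in>I. \<Sum>j\<in>J. c i * cnj (d j) * unit_exp (of_int (k i - l j) * x)) has_integral
      (\<Sum>i\<in>I. \<Sum>j\<in>J. c i * cnj (d j) * (if k i - l j = 0 then 1 else 0))) {0..1}"
    by (intro has_integral_sum assms has_integral_mult_right has_integral_unit_exp)
  moreover have "c i * cnj (d j) * (if k i - l j = 0 then 1 else 0)
      = (if k i = l j then c i * cnj (d j) else 0)" for i j
    by simp
  ultimately show ?thesis by simp
qed

lemma has_integral_norm_square_trig_poly:
  fixes k :: "'i \<Rightarrow> int" and c :: "'i \<Rightarrow> real"
  assumes "finite I"
  shows "((\<lambda>x. (cmod (\<Sum>i\<in>I. of_real (c i) * unit_exp (of_int (k i) * x)))\<^sup>2) has_integral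
     (\<Sum>i\<in>I. \<Sum>j\<in>I. if k i = k j then c i * c j else 0)) {0..1}"
proof -
  have "(\<Sum>i\<in>I. \<Sum>j\<in>I. if k i = k j then complex_of_real (c i) * cnj (of_real (c j)) else 0)
      = of_real (\<Sum>i\<in>I. \<Sum>j\<in>I. if k i = k j then c i * c j else 0)"
    by (auto intro!: sum.cong)
  then show ?thesis
    using has_integral_Re[OF has_integral_trig_poly_mult_cnj[OF assms assms,
        of "\<lambda>i. of_real (c i)" k "\<lambda>i. of_real (c i)" k]]
    by (simp only: complex_norm_square[symmetric] Re_complex_of_real)
qed

lemma Lp_pow_eq_of_has_integral:
  assumes "((\<lambda>x. cmod (f x) powr p) has_integral I) {0..1}"
  shows "Lp_pow p f = ennreal I"
  unfolding Lp_pow_def by (rule nn_integral_has_integral_lebesgue'[OF _ assms]) simp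

lemma Lp_pow_2_trig_poly:
  fixes k :: "'i \<Rightarrow> int" and c :: "'i \<Rightarrow> real"
  assumes "finite I" "inj_on k I"
  shows "Lp_pow 2 (\<lambda>x. \<Sum>i\<in>I. of_real (c i) * unit_exp (of_int (k i) * x)) = ennreal (\<Sum>i\<in>I. (c i)\<^sup>2)"
proof -
  have "(\<Sum>i\<in>I. \<Sum>j\<in>I. if k i = k j then c i * c j else 0) = (\<Sum>i\<in>I. \<Sum>j\<in>I. if i = j then c i * c j else 0)"
    using assms(2) by (intro sum.cong) (auto dest: inj_onD)
  also have "\<dots> = (\<Sum>i\<in>I. (c i)\<^sup>2)"
    using assms(1) by (simp add: power2_eq_square)
  finally show ?thesis
    using has_integral_norm_square_trig_poly[OF assms(1), of c k]
    by (intro Lp_pow_eq_of_has_integral) simp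
qed

definition Fejer_kernel :: "nat \<Rightarrow> real \<Rightarrow> real" where
  "Fejer_kernel Q x = (cmod (\<Sum>m<Q. unit_exp (of_int (int m) * x)))\<^sup>2 / real Q"

lemma Fejer_kernel_nonneg: "0 \<le> Fejer_kernel Q x"
  by (simp add: Fejer_kernel_def)

lemma Fejer_kernel_le: "Fejer_kernel Q x \<le> real Q"
proof -
  have "cmod (\<Sum>m<Q. unit_exp (of_int (int m) * x)) \<le> (\<Sum>m<Q. cmod (unit_exp (of_int (int m) * x)))"
    by (rule norm_sum)
  then have "(cmod (\<Sum>m<Q. unit_exp (of_int (int m) * x)))\<^sup>2 \<le> (real Q)\<^sup>2"
    by (intro power_mono) auto
  then show ?thesis by (cases "Q = 0") (simp_all add: Fejer_kernel_def power2_eq_square divide_le_eq)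
qed

lemma has_integral_unit_exp_mult_Fejer_kernel:
  "((\<lambda>x. Re (unit_exp (of_int (int n) * x)) * Fejer_kernel Q x) has_integral
      real (Q - n) / real Q) {0..1}"
proof -
  have "Re (unit_exp (of_int (int n) * x)) * Fejer_kernel Q x
      = Re ((\<Sum>m<Q. 1 * unit_exp (of_int (int m + int n) * x))
          * cnj (\<Sum>m<Q. 1 * unit_exp (of_int (int m) * x))) / real Q" for x
  proof -
    have "(\<Sum>m<Q. 1 * unit_exp (of_int (int m + int n) * x))
        = unit_exp (of_int (int n) * x) * (\<Sum>m<Q. unit_exp (of_int (int m) * x))"
      unfolding sum_distrib_left of_int_add distrib_right unit_exp_add by (simp add: mult.commute)
    moreover have "Re (w * z * cnj z) = Re w * (cmod z)\<^sup>2" for w z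
      unfolding mult.assoc complex_norm_square[symmetric] by simp
    ultimately show ?thesis by (simp only: Fejer_kernel_def mult_1 times_divide_eq_right)
  qed
  moreover have "(\<Sum>m<Q. \<Sum>m'<Q. if int m + int n = int m' then 1 * cnj 1 else 0) = of_nat (Q - n)"
  proof -
    have "(\<Sum>m'<Q. if int m + int n = int m' then 1 * cnj 1 else 0) = (if m < Q - n then 1 else 0)" for m
    proof -
      have "(\<Sum>m'<Q. if int m + int n = int m' then 1 * cnj 1 else 0)
          = (\<Sum>m'<Q. if m' = m + n then 1 else (0::complex))"
        by (intro sum.cong) auto
      then show ?thesis by auto
    qed
    moreover have "(\<Sum>m<Q. if m < Q - n then 1 else 0) = (\<Sum>m<Q - n. 1 :: complex)"
      by (rule sum.mono_neutral_cong_right) auto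
    ultimately show ?thesis by simp
  qed
  ultimately show ?thesis
    using has_integral_Re[OF has_integral_trig_poly_mult_cnj[of "{..<Q}" "{..<Q}" "\<lambda>_. 1"
      "\<lambda>m. int m + int n" "\<lambda>_. 1" int]]
    by (simp del: mult_1 complex_cnj_one mult_1_right add: has_integral_divide)
qed

lemma has_integral_Fejer_kernel:
  assumes "Q > 0"
  shows "(Fejer_kernel Q has_integral 1) {0..1}"
  using has_integral_unit_exp_mult_Fejer_kernel[of 0 Q] assms by simp

section \<open>Weyl differencing with tent weights\<close>

definition fdiff :: "(nat \<Rightarrow> 'a::minus) \<Rightarrow> nat \<Rightarrow> 'a" where
  "fdiff f n = f (Suc n) - f n"

lemma sum_mult_power_by_parts:
  fixes v :: "nat \<Rightarrow> 'a::comm_ring_1"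
  shows "(1 - z) * (\<Sum>m<M. v m * z ^ m) = v 0 - v M * z ^ M + z * (\<Sum>m<M. fdiff v m * z ^ m)"
proof (induction M)
  case (Suc M)
  have "(1 - z) * (\<Sum>m<Suc M. v m * z ^ m) = (1 - z) * (\<Sum>m<M. v m * z ^ m) + (1 - z) * (v M * z ^ M)"
    by (simp add: distrib_left)
  also have "\<dots> = v 0 - v (Suc M) * z ^ Suc M + z * (\<Sum>m<Suc M. fdiff v m * z ^ m)"
    unfolding Suc.IH by (simp add: fdiff_def algebra_simps)
  finally show ?case .
qed simp

lemma fdiff_fdiff_mult:
  fixes f g :: "nat \<Rightarrow> 'a::comm_ring_1"
  shows "fdiff (fdiff (\<lambda>m. f m * g m)) m
    = g (m + 2) * fdiff (fdiff f) m + f m * fdiff (fdiff g) m + 2 * fdiff g (m + 1) * fdiff f m"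
  by (simp add: fdiff_def algebra_simps)

lemma norm_power_sum_le_second_difference:
  fixes v :: "nat \<Rightarrow> real" and z :: complex
  assumes "v 0 = 0" "v M = 0" "v (Suc M) = 0" "cmod z = 1"
  shows "(cmod (1 - z))\<^sup>2 * cmod (\<Sum>m<M. of_real (v m) * z ^ m) \<le> \<bar>v 1\<bar> + (\<Sum>m<M. \<bar>fdiff (fdiff v) m\<bar>)"
proof -
  define u where "u m = complex_of_real (v m)" for m
  have u: "u 0 = 0" "u M = 0" "fdiff u 0 = of_real (v 1)" "fdiff u M = 0"
    using assms by (simp_all add: u_def fdiff_def)
  have "(1 - z)\<^sup>2 * (\<Sum>m<M. u m * z ^ m) = z * ((1 - z) * (\<Sum>m<M. fdiff u m * z ^ m))"
    using sum_mult_power_by_parts[where z = z and M = M and v = u] u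
    by (simp add: power2_eq_square mult_ac)
  also have "\<dots> = z * (of_real (v 1) + z * (\<Sum>m<M. fdiff (fdiff u) m * z ^ m))"
    using sum_mult_power_by_parts[where z = z and M = M and v = "fdiff u"] u by simp
  finally have "cmod ((1 - z)\<^sup>2 * (\<Sum>m<M. u m * z ^ m))
      = cmod (z * (of_real (v 1) + z * (\<Sum>m<M. fdiff (fdiff u) m * z ^ m)))"
    by (rule arg_cong[where f = cmod])
  then have "(cmod (1 - z))\<^sup>2 * cmod (\<Sum>m<M. u m * z ^ m)
      = cmod (of_real (v 1) + z * (\<Sum>m<M. fdiff (fdiff u) m * z ^ m))"
    by (simp only: norm_mult norm_power assms(4) mult_1)
  also have "\<dots> \<le> cmod (of_real (v 1)) + cmod (z * (\<Sum>m<M. fdiff (fdiff u) m * z ^ m))"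
    by (rule norm_triangle_ineq)
  also have "\<dots> = \<bar>v 1\<bar> + cmod (\<Sum>m<M. fdiff (fdiff u) m * z ^ m)"
    by (simp add: norm_mult assms(4))
  also have "cmod (\<Sum>m<M. fdiff (fdiff u) m * z ^ m) \<le> (\<Sum>m<M. cmod (fdiff (fdiff u) m * z ^ m))"
    by (rule norm_sum)
  also have "\<dots> = (\<Sum>m<M. \<bar>fdiff (fdiff v) m\<bar>)"
    using assms(4) by (simp add: norm_mult norm_power u_def fdiff_def flip: of_real_diff)
  finally show ?thesis by (simp add: u_def)
qed

definition tent :: "real \<Rightarrow> real \<Rightarrow> real" where
  "tent w t = max 0 (1 - \<bar>t - w\<bar> / w)"

lemma tent_nonneg: "0 \<le> tent w t"
  by (simp add: tent_def)

lemma tent_le_1: "w > 0 \<Longrightarrow> tent w t \<le> 1"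
  by (simp add: tent_def)

lemma tent_0: "w > 0 \<Longrightarrow> tent w 0 = 0"
  by (simp add: tent_def)

lemma tent_eq_0: "w > 0 \<Longrightarrow> 2 * w \<le> t \<Longrightarrow> tent w t = 0"
  by (simp add: tent_def field_simps)

lemma tent_eq_ramps:
  assumes "w > 0"
  shows "tent w t = (max 0 t - 2 * max 0 (t - w) + max 0 (t - 2 * w)) / w"
  using assms by (auto simp: tent_def max_def abs_if field_simps)

lemma abs_fdiff_tent_le:
  assumes "w > 0"
  shows "\<bar>fdiff (\<lambda>m. tent w (real (m + h))) m\<bar> \<le> 1 / w"
proof -
  define t where "t = real (m + h)"
  have "\<bar>tent w (t + 1) - tent w t\<bar> \<le> \<bar>\<bar>t + 1 - w\<bar> / w - \<bar>t - w\<bar> / w\<bar>"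
    by (auto simp: tent_def max_def abs_if)
  also have "\<dots> = \<bar>\<bar>t + 1 - w\<bar> - \<bar>t - w\<bar>\<bar> / w"
    using assms by (simp flip: diff_divide_distrib)
  also have "\<dots> \<le> 1 / w"
    using assms by (intro divide_right_mono) auto
  finally show ?thesis by (simp add: fdiff_def t_def add_ac)
qed

lemma sum_abs_fdiff_fdiff_ramp_le:
  "(\<Sum>m<M. \<bar>fdiff (fdiff (\<lambda>m. max 0 (real m - c))) m\<bar>) \<le> 1"
proof -
  define slope where "slope = fdiff (\<lambda>m. max 0 (real m - c))"
  have slope: "0 \<le> slope m" "slope m \<le> 1" "slope m \<le> slope (Suc m)" for m
    by (auto simp: slope_def fdiff_def max_def)
  have "(\<Sum>m<M. \<bar>fdiff slope m\<bar>) = (\<Sum>m<M. slope (Suc m) - slope m)"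
    using slope(3) by (simp add: fdiff_def)
  also have "\<dots> = slope M - slope 0" by (rule sum_lessThan_telescope)
  also have "\<dots> \<le> 1" using slope(1)[of 0] slope(2)[of M] by linarith
  finally show ?thesis by (simp add: slope_def)
qed

lemma sum_abs_fdiff_fdiff_tent_le:
  assumes "w > 0"
  shows "(\<Sum>m<M. \<bar>fdiff (fdiff (\<lambda>m. tent w (real (m + h)))) m\<bar>) \<le> 4 / w"
proof -
  define kink where "kink c = fdiff (fdiff (\<lambda>m. max 0 (real m - c)))" for c
  have "fdiff (fdiff (\<lambda>m. tent w (real (m + h)))) m
      = (kink (- real h) m - 2 * kink (w - real h) m + kink (2 * w - real h) m) / w" for m
    using assms by (simp add: tent_eq_ramps kink_def fdiff_def add_divide_distrib diff_divide_distrib algebra_simps)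
  moreover have "\<bar>(x - 2 * y + z) / w\<bar> \<le> (\<bar>x\<bar> + 2 * \<bar>y\<bar> + \<bar>z\<bar>) / w" for x y z
    using assms by (simp add: abs_divide divide_right_mono)
  ultimately have "(\<Sum>m<M. \<bar>fdiff (fdiff (\<lambda>m. tent w (real (m + h)))) m\<bar>)
      \<le> (\<Sum>m<M. (\<bar>kink (- real h) m\<bar> + 2 * \<bar>kink (w - real h) m\<bar> + \<bar>kink (2 * w - real h) m\<bar>) / w)"
    by (simp add: sum_mono)
  also have "\<dots> = ((\<Sum>m<M. \<bar>kink (- real h) m\<bar>) + 2 * (\<Sum>m<M. \<bar>kink (w - real h) m\<bar>)
      + (\<Sum>m<M. \<bar>kink (2 * w - real h) m\<bar>)) / w"
    by (simp add: sum.distrib sum_distrib_left flip: sum_divide_distrib)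
  also have "\<dots> \<le> (1 + 2 * 1 + 1) / w"
    using assms unfolding kink_def
    by (intro divide_right_mono add_mono mult_left_mono sum_abs_fdiff_fdiff_ramp_le) auto
  finally show ?thesis by simp
qed

lemma sum_le_of_eventually_nonpos:
  fixes f :: "nat \<Rightarrow> real"
  assumes "0 \<le> B" "0 \<le> y" "\<And>m. f m \<le> B" "\<And>m. y \<le> real m \<Longrightarrow> f m \<le> 0"
  shows "(\<Sum>m<M. f m) \<le> (y + 1) * B"
proof -
  have "(\<Sum>m<M. f m) \<le> (\<Sum>m<M. if m < nat \<lceil>y\<rceil> then B else 0)"
    using assms by (intro sum_mono) (auto simp: nat_less_iff le_nat_iff ceiling_le_iff not_less)
  also have "\<dots> = (\<Sum>m\<in>{m \<in> {..<M}. m < nat \<lceil>y\<rceil>}. B)"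
    by (rule sum.inter_filter[symmetric]) simp
  also have "\<dots> \<le> (\<Sum>m<nat \<lceil>y\<rceil>. B)"
    using \<open>0 \<le> B\<close> by (intro sum_mono2) auto
  also have "\<dots> \<le> (y + 1) * B"
    using \<open>0 \<le> B\<close> \<open>0 \<le> y\<close> by (simp, intro mult_right_mono) linarith+
  finally show ?thesis .
qed

lemma sum_abs_fdiff_tent_le:
  assumes "w \<ge> 1/2"
  shows "(\<Sum>m<M. \<bar>fdiff (\<lambda>m. tent w (real m)) m\<bar>) \<le> 4"
proof -
  have "\<bar>fdiff (\<lambda>m. tent w (real m)) m\<bar> \<le> 1 / w" for m
    using abs_fdiff_tent_le[of w 0 m] assms by simp
  then have "(\<Sum>m<M. \<bar>fdiff (\<lambda>m. tent w (real m)) m\<bar>) \<le> (2 * w + 1) * (1 / w)"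
    using assms by (intro sum_le_of_eventually_nonpos) (auto simp: fdiff_def tent_eq_0)
  also have "\<dots> \<le> 4" using assms by (simp add: field_simps)
  finally show ?thesis .
qed

lemma sum_abs_fdiff_fdiff_tent_mult_tent_le:
  assumes "w \<ge> 1/2"
  shows "(\<Sum>m<M. \<bar>fdiff (fdiff (\<lambda>m. tent w (real m) * tent w (real (m + h)))) m\<bar>) \<le> 16 / w"
proof -
  define f where "f m = tent w (real m)" for m
  define g where "g m = tent w (real (m + h))" for m
  have "w > 0" using assms by simp
  have unit: "0 \<le> f m" "f m \<le> 1" "0 \<le> g m" "g m \<le> 1" for m
    using \<open>w > 0\<close> by (auto simp: f_def g_def tent_nonneg tent_le_1)
  have Lipschitz: "\<bar>fdiff g m\<bar> \<le> 1 / w" for m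
    unfolding g_def by (rule abs_fdiff_tent_le[OF \<open>w > 0\<close>])
  have "\<bar>fdiff (fdiff (\<lambda>m. f m * g m)) m\<bar>
      \<le> \<bar>fdiff (fdiff f) m\<bar> + \<bar>fdiff (fdiff g) m\<bar> + 2 / w * \<bar>fdiff f m\<bar>" for m
  proof -
    have "\<bar>fdiff (fdiff (\<lambda>m. f m * g m)) m\<bar>
        \<le> \<bar>g (m + 2) * fdiff (fdiff f) m\<bar> + \<bar>f m * fdiff (fdiff g) m\<bar> + \<bar>2 * fdiff g (m + 1) * fdiff f m\<bar>"
      unfolding fdiff_fdiff_mult by linarith
    also have "\<dots> \<le> 1 * \<bar>fdiff (fdiff f) m\<bar> + 1 * \<bar>fdiff (fdiff g) m\<bar> + 2 * (1 / w) * \<bar>fdiff f m\<bar>"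
      unfolding abs_mult using unit Lipschitz[of "m + 1"] \<open>w > 0\<close> by (intro add_mono mult_mono) auto
    finally show ?thesis by simp
  qed
  then have "(\<Sum>m<M. \<bar>fdiff (fdiff (\<lambda>m. f m * g m)) m\<bar>)
      \<le> (\<Sum>m<M. \<bar>fdiff (fdiff f) m\<bar>) + (\<Sum>m<M. \<bar>fdiff (fdiff g) m\<bar>) + 2 / w * (\<Sum>m<M. \<bar>fdiff f m\<bar>)"
    unfolding sum_distrib_left sum.distrib[symmetric] by (rule sum_mono)
  also have "\<dots> \<le> 4 / w + 4 / w + 2 / w * 4"
    using sum_abs_fdiff_fdiff_tent_le[OF \<open>w > 0\<close>, where h = 0 and M = M]
      sum_abs_fdiff_fdiff_tent_le[OF \<open>w > 0\<close>, where h = h and M = M]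
      sum_abs_fdiff_tent_le[OF assms, of M] \<open>w > 0\<close>
    by (intro add_mono mult_left_mono) (auto simp: f_def[abs_def] g_def[abs_def])
  finally show ?thesis by (simp add: f_def g_def)
qed

lemma tent_autocorrelation_le_inverse:
  assumes "w \<ge> 1/2" "2 * w \<le> real M" "cmod z = 1"
  shows "(cmod (1 - z))\<^sup>2 * cmod (\<Sum>m<M. of_real (tent w (real m) * tent w (real (m + h))) * z ^ m)
      \<le> 17 / w"
proof -
  define v where "v m = tent w (real m) * tent w (real (m + h))" for m
  have "w > 0" using assms by simp
  have "(cmod (1 - z))\<^sup>2 * cmod (\<Sum>m<M. of_real (v m) * z ^ m) \<le> \<bar>v 1\<bar> + (\<Sum>m<M. \<bar>fdiff (fdiff v) m\<bar>)"
    using assms \<open>w > 0\<close> by (intro norm_power_sum_le_second_difference) (auto simp: v_def tent_0 tent_eq_0)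
  moreover have "(\<Sum>m<M. \<bar>fdiff (fdiff v) m\<bar>) \<le> 16 / w"
    unfolding v_def by (rule sum_abs_fdiff_fdiff_tent_mult_tent_le[OF assms(1)])
  moreover have "\<bar>v 1\<bar> \<le> 1 / w"
  proof -
    have "\<bar>v 1\<bar> \<le> tent w 1"
      using \<open>w > 0\<close> by (auto simp: v_def tent_nonneg abs_mult intro: mult_left_le tent_le_1)
    also have "\<dots> \<le> 1 / w"
      using abs_fdiff_tent_le[OF \<open>w > 0\<close>, of 0 0] \<open>w > 0\<close> by (simp add: fdiff_def tent_0)
    finally show ?thesis .
  qed
  ultimately show ?thesis by (simp add: v_def)
qed

text \<open>The quadratic decay, from two summations by parts, makes the sum over the shifts \<open>h\<close> in Weyl's
  inequality converge without a logarithm. The case distinction is needed since \<open>17 / 0 = 0\<close>.\<close>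

definition corr_bound :: "real \<Rightarrow> real \<Rightarrow> real" where
  "corr_bound w y = (if unit_exp y = 1 then 2 * w + 1
     else min (2 * w + 1) (17 / (w * (cmod (1 - unit_exp y))\<^sup>2)))"

lemma corr_bound_nonneg: "w > 0 \<Longrightarrow> 0 \<le> corr_bound w y"
  by (auto simp: corr_bound_def)

lemma corr_bound_le: "w \<ge> 1/2 \<Longrightarrow> corr_bound w y \<le> 4 * w"
  by (auto simp: corr_bound_def min_def)

lemma corr_bound_add_int: "corr_bound w (of_int k + y) = corr_bound w y"
  by (simp add: corr_bound_def unit_exp_add_int)

lemma sum_le_of_le_tent:
  assumes "w \<ge> 1/2" "\<And>m. f m \<le> tent w (real m)"
  shows "(\<Sum>m<M. f m) \<le> 2 * w + 1"
proof -
  have "f m \<le> 1" "2 * w \<le> real m \<Longrightarrow> f m \<le> 0" for m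
    using assms(2)[of m] tent_le_1[of w "real m"] tent_eq_0[of w "real m"] assms(1) by auto
  then have "(\<Sum>m<M. f m) \<le> (2 * w + 1) * 1"
    using assms(1) by (intro sum_le_of_eventually_nonpos) auto
  then show ?thesis by simp
qed

lemma tent_autocorrelation_le_corr_bound:
  assumes "w \<ge> 1/2" "2 * w \<le> real M"
  shows "cmod (\<Sum>m<M. of_real (tent w (real m) * tent w (real (m + h))) * unit_exp y ^ m) \<le> corr_bound w y"
    (is "cmod ?S \<le> _")
proof -
  have "w > 0" using assms(1) by simp
  have "cmod ?S \<le> (\<Sum>m<M. tent w (real m) * tent w (real (m + h)))"
    by (rule order_trans[OF norm_sum]) (simp add: norm_mult norm_power tent_nonneg)
  also have "\<dots> \<le> 2 * w + 1"
    using \<open>w > 0\<close> by (intro sum_le_of_le_tent assms(1) mult_left_le tent_le_1 tent_nonneg)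
  finally have trivial: "cmod ?S \<le> 2 * w + 1" .
  have "cmod ?S \<le> 17 / (w * (cmod (1 - unit_exp y))\<^sup>2)" if "unit_exp y \<noteq> 1"
    using tent_autocorrelation_le_inverse[OF assms norm_unit_exp, of y h] that \<open>w > 0\<close>
    by (simp add: field_simps)
  with trivial show ?thesis
    unfolding corr_bound_def
    by (cases "unit_exp y = 1") (simp_all only: if_True if_False simp_thms min.bounded_iff)
qed

text \<open>The shift \<open>D\<close> makes room for tents placed anywhere on the line: differencing turns it into
  a phase that is constant in the inner sum, so every bound below is uniform in \<open>D\<close>.\<close>

definition tent_sum :: "real \<Rightarrow> nat \<Rightarrow> real \<Rightarrow> real \<Rightarrow> complex" where
  "tent_sum w M D x = (\<Sum>l<M. of_real (tent w (real l)) * unit_exp ((D + real l)\<^sup>2 * x))"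

lemma continuous_on_tent_sum: "continuous_on S (tent_sum w M D)"
  unfolding tent_sum_def by (intro continuous_intros)

lemma norm_square_sum_eq_autocorrelations:
  fixes c :: "nat \<Rightarrow> complex"
  shows "(cmod (\<Sum>l<M. c l))\<^sup>2 = (\<Sum>l<M. (cmod (c l))\<^sup>2)
     + 2 * Re (\<Sum>h\<in>{1..<M}. \<Sum>m<M-h. c (m + h) * cnj (c m))"
proof (induction M)
  case 0
  then show ?case by simp
next
  case (Suc M)
  have "(\<Sum>h\<in>{1..<Suc M}. \<Sum>m<Suc M-h. c (m + h) * cnj (c m))
     = (\<Sum>h\<in>{1..<Suc M}. (\<Sum>m<M-h. c (m + h) * cnj (c m)) + c M * cnj (c (M - h)))"
    by (intro sum.cong) (auto simp: Suc_diff_le)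
  also have "\<dots> = (\<Sum>h\<in>{1..<M}. (\<Sum>m<M-h. c (m + h) * cnj (c m))) + c M * (\<Sum>h\<in>{1..<Suc M}. cnj (c (M - h)))"
    by (cases "M = 0") (simp_all add: sum.distrib sum_distrib_left distrib_left)
  also have "(\<Sum>h\<in>{1..<Suc M}. cnj (c (M - h))) = cnj (\<Sum>m<M. c m)"
    unfolding cnj_sum
    by (rule sum.reindex_bij_witness[of _ "\<lambda>m. M - m" "\<lambda>m. M - m"]) auto
  finally have new_pairs: "(\<Sum>h\<in>{1..<Suc M}. \<Sum>m<Suc M-h. c (m + h) * cnj (c m))
     = (\<Sum>h\<in>{1..<M}. (\<Sum>m<M-h. c (m + h) * cnj (c m))) + c M * cnj (\<Sum>m<M. c m)" .
  have "(cmod (z + w))\<^sup>2 = (cmod z)\<^sup>2 + (cmod w)\<^sup>2 + 2 * Re (w * cnj z)" for z w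
    unfolding cmod_power2 by (simp add: algebra_simps power2_eq_square)
  from this[of "\<Sum>l<M. c l" "c M"] show ?case
    unfolding new_pairs by (simp add: Suc.IH)
qed

lemma tent_sum_autocorrelation_le:
  fixes w D x :: real
  defines "c \<equiv> \<lambda>l. of_real (tent w (real l)) * unit_exp ((D + real l)\<^sup>2 * x)"
  assumes "w \<ge> 1/2" "2 * w \<le> real M"
  shows "cmod (\<Sum>m<M-h. c (m + h) * cnj (c m))
      \<le> (if real h < 2 * w then corr_bound w (real (2 * h) * x) else 0)"
proof (cases "real h < 2 * w")
  case False
  then have "c (m + h) = 0" for m
    using assms(2) by (auto simp: c_def tent_eq_0)
  then show ?thesis using False by simp
next
  case True
  define f where "f m = complex_of_real (tent w (real m) * tent w (real (m + h)))
      * unit_exp (real (2 * h) * x) ^ m" for m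
  have "c (m + h) * cnj (c m) = unit_exp ((2 * D * real h + (real h)\<^sup>2) * x) * f m" for m
  proof -
    have "unit_exp ((D + real (m + h))\<^sup>2 * x) * unit_exp (- ((D + real m)\<^sup>2 * x))
       = unit_exp ((2 * D * real h + (real h)\<^sup>2) * x) * unit_exp (real (2 * h) * x) ^ m"
      unfolding unit_exp_power unit_exp_add[symmetric]
      by (rule arg_cong[of _ _ unit_exp]) (simp add: algebra_simps power2_eq_square)
    then show ?thesis by (simp add: c_def f_def cnj_unit_exp mult_ac)
  qed
  then have "cmod (\<Sum>m<M-h. c (m + h) * cnj (c m)) = cmod (\<Sum>m<M-h. f m)"
    by (simp add: norm_mult flip: sum_distrib_left)
  also have "(\<Sum>m<M-h. f m) = (\<Sum>m<M. f m)"
    using assms by (intro sum.mono_neutral_left) (auto simp: f_def tent_eq_0)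
  finally show ?thesis
    using True tent_autocorrelation_le_corr_bound[OF assms(2,3), of h "real (2 * h) * x"]
    by (simp add: f_def)
qed

lemma norm_square_tent_sum_le:
  assumes "w \<ge> 1/2" "2 * w \<le> real M"
  shows "(cmod (tent_sum w M D x))\<^sup>2 \<le> (2 * w + 1) + 2 * (\<Sum>t\<in>{1..nat \<lfloor>4 * w\<rfloor>}. corr_bound w (real t * x))"
proof -
  have "w > 0" using assms by simp
  define c where "c = (\<lambda>l. of_real (tent w (real l)) * unit_exp ((D + real l)\<^sup>2 * x))"
  have "(cmod (tent_sum w M D x))\<^sup>2 = (\<Sum>l<M. (cmod (c l))\<^sup>2)
     + 2 * Re (\<Sum>h\<in>{1..<M}. \<Sum>m<M-h. c (m + h) * cnj (c m))"
    unfolding tent_sum_def c_def by (rule norm_square_sum_eq_autocorrelations)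
  moreover have "(\<Sum>l<M. (cmod (c l))\<^sup>2) \<le> 2 * w + 1"
    using \<open>w > 0\<close> by (intro sum_le_of_le_tent[OF assms(1)])
      (auto simp: c_def norm_mult power2_eq_square tent_nonneg intro!: mult_left_le tent_le_1)
  moreover have "Re (\<Sum>h\<in>{1..<M}. \<Sum>m<M-h. c (m + h) * cnj (c m))
      \<le> (\<Sum>t\<in>{1..nat \<lfloor>4 * w\<rfloor>}. corr_bound w (real t * x))"
  proof -
    define H where "H = {h \<in> {1..<M}. real h < 2 * w}"
    have "Re (\<Sum>h\<in>{1..<M}. \<Sum>m<M-h. c (m + h) * cnj (c m))
        \<le> (\<Sum>h\<in>{1..<M}. cmod (\<Sum>m<M-h. c (m + h) * cnj (c m)))"
      by (rule order_trans[OF complex_Re_le_cmod norm_sum])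
    also have "\<dots> \<le> (\<Sum>h\<in>{1..<M}. if real h < 2 * w then corr_bound w (real (2 * h) * x) else 0)"
      unfolding c_def by (intro sum_mono tent_sum_autocorrelation_le assms)
    also have "\<dots> = (\<Sum>h\<in>H. corr_bound w (real (2 * h) * x))"
      unfolding H_def by (rule sum.inter_filter[symmetric]) simp
    also have "\<dots> = (\<Sum>t\<in>(*) 2 ` H. corr_bound w (real t * x))"
      by (subst sum.reindex) (auto simp: inj_on_def)
    also have "\<dots> \<le> (\<Sum>t\<in>{1..nat \<lfloor>4 * w\<rfloor>}. corr_bound w (real t * x))"
      using \<open>w > 0\<close> by (intro sum_mono2 corr_bound_nonneg) (auto simp: H_def le_nat_iff le_floor_iff)
    finally show ?thesis .
  qed
  ultimately show ?thesis by linarith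
qed

section \<open>Pointwise bounds near rational points\<close>

lemma two_div_pi_mult_le_sin:
  assumes "0 \<le> x" "x \<le> pi / 2"
  shows "2 / pi * x \<le> sin x"
proof -
  define t where "t = 2 / pi * x"
  have "2 / pi * x \<le> 2 / pi * (pi / 2)" using assms(2) by (rule mult_left_mono) simp
  then have t: "0 \<le> t" "t \<le> 1" "t * (pi / 2) = x" using assms(1) by (simp_all add: t_def)
  have concave: "concave_on {0..pi} sin"
    by (rule f''_le0_imp_concave[where f' = cos and f'' = "\<lambda>x. - sin x"])
      (auto intro: DERIV_sin DERIV_cos sin_ge_zero)
  have "(1 - t) * sin 0 + t * sin (pi / 2) \<le> sin ((1 - t) *\<^sub>R 0 + t *\<^sub>R (pi / 2))"
    by (rule concave_onD[OF concave t(1,2)]) simp_all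
  also have "(1 - t) *\<^sub>R 0 + t *\<^sub>R (pi / 2) = x"
    using t(3) by (simp only: scaleR_zero_right add_0 real_scaleR_def)
  finally show ?thesis
    by (simp only: t_def sin_zero sin_pi_half mult_zero_right add_0 mult_1_right)
qed

lemma norm_one_minus_unit_exp_ge:
  assumes "\<bar>x\<bar> \<le> 1/2"
  shows "4 * \<bar>x\<bar> \<le> cmod (1 - unit_exp x)"
proof -
  have "pi * \<bar>x\<bar> \<le> pi * (1/2)" using assms by (rule mult_left_mono) simp
  then have "2 / pi * (pi * \<bar>x\<bar>) \<le> sin (pi * \<bar>x\<bar>)"
    by (intro two_div_pi_mult_le_sin) simp_all
  also have "\<dots> \<le> \<bar>sin (pi * x)\<bar>" by (cases "x \<ge> 0") simp_all
  finally show ?thesis by (simp add: norm_one_minus_unit_exp)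
qed

lemma corr_bound_le_of_far_from_int:
  assumes "w > 0" "d > 0" and far: "\<And>k. d \<le> \<bar>y - of_int k\<bar>"
  shows "corr_bound w y \<le> 2 / (w * d\<^sup>2)"
proof -
  define u where "u = y - of_int (round y)"
  have "\<bar>u\<bar> \<le> 1/2"
    using of_int_round_abs_le[of y] by (simp add: u_def abs_minus_commute)
  moreover have "d \<le> \<bar>u\<bar>" unfolding u_def by (rule far)
  ultimately have gap: "4 * d \<le> cmod (1 - unit_exp u)"
    using norm_one_minus_unit_exp_ge[of u] by linarith
  then have "unit_exp u \<noteq> 1" using \<open>d > 0\<close> by auto
  then have "corr_bound w u \<le> 17 / (w * (cmod (1 - unit_exp u))\<^sup>2)"
    by (simp add: corr_bound_def)
  also have "\<dots> \<le> 17 / (w * (4 * d)\<^sup>2)"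
    using assms gap by (intro divide_left_mono mult_left_mono power_mono mult_pos_pos) auto
  also have "\<dots> \<le> 2 / (w * d\<^sup>2)"
    using assms by (simp add: power_mult_distrib divide_simps)
  finally show ?thesis
    using corr_bound_add_int[of w "round y" u] by (simp add: u_def)
qed

lemma min_mod_le_abs_diff:
  fixes n Q :: int
  assumes "Q > 0"
  shows "min (n mod Q) (Q - n mod Q) \<le> \<bar>n - k * Q\<bar>"
proof -
  define j where "j = n div Q - k"
  have n: "n - k * Q = n mod Q + j * Q"
    by (simp add: j_def left_diff_distrib)
  have "0 \<le> n mod Q" using assms by simp
  consider (nonneg) "0 \<le> j" | (neg) "j \<le> -1" by linarith
  then show ?thesis
  proof cases
    case nonneg
    then have "0 \<le> j * Q" using assms by simp
    then show ?thesis using n \<open>0 \<le> n mod Q\<close> by linarith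
  next
    case neg
    then have "j * Q \<le> -1 * Q" using assms by (intro mult_right_mono) auto
    then show ?thesis using n by linarith
  qed
qed

lemma corr_bound_near_rational:
  fixes n :: int and Q :: nat
  assumes "w > 0" "Q > 0" and near: "\<bar>y - of_int n / real Q\<bar> \<le> 1 / (2 * real Q)"
    and "r = n mod int Q" "r \<noteq> 0"
  shows "corr_bound w y \<le> 8 / w * (real Q)\<^sup>2 * (1 / (of_int r)\<^sup>2 + 1 / (real Q - of_int r)\<^sup>2)"
proof -
  define d where "d = min r (int Q - r)"
  have "0 < r" "r < int Q"
    using \<open>Q > 0\<close> \<open>r \<noteq> 0\<close> pos_mod_sign[of "int Q" n] pos_mod_bound[of "int Q" n]
    unfolding \<open>r = n mod int Q\<close> by linarith+
  then have "d \<ge> 1" by (simp add: d_def)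
  have far: "of_int d / (2 * real Q) \<le> \<bar>y - of_int k\<bar>" for k
  proof -
    have "d \<le> \<bar>n - k * int Q\<bar>"
      unfolding d_def \<open>r = n mod int Q\<close> using \<open>Q > 0\<close> by (intro min_mod_le_abs_diff) simp
    then have "real_of_int d \<le> \<bar>real_of_int (n - k * int Q)\<bar>"
      by (simp only: of_int_abs[symmetric] of_int_le_iff)
    then have "of_int d / real Q \<le> \<bar>real_of_int (n - k * int Q)\<bar> / real Q"
      by (rule divide_right_mono) simp
    moreover have "real_of_int (n - k * int Q) / real Q = of_int n / real Q - of_int k"
      using \<open>Q > 0\<close> by (simp add: diff_divide_distrib)
    ultimately have "of_int d / real Q \<le> \<bar>of_int n / real Q - of_int k\<bar>"
      by (metis abs_divide abs_of_nat)
    moreover have "1 / (2 * real Q) \<le> of_int d / (2 * real Q)"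
      using \<open>d \<ge> 1\<close> by (intro divide_right_mono) auto
    moreover have "of_int d / real Q = 2 * (of_int d / (2 * real Q))" by simp
    ultimately show ?thesis using near by linarith
  qed
  have "corr_bound w y \<le> 2 / (w * (of_int d / (2 * real Q))\<^sup>2)"
    using assms \<open>d \<ge> 1\<close> far by (intro corr_bound_le_of_far_from_int) auto
  also have "\<dots> = 8 / w * (real Q)\<^sup>2 * (1 / (of_int d)\<^sup>2)"
    using assms \<open>d \<ge> 1\<close> by (simp add: field_simps power2_eq_square)
  also have "\<dots> \<le> 8 / w * (real Q)\<^sup>2 * (1 / (of_int r)\<^sup>2 + 1 / (real Q - of_int r)\<^sup>2)"
    using \<open>w > 0\<close> by (intro mult_left_mono) (auto simp: d_def min_def)
  finally show ?thesis .
qed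

lemma bij_betw_mult_mod:
  fixes a :: int and Q :: nat
  assumes "coprime a (int Q)"
  shows "bij_betw (\<lambda>t. nat (int t * a mod int Q)) {n..<n + Q} {..<Q}"
proof -
  let ?f = "\<lambda>t. nat (int t * a mod int Q)"
  have inj: "inj_on ?f {n..<n + Q}"
  proof (rule inj_onI)
    fix t u assume tu: "t \<in> {n..<n + Q}" "u \<in> {n..<n + Q}" "?f t = ?f u"
    then have "int t * a mod int Q = int u * a mod int Q"
      by (simp add: nat_eq_iff2)
    then have "int Q dvd (int t - int u) * a" by (simp add: mod_eq_dvd_iff left_diff_distrib)
    then have "int Q dvd int t - int u"
      using assms by (simp add: coprime_dvd_mult_left_iff coprime_commute)
    moreover have "\<bar>int t - int u\<bar> < int Q" using tu by auto
    ultimately show "t = u" using zdvd_not_zless[of "\<bar>int t - int u\<bar>" "int Q"] by force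
  qed
  have "?f ` {n..<n + Q} = {..<Q}"
  proof (rule card_subset_eq)
    show "?f ` {n..<n + Q} \<subseteq> {..<Q}" by (auto simp: nat_less_iff)
    show "card (?f ` {n..<n + Q}) = card {..<Q}" using inj by (simp add: card_image)
  qed simp
  with inj show ?thesis by (simp add: bij_betw_def)
qed

lemma sum_mult_mod_le:
  fixes a :: int and Q :: nat and g :: "int \<Rightarrow> real"
  assumes "coprime a (int Q)" "Q > 0" "\<And>r. g r \<ge> 0"
  shows "(\<Sum>t<T. g (int t * a mod int Q)) \<le> real (T div Q + 1) * (\<Sum>r<Q. g (int r))"
proof -
  define f where "f t = g (int t * a mod int Q)" for t
  define n where "n = T div Q + 1"
  have "T \<le> n * Q"
    using assms(2) by (simp add: n_def dividend_less_div_times less_imp_le)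
  then have "(\<Sum>t<T. f t) \<le> (\<Sum>t<n * Q. f t)"
    using assms by (intro sum_mono2) (auto simp: f_def)
  also have "\<dots> = (\<Sum>m<n. sum f {m * Q..<m * Q + Q})"
    by (rule sum.nat_group[symmetric])
  also have "\<dots> = (\<Sum>m<n. \<Sum>r<Q. g (int r))"
  proof (rule sum.cong[OF refl])
    fix m
    show "sum f {m * Q..<m * Q + Q} = (\<Sum>r<Q. g (int r))"
      using sum.reindex_bij_betw[OF bij_betw_mult_mod[OF assms(1)], of "\<lambda>r. g (int r)" "m * Q"] assms(2)
      by (simp add: f_def)
  qed
  finally show ?thesis by (simp add: f_def n_def)
qed

lemma sum_inverse_squares_le: "(\<Sum>r=1..n. 1 / (real r)\<^sup>2) \<le> 2"
proof -
  have "(\<Sum>r=1..n. 1 / (real r)\<^sup>2) = (\<Sum>m<n. 1 / (real m + 1)\<^sup>2)"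
    by (rule sum.reindex_bij_witness[of _ Suc "\<lambda>r. r - 1"]) (auto simp: add.commute of_nat_diff)
  also have "\<dots> \<le> (\<Sum>m. 1 / (real m + 1)\<^sup>2)"
    using inverse_squares_sums by (intro sum_le_suminf) (auto simp: sums_iff add.commute)
  also have "\<dots> = pi\<^sup>2 / 6" using inverse_squares_sums by (simp add: sums_iff add.commute)
  also have "\<dots> \<le> 3.2\<^sup>2 / 6" using pi_approx by (intro divide_right_mono power_mono) auto
  also have "\<dots> \<le> 2" by (simp add: power2_eq_square)
  finally show ?thesis .
qed

text \<open>At \<open>r = 0\<close> the first summand is \<open>1 / 0 = 0\<close>.\<close>

lemma sum_reflected_inverse_squares_le:
  "(\<Sum>r<Q. 1 / (real r)\<^sup>2 + 1 / (real Q - real r)\<^sup>2) \<le> 4"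
proof -
  have "(\<Sum>r<Q. 1 / (real r)\<^sup>2) = (\<Sum>r\<in>{1..<Q}. 1 / (real r)\<^sup>2)"
    by (rule sum.mono_neutral_right) auto
  also have "\<dots> \<le> (\<Sum>r=1..Q. 1 / (real r)\<^sup>2)"
    by (intro sum_mono2) auto
  finally have "(\<Sum>r<Q. 1 / (real r)\<^sup>2) \<le> (\<Sum>r=1..Q. 1 / (real r)\<^sup>2)" .
  moreover have "(\<Sum>r<Q. 1 / (real Q - real r)\<^sup>2) = (\<Sum>r=1..Q. 1 / (real r)\<^sup>2)"
    by (rule sum.reindex_bij_witness[of _ "\<lambda>r. Q - r" "\<lambda>r. Q - r"]) (auto simp: of_nat_diff)
  ultimately show ?thesis
    using sum_inverse_squares_le[of Q] by (simp add: sum.distrib)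
qed

lemma sum_corr_bound_nonmultiples_le:
  fixes a :: int and Q :: nat
  assumes "w > 0" "Q > 0" "coprime a (int Q)"
    and near: "\<And>t. t \<le> T \<Longrightarrow> \<bar>real t * (x - of_int a / real Q)\<bar> \<le> 1 / (2 * real Q)"
  shows "(\<Sum>t\<in>{t\<in>{1..T}. \<not> Q dvd t}. corr_bound w (real t * x))
    \<le> 8 / w * (real Q)\<^sup>2 * (((real T + 1) / real Q + 1) * 4)"
proof -
  define g where "g r = 1 / (real_of_int r)\<^sup>2 + 1 / (real Q - real_of_int r)\<^sup>2" for r
  have "g r \<ge> 0" for r by (simp add: g_def)
  have "(\<Sum>t\<in>{t\<in>{1..T}. \<not> Q dvd t}. corr_bound w (real t * x))
      \<le> (\<Sum>t\<in>{t\<in>{1..T}. \<not> Q dvd t}. 8 / w * (real Q)\<^sup>2 * g (int t * a mod int Q))"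
  proof (rule sum_mono)
    fix t assume t: "t \<in> {t\<in>{1..T}. \<not> Q dvd t}"
    have "\<not> int Q dvd int t * a"
      using t assms(3) by (simp add: coprime_dvd_mult_left_iff coprime_commute int_dvd_int_iff)
    then have "int t * a mod int Q \<noteq> 0" by (simp add: dvd_eq_mod_eq_0)
    moreover have "\<bar>real t * x - of_int (int t * a) / real Q\<bar> \<le> 1 / (2 * real Q)"
      using near[of t] t by (simp add: right_diff_distrib)
    ultimately show "corr_bound w (real t * x) \<le> 8 / w * (real Q)\<^sup>2 * g (int t * a mod int Q)"
      unfolding g_def using corr_bound_near_rational[OF assms(1,2) _ refl] by blast
  qed
  also have "\<dots> \<le> (\<Sum>t<T + 1. 8 / w * (real Q)\<^sup>2 * g (int t * a mod int Q))"
    using \<open>w > 0\<close> \<open>\<And>r. g r \<ge> 0\<close> by (intro sum_mono2) auto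
  also have "\<dots> = 8 / w * (real Q)\<^sup>2 * (\<Sum>t<T + 1. g (int t * a mod int Q))"
    by (rule sum_distrib_left[symmetric])
  also have "\<dots> \<le> 8 / w * (real Q)\<^sup>2 * (((real T + 1) / real Q + 1) * 4)"
  proof (rule mult_left_mono)
    have "(\<Sum>t<T + 1. g (int t * a mod int Q)) \<le> real ((T + 1) div Q + 1) * (\<Sum>r<Q. g (int r))"
      by (rule sum_mult_mod_le[OF assms(3,2)]) fact
    also have "\<dots> \<le> ((real T + 1) / real Q + 1) * 4"
    proof (rule mult_mono)
      show "real ((T + 1) div Q + 1) \<le> (real T + 1) / real Q + 1"
        using of_nat_div_le_of_nat[of "T + 1" Q, where ?'a = real] by (simp add: add.commute)
      show "(\<Sum>r<Q. g (int r)) \<le> 4"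
        using sum_reflected_inverse_squares_le[of Q] by (simp add: g_def)
    qed (auto intro!: sum_nonneg \<open>\<And>r. g r \<ge> 0\<close>)
    finally show "(\<Sum>t<T + 1. g (int t * a mod int Q)) \<le> ((real T + 1) / real Q + 1) * 4" .
  qed (use \<open>w > 0\<close> in auto)
  finally show ?thesis .
qed

definition arc_peak :: "real \<Rightarrow> real \<Rightarrow> real \<Rightarrow> real \<Rightarrow> real" where
  "arc_peak \<eta> w q \<beta> = w\<^sup>2 / q * (1 + w\<^sup>2 * \<bar>\<beta>\<bar>) powr (- \<eta>)"

lemma arc_peak_nonneg: "0 \<le> q \<Longrightarrow> 0 \<le> arc_peak \<eta> w q \<beta>"
  by (simp add: arc_peak_def)

lemma sum_powr_minus_le:
  fixes \<eta> :: real
  assumes "0 < \<eta>" "\<eta> < 1"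
  shows "(\<Sum>k=1..n. real k powr (- \<eta>)) \<le> real n powr (1 - \<eta>) / (1 - \<eta>)"
proof (induction n)
  case (Suc n)
  define N where "N = real (Suc n)"
  have N: "N > 0" "real n / N = 1 - 1 / N" by (auto simp: N_def field_simps)
  have "(real n / N) powr (1 - \<eta>) * 1 powr \<eta> \<le> (1 - \<eta>) * (real n / N) + \<eta> * 1"
  proof (cases "n = 0")
    case False
    then show ?thesis using assms \<open>N > 0\<close> by (intro Youngs_inequality_0) auto
  qed (use assms in auto)
  then have "N powr (1 - \<eta>) * (real n / N) powr (1 - \<eta>) \<le> N powr (1 - \<eta>) * ((1 - \<eta>) * (real n / N) + \<eta>)"
    by (intro mult_left_mono) auto
  moreover have "N powr (1 - \<eta>) * (real n / N) powr (1 - \<eta>) = real n powr (1 - \<eta>)"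
    using \<open>N > 0\<close> by (simp add: powr_divide)
  moreover have "N powr (1 - \<eta>) * ((1 - \<eta>) * (real n / N) + \<eta>) = N powr (1 - \<eta>) - N powr (- \<eta>) * (1 - \<eta>)"
    unfolding N(2) using \<open>N > 0\<close> by (simp add: powr_diff powr_minus field_simps)
  ultimately have "N powr (- \<eta>) \<le> (N powr (1 - \<eta>) - real n powr (1 - \<eta>)) / (1 - \<eta>)"
    using assms by (simp add: field_simps)
  then show ?case using Suc by (simp add: N_def diff_divide_distrib)
qed (use assms in auto)

lemma corr_bound_le_powr:
  assumes "w \<ge> 1/2" "\<bar>y\<bar> \<le> 1/2" "y \<noteq> 0" "0 \<le> \<eta>" "\<eta> \<le> 2"
  shows "corr_bound w y \<le> 4 * w * (w * \<bar>y\<bar>) powr (- \<eta>)"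
proof (cases "w * \<bar>y\<bar> \<le> 1")
  case True
  have "1 \<le> (w * \<bar>y\<bar>) powr (- \<eta>)"
    using powr_mono2'[of "- \<eta>" "w * \<bar>y\<bar>" 1] assms True by simp
  then have "4 * w * 1 \<le> 4 * w * (w * \<bar>y\<bar>) powr (- \<eta>)" using assms by (intro mult_left_mono) auto
  then show ?thesis using corr_bound_le[OF assms(1), of y] by linarith
next
  case False
  have "\<bar>y\<bar> \<le> \<bar>y - of_int k\<bar>" for k
  proof (cases "k = 0")
    case False
    then have "1 \<le> \<bar>real_of_int k\<bar>" by linarith
    then show ?thesis using \<open>\<bar>y\<bar> \<le> 1/2\<close> by linarith
  qed simp
  then have "corr_bound w y \<le> 2 / (w * \<bar>y\<bar>\<^sup>2)"
    using assms by (intro corr_bound_le_of_far_from_int) auto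
  also have "\<dots> = 2 * w * (w * \<bar>y\<bar>) powr (- 2)"
    using assms by (simp add: powr_minus divide_simps power2_eq_square)
  also have "\<dots> \<le> 4 * w * (w * \<bar>y\<bar>) powr (- \<eta>)"
    using assms False by (intro mult_mono powr_mono) auto
  finally show ?thesis .
qed

lemma powr_minus_le_one_plus_powr_minus:
  fixes B \<eta> :: real
  assumes "1 \<le> B" "0 \<le> \<eta>" "\<eta> \<le> 1"
  shows "B powr (- \<eta>) \<le> 2 * (1 + B) powr (- \<eta>)"
proof -
  have "2 powr (- 1) * B powr (- \<eta>) \<le> 2 powr (- \<eta>) * B powr (- \<eta>)"
    using assms by (intro mult_right_mono powr_mono) auto
  also have "\<dots> = (2 * B) powr (- \<eta>)" by (simp add: powr_mult)
  also have "\<dots> \<le> (1 + B) powr (- \<eta>)"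
    using assms by (intro powr_mono2') auto
  finally show ?thesis by (simp add: powr_minus)
qed

lemma sum_corr_bound_multiples_le_of_large:
  assumes "w \<ge> 1/2" "q > 0" "real n \<le> 4 * w / q" "0 < \<eta>" "\<eta> < 1" "w\<^sup>2 * \<bar>\<beta>\<bar> > 1"
    and near: "\<And>k. k \<in> {1..n} \<Longrightarrow> \<bar>real k * q * \<beta>\<bar> \<le> 1/2"
  shows "(\<Sum>k=1..n. corr_bound w (real k * q * \<beta>)) \<le> 32 / (1 - \<eta>) * arc_peak \<eta> w q \<beta>"
proof -
  have "\<beta> \<noteq> 0" using assms(6) by auto
  define B where "B = w\<^sup>2 * \<bar>\<beta>\<bar>"
  have "B > 1" using assms(6) by (simp add: B_def)
  have "(\<Sum>k=1..n. corr_bound w (real k * q * \<beta>))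
      \<le> (\<Sum>k=1..n. 4 * w * (w * q * \<bar>\<beta>\<bar>) powr (- \<eta>) * real k powr (- \<eta>))"
  proof (rule sum_mono)
    fix k assume k: "k \<in> {1..n}"
    have "corr_bound w (real k * q * \<beta>) \<le> 4 * w * (w * \<bar>real k * q * \<beta>\<bar>) powr (- \<eta>)"
      using k assms \<open>\<beta> \<noteq> 0\<close> by (intro corr_bound_le_powr near) auto
    also have "w * \<bar>real k * q * \<beta>\<bar> = (w * q * \<bar>\<beta>\<bar>) * real k"
      using \<open>q > 0\<close> by (simp add: abs_mult)
    finally show "corr_bound w (real k * q * \<beta>) \<le> 4 * w * (w * q * \<bar>\<beta>\<bar>) powr (- \<eta>) * real k powr (- \<eta>)"
      by (simp only: powr_mult mult.assoc)
  qed
  also have "\<dots> = 4 * w * (w * q * \<bar>\<beta>\<bar>) powr (- \<eta>) * (\<Sum>k=1..n. real k powr (- \<eta>))"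
    by (rule sum_distrib_left[symmetric])
  also have "\<dots> \<le> 4 * w * (w * q * \<bar>\<beta>\<bar>) powr (- \<eta>) * ((4 * w / q) powr (1 - \<eta>) / (1 - \<eta>))"
  proof (rule mult_left_mono)
    have "(\<Sum>k=1..n. real k powr (- \<eta>)) \<le> real n powr (1 - \<eta>) / (1 - \<eta>)"
      by (rule sum_powr_minus_le) fact+
    also have "\<dots> \<le> (4 * w / q) powr (1 - \<eta>) / (1 - \<eta>)"
      using assms by (intro divide_right_mono powr_mono2) auto
    finally show "(\<Sum>k=1..n. real k powr (- \<eta>)) \<le> (4 * w / q) powr (1 - \<eta>) / (1 - \<eta>)" .
  qed (use assms in auto)
  also have "\<dots> = 4 / (1 - \<eta>) * (w\<^sup>2 / q) * (4 powr (1 - \<eta>) * B powr (- \<eta>))"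
    using assms \<open>\<beta> \<noteq> 0\<close> unfolding B_def
    by (simp add: powr_mult powr_divide powr_diff powr_minus power2_eq_square field_simps)
  also have "\<dots> \<le> 4 / (1 - \<eta>) * (w\<^sup>2 / q) * (4 * (2 * (1 + B) powr (- \<eta>)))"
  proof (intro mult_left_mono mult_mono)
    show "4 powr (1 - \<eta>) \<le> (4::real)" using powr_mono[of "1 - \<eta>" 1 "4::real"] assms by simp
    show "B powr (- \<eta>) \<le> 2 * (1 + B) powr (- \<eta>)"
      using assms \<open>B > 1\<close> by (intro powr_minus_le_one_plus_powr_minus) auto
  qed (use assms in auto)
  finally show ?thesis by (simp add: arc_peak_def B_def)
qed

lemma sum_corr_bound_multiples_le:
  assumes "w \<ge> 1/2" "q > 0" "real n \<le> 4 * w / q" "0 < \<eta>" "\<eta> < 1"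
    and near: "\<And>k. k \<in> {1..n} \<Longrightarrow> \<bar>real k * q * \<beta>\<bar> \<le> 1/2"
  shows "(\<Sum>k=1..n. corr_bound w (real k * q * \<beta>)) \<le> 32 / (1 - \<eta>) * arc_peak \<eta> w q \<beta>"
proof (cases "w\<^sup>2 * \<bar>\<beta>\<bar> \<le> 1")
  case False
  then show ?thesis using assms by (intro sum_corr_bound_multiples_le_of_large) auto
next
  case True
  have "(\<Sum>k=1..n. corr_bound w (real k * q * \<beta>)) \<le> (\<Sum>k=1..n. 4 * w)"
    by (intro sum_mono corr_bound_le assms)
  also have "\<dots> = real n * (4 * w)" by simp
  also have "\<dots> \<le> 4 * w / q * (4 * w)" using assms by (intro mult_right_mono) auto
  also have "\<dots> = 32 / 1 * (w\<^sup>2 / q * (1/2))" by (simp add: power2_eq_square)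
  also have "\<dots> \<le> 32 / (1 - \<eta>) * arc_peak \<eta> w q \<beta>"
    unfolding arc_peak_def
  proof (intro mult_mono divide_left_mono)
    have "1/2 = 2 powr (- 1 :: real)" by (simp add: powr_minus)
    also have "\<dots> \<le> 2 powr (- \<eta>)" using assms by (intro powr_mono) auto
    also have "\<dots> \<le> (1 + w\<^sup>2 * \<bar>\<beta>\<bar>) powr (- \<eta>)"
      using True assms by (intro powr_mono2') (auto simp: add_pos_nonneg)
    finally show "1/2 \<le> (1 + w\<^sup>2 * \<bar>\<beta>\<bar>) powr (- \<eta>)" .
  qed (use assms in auto)
  finally show ?thesis .
qed

lemma sum_dvd_corr_bound_eq:
  fixes a :: int and Q :: nat
  assumes "Q > 0"
  shows "(\<Sum>t\<in>{t\<in>{1..T}. Q dvd t}. corr_bound w (real t * x))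
    = (\<Sum>k=1..T div Q. corr_bound w (real k * real Q * (x - of_int a / real Q)))"
proof (rule sum.reindex_bij_witness[of _ "\<lambda>k. k * Q" "\<lambda>t. t div Q"])
  fix k assume "k \<in> {1..T div Q}"
  then show "k * Q \<in> {t\<in>{1..T}. Q dvd t}" "k * Q div Q = k"
    using assms by (auto simp: less_eq_div_iff_mult_less_eq)
next
  fix t assume t: "t \<in> {t\<in>{1..T}. Q dvd t}"
  then show "t div Q \<in> {1..T div Q}" "t div Q * Q = t"
    using assms by (auto simp: div_le_mono dvd_imp_le div_greater_zero_iff Suc_le_eq)
  obtain k where k: "t = Q * k" using t by blast
  have "real t * x = of_int (int k * a) + real k * real Q * (x - of_int a / real Q)"
    using assms by (simp add: k field_simps)
  then show "corr_bound w (real (t div Q) * real Q * (x - of_int a / real Q)) = corr_bound w (real t * x)"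
    using assms by (simp only: corr_bound_add_int) (simp add: k)
qed

lemma sum_corr_bound_near_rational_le:
  fixes a :: int and Q T :: nat
  assumes "w \<ge> 1/2" "real T \<le> 4 * w" and \<eta>: "0 < \<eta>" "\<eta> < 1"
    and Q: "Q > 0" "real Q \<le> 10 * w" and "coprime a (int Q)"
    and near: "\<bar>x - of_int a / real Q\<bar> \<le> 1 / (8 * w * real Q)"
  shows "(\<Sum>t\<in>{1..T}. corr_bound w (real t * x))
    \<le> 5120 * w + 32 / (1 - \<eta>) * arc_peak \<eta> w (real Q) (x - of_int a / real Q)"
proof -
  define \<beta> where "\<beta> = x - of_int a / real Q"
  have "w > 0" using assms by simp
  have t\<beta>: "\<bar>real t * \<beta>\<bar> \<le> 1 / (2 * real Q)" if "t \<le> T" for t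
  proof -
    have "real t * \<bar>\<beta>\<bar> \<le> 4 * w * (1 / (8 * w * real Q))"
      using that assms(2) near \<open>w > 0\<close> by (intro mult_mono) (auto simp: \<beta>_def)
    then show ?thesis using \<open>w > 0\<close> by (simp add: abs_mult)
  qed
  have "(\<Sum>t\<in>{t\<in>{1..T}. \<not> Q dvd t}. corr_bound w (real t * x))
      \<le> 8 / w * (real Q)\<^sup>2 * (((real T + 1) / real Q + 1) * 4)"
    using \<open>w > 0\<close> assms t\<beta> by (intro sum_corr_bound_nonmultiples_le[of w Q a]) (auto simp: \<beta>_def)
  also have "\<dots> = 32 / w * (real Q * (real T + 1) + real Q * real Q)"
    using Q by (simp add: field_simps power2_eq_square)
  also have "\<dots> \<le> 32 / w * (10 * w * (6 * w) + 10 * w * (10 * w))"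
    using assms by (intro mult_left_mono add_mono mult_mono) auto
  also have "\<dots> = 5120 * w" using \<open>w > 0\<close> by (simp add: field_simps)
  finally have "(\<Sum>t\<in>{t\<in>{1..T}. \<not> Q dvd t}. corr_bound w (real t * x)) \<le> 5120 * w" .
  moreover have "(\<Sum>t\<in>{t\<in>{1..T}. Q dvd t}. corr_bound w (real t * x))
      \<le> 32 / (1 - \<eta>) * arc_peak \<eta> w (real Q) \<beta>"
    unfolding sum_dvd_corr_bound_eq[OF Q(1), where T = T and w = w and x = x and a = a] \<beta>_def[symmetric]
  proof (rule sum_corr_bound_multiples_le[OF assms(1) _ _ \<eta>])
    show "real (T div Q) \<le> 4 * w / real Q"
      using of_nat_div_le_of_nat[of T Q, where ?'a = real] assms(2)
      by (meson divide_right_mono of_nat_0_le_iff order_trans)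
    fix k assume "k \<in> {1..T div Q}"
    then have "k * Q \<le> T" using Q by (auto simp: less_eq_div_iff_mult_less_eq)
    then have "\<bar>real (k * Q) * \<beta>\<bar> \<le> 1 / (2 * real Q)" by (rule t\<beta>)
    also have "\<dots> \<le> 1/2" using Q by simp
    finally show "\<bar>real k * real Q * \<beta>\<bar> \<le> 1/2" by simp
  qed (use Q in auto)
  moreover have "(\<Sum>t\<in>{1..T}. corr_bound w (real t * x))
      = (\<Sum>t\<in>{t\<in>{1..T}. Q dvd t}. corr_bound w (real t * x)) + (\<Sum>t\<in>{t\<in>{1..T}. \<not> Q dvd t}. corr_bound w (real t * x))"
    by (subst sum.union_disjoint[symmetric]) (auto intro!: sum.cong)
  ultimately show ?thesis by (simp add: \<beta>_def)
qed

lemma norm_square_tent_sum_near_rational_le: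
  fixes a :: int and Q :: nat
  assumes "w \<ge> 1/2" "2 * w \<le> real M" and \<eta>: "0 < \<eta>" "\<eta> < 1"
    and Q: "Q > 0" "real Q \<le> 10 * w" and "coprime a (int Q)"
    and near: "\<bar>x - of_int a / real Q\<bar> \<le> 1 / (8 * w * real Q)"
  shows "(cmod (tent_sum w M D x))\<^sup>2
      \<le> 20000 / (1 - \<eta>) * (w + arc_peak \<eta> w (real Q) (x - of_int a / real Q))"
proof -
  define P where "P = arc_peak \<eta> w (real Q) (x - of_int a / real Q)"
  have "P \<ge> 0" by (simp add: P_def arc_peak_nonneg)
  have "real (nat \<lfloor>4 * w\<rfloor>) \<le> 4 * w" using assms(1) by simp
  then have "(\<Sum>t\<in>{1..nat \<lfloor>4 * w\<rfloor>}. corr_bound w (real t * x)) \<le> 5120 * w + 32 / (1 - \<eta>) * P"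
    unfolding P_def using assms by (intro sum_corr_bound_near_rational_le) auto
  then have "(cmod (tent_sum w M D x))\<^sup>2 \<le> 4 * w + 2 * (5120 * w + 32 / (1 - \<eta>) * P)"
    using norm_square_tent_sum_le[OF assms(1,2), of D x] assms(1) by simp
  also have "\<dots> = 10244 * w + 64 / (1 - \<eta>) * P" by simp
  also have "\<dots> \<le> 20000 / (1 - \<eta>) * w + 20000 / (1 - \<eta>) * P"
  proof (intro add_mono mult_right_mono)
    show "10244 \<le> 20000 / (1 - \<eta>)" using \<eta> by (simp add: field_simps)
    show "64 / (1 - \<eta>) \<le> 20000 / (1 - \<eta>)" using \<eta> by (intro divide_right_mono) auto
  qed (use \<open>P \<ge> 0\<close> assms(1) in auto)
  finally show ?thesis by (simp add: P_def distrib_left)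
qed

lemma Dirichlet_approx_unit_interval:
  assumes "N > 0" "x \<in> {0..1}"
  obtains a Q :: nat where "coprime a Q" "0 < Q" "Q \<le> N" "a \<le> Q"
    "\<bar>x - real a / real Q\<bar> \<le> 1 / (real N * real Q)"
proof -
  obtain h q where hq: "coprime h q" "0 < q" "q \<le> int N" "\<bar>of_int q * x - of_int h\<bar> < 1 / real N"
    using Dirichlet_approx_coprime[OF assms(1), of x] by metis
  have "0 \<le> of_int q * x" "of_int q * x \<le> of_int q" using assms(2) hq(2) by (auto intro: mult_left_le)
  moreover have "1 / real N \<le> 1" using assms(1) by simp
  ultimately have "real_of_int h > -1" "real_of_int h < of_int q + 1" using hq(4) by linarith+
  then have "0 \<le> h" "h \<le> q" by linarith+
  then obtain a Q where aQ: "h = int a" "q = int Q" using hq(2) by (metis zero_le_imp_eq_int less_imp_le)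
  have "(x - real a / real Q) * real Q = of_int q * x - of_int h"
    using hq(2) by (simp add: aQ field_simps)
  then have "\<bar>x - real a / real Q\<bar> * real Q = \<bar>of_int q * x - of_int h\<bar>"
    by (metis abs_mult abs_of_nat)
  then have "\<bar>x - real a / real Q\<bar> \<le> 1 / (real N * real Q)"
    using hq(2,4) assms(1) by (simp add: aQ field_simps)
  with hq \<open>h \<le> q\<close> show thesis by (intro that[of a Q]) (auto simp: aQ)
qed

lemma powr_add_le:
  fixes u v r :: real
  assumes "u \<ge> 0" "v \<ge> 0" "r \<ge> 0"
  shows "(u + v) powr r \<le> 2 powr r * (u powr r + v powr r)"
proof -
  have "(u + v) powr r \<le> (2 * max u v) powr r" using assms by (intro powr_mono2) auto
  also have "\<dots> = 2 powr r * max u v powr r" using assms by (simp add: powr_mult)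
  also have "\<dots> \<le> 2 powr r * (u powr r + v powr r)"
    by (intro mult_left_mono) (auto simp: max_def)
  finally show ?thesis .
qed

text \<open>The pair \<open>(Q, a)\<close> stands for the arc around \<open>a / Q\<close>.\<close>

definition arcs :: "real \<Rightarrow> (nat \<times> nat) set" where
  "arcs w = (SIGMA Q:{1..nat \<lceil>8 * w\<rceil>}. {..Q})"

lemma finite_arcs: "finite (arcs w)"
  by (simp add: arcs_def)

lemma nat_ceiling_8_mult:
  assumes "w \<ge> 1/2"
  shows "1 \<le> nat \<lceil>8 * w\<rceil>" "8 * w \<le> real (nat \<lceil>8 * w\<rceil>)" "real (nat \<lceil>8 * w\<rceil>) \<le> 10 * w"
  using assms by linarith+

lemma ex_arc_norm_square_tent_sum_le:
  assumes "w \<ge> 1/2" "2 * w \<le> real M" and \<eta>: "0 < \<eta>" "\<eta> < 1" and "x \<in> {0..1}"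
  shows "\<exists>(Q, a)\<in>arcs w. (cmod (tent_sum w M D x))\<^sup>2
      \<le> 20000 / (1 - \<eta>) * (w + arc_peak \<eta> w (real Q) (x - real a / real Q))"
proof -
  define N where "N = nat \<lceil>8 * w\<rceil>"
  have N: "N > 0" "8 * w \<le> real N" "real N \<le> 10 * w"
    using nat_ceiling_8_mult[OF assms(1)] by (simp_all add: N_def)
  obtain a Q :: nat where aQ: "coprime a Q" "0 < Q" "Q \<le> N" "a \<le> Q"
    and near: "\<bar>x - real a / real Q\<bar> \<le> 1 / (real N * real Q)"
    using Dirichlet_approx_unit_interval[OF N(1) assms(5)] by metis
  have "1 / (real N * real Q) \<le> 1 / (8 * w * real Q)"
    using N aQ assms(1) by (intro divide_left_mono mult_right_mono) auto
  then have "(cmod (tent_sum w M D x))\<^sup>2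
      \<le> 20000 / (1 - \<eta>) * (w + arc_peak \<eta> w (real Q) (x - real a / real Q))"
    using norm_square_tent_sum_near_rational_le[OF assms(1,2) \<eta> aQ(2), of "int a" x D] near N aQ by simp
  moreover have "(Q, a) \<in> arcs w" using aQ by (simp add: arcs_def N_def)
  ultimately show ?thesis by blast
qed

lemma norm_tent_sum_powr_le:
  assumes "w \<ge> 1/2" "2 * w \<le> real M" and \<eta>: "0 < \<eta>" "\<eta> < 1" and "x \<in> {0..1}" "0 \<le> r"
  shows "cmod (tent_sum w M D x) powr (2 * r) \<le> (40000 / (1 - \<eta>)) powr r *
    (w powr r + (\<Sum>(Q, a)\<in>arcs w. arc_peak \<eta> w (real Q) (x - real a / real Q) powr r))"
proof -
  define P where "P Q a = arc_peak \<eta> w (real Q) (x - real a / real Q)" for Q a :: nat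
  obtain Q a where Qa: "(Q, a) \<in> arcs w"
    and square: "(cmod (tent_sum w M D x))\<^sup>2 \<le> 20000 / (1 - \<eta>) * (w + P Q a)"
    using ex_arc_norm_square_tent_sum_le[OF assms(1-5), of D] unfolding P_def by blast
  have "cmod (tent_sum w M D x) powr (2 * r) = ((cmod (tent_sum w M D x))\<^sup>2) powr r"
    by (simp flip: powr_powr)
  also have "\<dots> \<le> (20000 / (1 - \<eta>) * (w + P Q a)) powr r"
    using square \<open>0 \<le> r\<close> by (intro powr_mono2) auto
  also have "\<dots> \<le> (20000 / (1 - \<eta>)) powr r * (2 powr r * (w powr r + P Q a powr r))"
    unfolding powr_mult[of "20000 / (1 - \<eta>)"] using assms
    by (intro mult_left_mono powr_add_le) (auto simp: P_def arc_peak_nonneg)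
  also have "\<dots> = (40000 / (1 - \<eta>)) powr r * (w powr r + P Q a powr r)"
    using powr_mult[of "20000 / (1 - \<eta>)" 2 r] by simp
  also have "\<dots> \<le> (40000 / (1 - \<eta>)) powr r * (w powr r + (\<Sum>(Q, a)\<in>arcs w. P Q a powr r))"
    using member_le_sum[OF Qa, of "\<lambda>(Q, a). P Q a powr r"] finite_arcs
    by (intro mult_left_mono add_left_mono) auto
  finally show ?thesis by (simp add: P_def)
qed

section \<open>The \<open>L\<^sup>p\<close> norm of a tent sum\<close>

lemma nn_integral_one_plus_powr_atLeast:
  assumes "\<rho> > 1" "A > 0"
  shows "(\<integral>\<^sup>+ x. ennreal ((1 + A * x) powr (- \<rho>)) * indicator {0..} x \<partial>lborel)
      = ennreal (1 / (A * (\<rho> - 1)))"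
proof -
  define F where "F x = - ((1 + A * x) powr (1 - \<rho>)) / (A * (\<rho> - 1))" for x
  have "(\<integral>\<^sup>+ x. ennreal ((1 + A * x) powr (- \<rho>)) * indicator {0..} x \<partial>lborel) = 0 - F 0"
  proof (rule nn_integral_FTC_atLeast)
    fix x :: real assume "0 \<le> x"
    then have "1 + A * x > 0" using assms by (simp add: add_pos_nonneg)
    then have "((\<lambda>x. (1 + A * x) powr (1 - \<rho>)) has_real_derivative
        (1 - \<rho>) * (1 + A * x) powr (1 - \<rho> - of_nat 1) * A) (at x)"
      by (intro DERIV_fun_powr) (auto intro!: derivative_eq_intros)
    then have "(F has_real_derivative
        - ((1 - \<rho>) * (1 + A * x) powr (1 - \<rho> - of_nat 1) * A) / (A * (\<rho> - 1))) (at x)"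
      unfolding F_def by (intro DERIV_cdivide DERIV_minus)
    also have "- ((1 - \<rho>) * (1 + A * x) powr (1 - \<rho> - of_nat 1) * A) / (A * (\<rho> - 1))
        = (1 + A * x) powr (- \<rho>)"
      using assms by (simp add: divide_simps) (simp add: algebra_simps)
    finally show "(F has_real_derivative (1 + A * x) powr (- \<rho>)) (at x)" .
  next
    have "((\<lambda>x. (1 + A * x) powr (1 - \<rho>)) \<longlongrightarrow> 0) at_top"
      using assms
      by (intro tendsto_neg_powr filterlim_tendsto_add_at_top[OF tendsto_const]
            filterlim_tendsto_pos_mult_at_top[OF tendsto_const] filterlim_ident) auto
    then have "(F \<longlongrightarrow> - 0 / (A * (\<rho> - 1))) at_top"
      unfolding F_def using assms by (intro tendsto_intros) auto
    then show "(F \<longlongrightarrow> 0) at_top" by simp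
  qed simp_all
  then show ?thesis by (simp add: F_def)
qed

lemma nn_integral_one_plus_abs_powr_le:
  assumes "\<rho> > 1" "A > 0"
  shows "(\<integral>\<^sup>+ x. ennreal ((1 + A * \<bar>x - c\<bar>) powr (- \<rho>)) \<partial>lborel) \<le> ennreal (2 / (A * (\<rho> - 1)))"
proof -
  define g where "g x = (1 + A * \<bar>x\<bar>) powr (- \<rho>)" for x
  have [measurable]: "g \<in> borel_measurable borel" unfolding g_def by measurable
  have right: "(\<integral>\<^sup>+ x. ennreal (g x) * indicator {0..} x \<partial>lborel) = ennreal (1 / (A * (\<rho> - 1)))"
    unfolding nn_integral_one_plus_powr_atLeast[OF assms, symmetric]
    by (intro nn_integral_cong) (auto simp: g_def indicator_def)
  have left: "(\<integral>\<^sup>+ x. ennreal (g x) * indicator {..0} x \<partial>lborel)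
      = (\<integral>\<^sup>+ x. ennreal (g x) * indicator {0..} x \<partial>lborel)"
    by (subst nn_integral_real_affine[where c = "-1" and t = 0])
      (auto simp: g_def indicator_def intro!: nn_integral_cong)
  have "(\<integral>\<^sup>+ x. ennreal ((1 + A * \<bar>x - c\<bar>) powr (- \<rho>)) \<partial>lborel) = (\<integral>\<^sup>+ x. ennreal (g x) \<partial>lborel)"
    by (subst nn_integral_real_affine[where c = 1 and t = c]) (auto simp: g_def)
  also have "\<dots> \<le> (\<integral>\<^sup>+ x. ennreal (g x) * indicator {0..} x + ennreal (g x) * indicator {..0} x \<partial>lborel)"
    by (intro nn_integral_mono) (auto simp: indicator_def)
  also have "\<dots> = ennreal (1 / (A * (\<rho> - 1))) + ennreal (1 / (A * (\<rho> - 1)))"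
    by (subst nn_integral_add) (auto simp: left right)
  also have "\<dots> = ennreal (2 / (A * (\<rho> - 1)))"
    using assms by (simp flip: ennreal_plus)
  finally show ?thesis .
qed

lemma nn_integral_arc_peak_powr_le:
  assumes "w > 0" "\<eta> * r > 1"
  shows "(\<integral>\<^sup>+ x. ennreal (arc_peak \<eta> w q (x - c) powr r) \<partial>lborel)
    \<le> ennreal ((w\<^sup>2 / q) powr r * (2 / (w\<^sup>2 * (\<eta> * r - 1))))"
proof -
  have "arc_peak \<eta> w q (x - c) powr r = (w\<^sup>2 / q) powr r * (1 + w\<^sup>2 * \<bar>x - c\<bar>) powr (- (\<eta> * r))" for x
    unfolding arc_peak_def by (subst powr_mult) (simp add: powr_powr)
  then have "(\<integral>\<^sup>+ x. ennreal (arc_peak \<eta> w q (x - c) powr r) \<partial>lborel)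
      = ennreal ((w\<^sup>2 / q) powr r) * (\<integral>\<^sup>+ x. ennreal ((1 + w\<^sup>2 * \<bar>x - c\<bar>) powr (- (\<eta> * r))) \<partial>lborel)"
    by (simp add: ennreal_mult nn_integral_cmult)
  also have "\<dots> \<le> ennreal ((w\<^sup>2 / q) powr r) * ennreal (2 / (w\<^sup>2 * (\<eta> * r - 1)))"
    using assms by (intro mult_left_mono nn_integral_one_plus_abs_powr_le) auto
  also have "\<dots> = ennreal ((w\<^sup>2 / q) powr r * (2 / (w\<^sup>2 * (\<eta> * r - 1))))"
    using assms by (intro ennreal_mult[symmetric]) auto
  finally show ?thesis .
qed

abbreviation arc_sum :: "real \<Rightarrow> real \<Rightarrow> real" where
  "arc_sum p w \<equiv> (\<Sum>Q\<in>{1..nat \<lceil>8 * w\<rceil>}. real Q powr (1 - p/2))"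

lemma sum_arcs_le:
  assumes "w > 0" "0 \<le> c"
  shows "(\<Sum>(Q, a)\<in>arcs w. (w\<^sup>2 / real Q) powr (p/2) * (2 / w\<^sup>2 * c))
      \<le> 4 * c * w powr (p - 2) * arc_sum p w"
proof -
  have "(\<Sum>(Q, a)\<in>arcs w. (w\<^sup>2 / real Q) powr (p/2) * (2 / w\<^sup>2 * c))
      = (\<Sum>Q\<in>{1..nat \<lceil>8 * w\<rceil>}. (real Q + 1) * ((w\<^sup>2 / real Q) powr (p/2) * (2 / w\<^sup>2 * c)))"
    unfolding arcs_def by (simp add: sum.Sigma[symmetric] add.commute)
  also have "\<dots> \<le> (\<Sum>Q\<in>{1..nat \<lceil>8 * w\<rceil>}. 4 * c * w powr (p - 2) * real Q powr (1 - p/2))"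
  proof (rule sum_mono)
    fix Q :: nat assume "Q \<in> {1..nat \<lceil>8 * w\<rceil>}"
    then have "Q \<ge> 1" by simp
    have "(w\<^sup>2) powr (p/2) = (w powr 2) powr (p/2)" using \<open>w > 0\<close> by simp
    also have "\<dots> = w powr p" by (simp only: powr_powr) simp
    finally have numerator: "(w\<^sup>2 / real Q) powr (p/2) = w powr p * real Q powr (- (p/2))"
      by (simp add: powr_divide powr_minus_divide)
    have "(real Q + 1) * ((w\<^sup>2 / real Q) powr (p/2) * (2 / w\<^sup>2 * c))
        \<le> (2 * real Q) * ((w\<^sup>2 / real Q) powr (p/2) * (2 / w\<^sup>2 * c))"
      using \<open>Q \<ge> 1\<close> assms by (intro mult_right_mono) auto
    also have "\<dots> = 4 * c * (w powr p / w\<^sup>2) * (real Q * real Q powr (- (p/2)))"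
      unfolding numerator by (simp add: mult_ac)
    also have "w powr p / w\<^sup>2 = w powr (p - 2)" using \<open>w > 0\<close> by (simp add: powr_diff)
    also have "real Q * real Q powr (- (p/2)) = real Q powr (1 - p/2)"
      using \<open>Q \<ge> 1\<close> by (simp add: powr_diff powr_minus_divide)
    finally show "(real Q + 1) * ((w\<^sup>2 / real Q) powr (p/2) * (2 / w\<^sup>2 * c))
        \<le> 4 * c * w powr (p - 2) * real Q powr (1 - p/2)" .
  qed
  finally show ?thesis by (simp add: sum_distrib_left)
qed

lemma Lp_pow_le_sum_nn_integral:
  assumes [measurable]: "\<And>i. i \<in> I \<Longrightarrow> P i \<in> borel_measurable borel"
    and nonneg: "0 \<le> A" "0 \<le> C" "\<And>i x. i \<in> I \<Longrightarrow> 0 \<le> P i x"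
    and pointwise: "\<And>x. x \<in> {0..1} \<Longrightarrow> cmod (f x) powr p \<le> C * (A + (\<Sum>i\<in>I. P i x))"
  shows "Lp_pow p f \<le> ennreal C * (ennreal A + (\<Sum>i\<in>I. \<integral>\<^sup>+ x. ennreal (P i x) \<partial>lborel))"
proof -
  have "Lp_pow p f
      \<le> (\<integral>\<^sup>+ x. ennreal C * (ennreal A * indicator {0..1} x + (\<Sum>i\<in>I. ennreal (P i x))) \<partial>lborel)"
    unfolding Lp_pow_def
  proof (rule nn_integral_mono)
    fix x :: real
    show "ennreal (cmod (f x) powr p) * indicator {0..1} x
      \<le> ennreal C * (ennreal A * indicator {0..1} x + (\<Sum>i\<in>I. ennreal (P i x)))"
    proof (cases "x \<in> {0..1}")
      case True
      then have "ennreal (cmod (f x) powr p) \<le> ennreal (C * (A + (\<Sum>i\<in>I. P i x)))"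
        by (intro ennreal_leI pointwise)
      also have "\<dots> = ennreal C * (ennreal A + (\<Sum>i\<in>I. ennreal (P i x)))"
        using nonneg by (simp add: ennreal_mult sum_nonneg sum_ennreal)
      finally show ?thesis using True by simp
    qed simp
  qed
  also have "\<dots> = ennreal C * (ennreal A + (\<Sum>i\<in>I. \<integral>\<^sup>+ x. ennreal (P i x) \<partial>lborel))"
    by (simp add: nn_integral_cmult nn_integral_add nn_integral_sum)
  finally show ?thesis .
qed

lemma Lp_pow_tent_sum_le:
  assumes w: "w \<ge> 1/2" "2 * w \<le> real M" and "p > 2" and \<eta>: "2 / p < \<eta>" "\<eta> < 1"
  shows "Lp_pow p (tent_sum w M D) \<le> ennreal ((40000 / (1 - \<eta>)) powr (p/2) *
      (w powr (p/2) + 4 / (\<eta> * (p/2) - 1) * w powr (p - 2) * arc_sum p w))"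
proof -
  define r where "r = p / 2"
  define C where "C = (40000 / (1 - \<eta>)) powr r"
  define c where "c = 1 / (\<eta> * r - 1)"
  define P where "P = (\<lambda>(Q, a) x. arc_peak \<eta> w (real Q) (x - real a / real Q) powr r)"
  have "0 < 2 / p" using \<open>p > 2\<close> by simp
  then have "\<eta> > 0" using \<eta> by linarith
  have "\<eta> * r > 1" using \<eta> \<open>p > 2\<close> by (simp add: r_def field_simps)
  then have "c \<ge> 0" by (simp add: c_def)
  have "Lp_pow p (tent_sum w M D)
      \<le> ennreal C * (ennreal (w powr r) + (\<Sum>i\<in>arcs w. \<integral>\<^sup>+ x. ennreal (P i x) \<partial>lborel))"
  proof (rule Lp_pow_le_sum_nn_integral)
    show "P i \<in> borel_measurable borel" for i
      unfolding P_def arc_peak_def case_prod_unfold by measurable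
    show "cmod (tent_sum w M D x) powr p \<le> C * (w powr r + (\<Sum>i\<in>arcs w. P i x))" if "x \<in> {0..1}" for x
      using norm_tent_sum_powr_le[OF w \<open>\<eta> > 0\<close> \<eta>(2) that, of r D] \<open>p > 2\<close>
      by (simp add: C_def P_def r_def case_prod_unfold)
  qed (auto simp: C_def P_def split: prod.split)
  also have "\<dots>
      \<le> ennreal C * (ennreal (w powr r) + (\<Sum>(Q, a)\<in>arcs w. ennreal ((w\<^sup>2 / real Q) powr r * (2 / w\<^sup>2 * c))))"
    unfolding P_def c_def using w \<open>\<eta> * r > 1\<close> nn_integral_arc_peak_powr_le[of w \<eta> r]
    by (intro mult_left_mono add_left_mono sum_mono) (auto split: prod.split)
  also have "\<dots> = ennreal (C * (w powr r + (\<Sum>(Q, a)\<in>arcs w. (w\<^sup>2 / real Q) powr r * (2 / w\<^sup>2 * c))))"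
    using \<open>c \<ge> 0\<close> by (simp add: C_def ennreal_mult sum_nonneg sum_ennreal case_prod_unfold)
  also have "\<dots> \<le> ennreal (C * (w powr r + 4 * c * w powr (p - 2) * arc_sum p w))"
    unfolding r_def using w \<open>c \<ge> 0\<close>
    by (intro ennreal_leI mult_left_mono add_left_mono sum_arcs_le) (auto simp: C_def)
  finally show ?thesis unfolding C_def c_def r_def by simp
qed

text \<open>The summand \<open>2\<close> keeps the factor positive down to \<open>K = 1/2\<close>, the smallest tent used.\<close>

definition growth :: "real \<Rightarrow> real \<Rightarrow> real" where
  "growth p K = (if p < 4 then 1 else if p = 4 then 2 + ln K else K powr (p/2 - 2))"

lemma ln_ge_minus_1:
  fixes K :: real
  assumes "K \<ge> 1/2"
  shows "ln K \<ge> -1"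
proof -
  have "ln (1/2) \<le> ln K" using assms by (intro ln_mono) auto
  then show ?thesis using ln_2_less_1 by (simp add: ln_div)
qed

lemma growth_pos: "K \<ge> 1/2 \<Longrightarrow> growth p K > 0"
  using ln_ge_minus_1[of K] by (auto simp: growth_def)

lemma growth_mono: "1/2 \<le> x \<Longrightarrow> x \<le> y \<Longrightarrow> growth p x \<le> growth p y"
  by (auto simp: growth_def intro!: powr_mono2)

lemma growth_mult_le:
  assumes "x \<ge> 1" "y \<ge> 1"
  shows "growth p (x * y) \<le> growth p x * growth p y"
  using assms by (auto simp: growth_def powr_mult ln_mult algebra_simps)

lemma arc_sum_le_of_lt_4:
  assumes "2 < p" "p < 4" "w \<ge> 1/2"
  shows "w powr (p/2 - 2) * arc_sum p w \<le> 10 powr (2 - p/2) / (2 - p/2)"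
proof -
  have "arc_sum p w \<le> real (nat \<lceil>8 * w\<rceil>) powr (2 - p/2) / (2 - p/2)"
    using sum_powr_minus_le[of "p/2 - 1" "nat \<lceil>8 * w\<rceil>"] assms by simp
  also have "\<dots> \<le> (10 * w) powr (2 - p/2) / (2 - p/2)"
    using assms nat_ceiling_8_mult[OF assms(3)] by (intro divide_right_mono powr_mono2) auto
  finally have "w powr (p/2 - 2) * arc_sum p w \<le> w powr (p/2 - 2) * ((10 * w) powr (2 - p/2) / (2 - p/2))"
    by (rule mult_left_mono) simp
  also have "\<dots> = 10 powr (2 - p/2) / (2 - p/2) * (w powr (p/2 - 2) * w powr (2 - p/2))"
    unfolding powr_mult by simp
  also have "w powr (p/2 - 2) * w powr (2 - p/2) = 1"
    using assms by (simp flip: powr_add)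
  finally show ?thesis by simp
qed

lemma arc_sum_4_le:
  assumes "w \<ge> 1/2"
  shows "arc_sum 4 w \<le> 5 * (2 + ln w)"
proof -
  define N where "N = nat \<lceil>8 * w\<rceil>"
  have N: "1 \<le> N" "real N \<le> 10 * w" using nat_ceiling_8_mult[OF assms] by (simp_all add: N_def)
  obtain m where m: "N = Suc m" using N(1) by (cases N) auto
  have "arc_sum 4 w = harm N" by (simp add: harm_def powr_minus N_def)
  also have "harm (Suc m) - ln (real (Suc m)) \<le> harm (Suc 0) - ln (real (Suc 0))"
    using decseq_harm_diff_ln by (rule decseqD) simp
  then have "harm N \<le> 1 + ln (real N)" by (simp add: m harm_def)
  also have "ln (real N) \<le> ln (16 * w)" using N by (intro ln_mono) auto
  also have "\<dots> = 4 * ln 2 + ln w" using assms ln_realpow[of 2 4] by (simp add: ln_mult)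
  also have "1 + (4 * ln 2 + ln w) \<le> 5 * (2 + ln w)"
    using ln_2_less_1 ln_ge_minus_1[OF assms] by simp
  finally show ?thesis by simp
qed

lemma arc_sum_le_suminf:
  assumes "p > 4"
  shows "arc_sum p w \<le> (\<Sum>n. real n powr (1 - p/2))"
proof (rule sum_le_suminf)
  show "summable (\<lambda>n. real n powr (1 - p/2))"
    using assms by (subst summable_real_powr_iff) auto
qed auto

lemma arc_sum_le_growth:
  assumes "p > 2"
  obtains B where "\<And>w. w \<ge> 1/2 \<Longrightarrow> w powr (p/2 - 2) * arc_sum p w \<le> B * growth p w"
proof -
  consider (less) "p < 4" | (equal) "p = 4" | (greater) "p > 4" by linarith
  then show thesis
  proof cases
    case less
    then show thesis
      using arc_sum_le_of_lt_4[OF assms] that[of "10 powr (2 - p/2) / (2 - p/2)"]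
      by (simp add: growth_def)
  next
    case equal
    then show thesis
      using arc_sum_4_le that[of 5] by (simp add: growth_def)
  next
    case greater
    then have "w powr (p/2 - 2) * arc_sum p w \<le> (\<Sum>n. real n powr (1 - p/2)) * growth p w" for w
      using mult_left_mono[OF arc_sum_le_suminf, of p "w powr (p/2 - 2)"]
      by (simp add: growth_def mult.commute)
    then show thesis by (rule that)
  qed
qed

definition weyl_rate :: "real \<Rightarrow> real \<Rightarrow> real" where
  "weyl_rate p K = sqrt K * growth p K powr (1 / p)"

lemma weyl_rate_nonneg: "K \<ge> 0 \<Longrightarrow> weyl_rate p K \<ge> 0"
  by (simp add: weyl_rate_def)

lemma weyl_rate_mono: "1/2 \<le> x \<Longrightarrow> x \<le> y \<Longrightarrow> p > 0 \<Longrightarrow> weyl_rate p x \<le> weyl_rate p y"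
  unfolding weyl_rate_def
  by (intro mult_mono powr_mono2 growth_mono) (auto simp: less_imp_le growth_pos)

lemma weyl_rate_powr:
  assumes "K \<ge> 1/2" "p > 0"
  shows "weyl_rate p K powr p = K powr (p/2) * growth p K"
proof -
  have "weyl_rate p K powr p = sqrt K powr p * (growth p K powr (1/p)) powr p"
    unfolding weyl_rate_def by (rule powr_mult)
  also have "sqrt K powr p = K powr (p/2)" using assms by (simp add: powr_powr flip: powr_half_sqrt)
  also have "(growth p K powr (1/p)) powr p = growth p K"
    using assms growth_pos[of K p] by (simp add: powr_powr)
  finally show ?thesis .
qed

lemma Lp_pow_tent_sum_le_growth:
  assumes "p > 2"
  obtains E where "E > 0"
    "\<And>w M D. w \<ge> 1/2 \<Longrightarrow> 2 * w \<le> real M \<Longrightarrow>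
      Lp_pow p (tent_sum w M D) \<le> ennreal (E * (w powr (p/2) * growth p w))"
proof -
  obtain \<eta> where \<eta>: "2 / p < \<eta>" "\<eta> < 1" using dense[of "2 / p" 1] assms by auto
  define A where "A = (40000 / (1 - \<eta>)) powr (p/2)"
  define c where "c = 4 / (\<eta> * (p/2) - 1)"
  have "A > 0" using \<eta> by (simp add: A_def)
  have "c > 0" using \<eta> assms by (simp add: c_def field_simps)
  obtain B where B: "\<And>w. w \<ge> 1/2 \<Longrightarrow> w powr (p/2 - 2) * arc_sum p w \<le> B * growth p w"
    using arc_sum_le_growth[OF assms] by metis
  define E where "E = 1 / growth p (1/2) + c * \<bar>B\<bar>"
  have "growth p (1/2) > 0" by (rule growth_pos) simp
  then have "E > 0" using \<open>c > 0\<close> by (auto simp: E_def intro!: add_pos_nonneg)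
  show thesis
  proof (rule that)
    show "A * E > 0" using \<open>A > 0\<close> \<open>E > 0\<close> by simp
    fix w D :: real and M :: nat assume w: "w \<ge> 1/2" "2 * w \<le> real M"
    have "w powr (p - 2) = w powr (p/2) * w powr (p/2 - 2)" by (simp flip: powr_add)
    then have "w powr (p/2) + c * w powr (p - 2) * arc_sum p w
        = w powr (p/2) * (1 + c * (w powr (p/2 - 2) * arc_sum p w))"
      by (simp add: distrib_left mult_ac)
    also have "\<dots> \<le> w powr (p/2) * (growth p w / growth p (1/2) + c * (\<bar>B\<bar> * growth p w))"
    proof (intro mult_left_mono add_mono)
      show "1 \<le> growth p w / growth p (1/2)"
        using growth_mono[OF order_refl w(1)] \<open>growth p (1/2) > 0\<close> by simp
      have "B * growth p w \<le> \<bar>B\<bar> * growth p w"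
        using growth_pos[OF w(1), of p] by (intro mult_right_mono) auto
      then show "w powr (p/2 - 2) * arc_sum p w \<le> \<bar>B\<bar> * growth p w"
        using B[OF w(1)] by linarith
    qed (use \<open>c > 0\<close> in auto)
    also have "\<dots> = E * (w powr (p/2) * growth p w)" by (simp add: E_def algebra_simps)
    finally have "A * (w powr (p/2) + c * w powr (p - 2) * arc_sum p w)
        \<le> A * E * (w powr (p/2) * growth p w)"
      using \<open>A > 0\<close> by (simp only: mult.assoc mult_left_mono less_imp_le)
    then show "Lp_pow p (tent_sum w M D) \<le> ennreal (A * E * (w powr (p/2) * growth p w))"
      using Lp_pow_tent_sum_le[OF w assms \<eta>, of D] unfolding A_def c_def
      by (meson ennreal_leI order_trans)
  qed
qed

lemma Lp_bound_tent_sum: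
  assumes "p > 2"
  obtains C where "C > 0"
    "\<And>w M D. w \<ge> 1/2 \<Longrightarrow> 2 * w \<le> real M \<Longrightarrow> Lp_bound p (tent_sum w M D) (C * weyl_rate p w)"
proof -
  obtain E where E: "E > 0"
    "\<And>w M D. w \<ge> 1/2 \<Longrightarrow> 2 * w \<le> real M \<Longrightarrow>
      Lp_pow p (tent_sum w M D) \<le> ennreal (E * (w powr (p/2) * growth p w))"
    using Lp_pow_tent_sum_le_growth[OF assms] by metis
  have "Lp_bound p (tent_sum w M D) (E powr (1 / p) * weyl_rate p w)"
    if "w \<ge> 1/2" "2 * w \<le> real M" for w M D
  proof -
    have "E * (w powr (p/2) * growth p w) = (E powr (1 / p) * weyl_rate p w) powr p"
      using that assms \<open>E > 0\<close> by (simp add: powr_mult weyl_rate_powr powr_powr)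
    moreover have "tent_sum w M D \<in> borel_measurable borel"
      by (intro borel_measurable_continuous_onI continuous_on_tent_sum)
    ultimately show ?thesis
      using E(2)[OF that, of D] that by (simp add: Lp_bound_def weyl_rate_nonneg)
  qed
  then show thesis using that[of "E powr (1 / p)"] \<open>E > 0\<close> by simp
qed

section \<open>Sums over intervals\<close>

lemma tent_eq_ramp_diff:
  assumes "w > 0" "t \<ge> 0"
  shows "tent w t / 2 = min 1 (t / w) - min 1 (t / (2 * w))"
  using assms by (auto simp: tent_def min_def max_def abs_if field_simps)

lemma sum_tent_halvings:
  assumes "K > 0" "t \<ge> 0"
  shows "(\<Sum>j\<in>{1..n}. tent (K / 2 ^ j) t / 2) = min 1 (t / (K / 2 ^ n)) - min 1 (t / K)"
proof (induction n)
  case (Suc n)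
  have "tent (K / 2 ^ Suc n) t / 2 = min 1 (t / (K / 2 ^ Suc n)) - min 1 (t / (2 * (K / 2 ^ Suc n)))"
    using assms by (intro tent_eq_ramp_diff) auto
  also have "2 * (K / 2 ^ Suc n) = K / 2 ^ n" by simp
  finally have "tent (K / 2 ^ Suc n) t / 2 = min 1 (t / (K / 2 ^ Suc n)) - min 1 (t / (K / 2 ^ n))" .
  moreover have "(\<Sum>j\<in>{1..Suc n}. tent (K / 2 ^ j) t / 2)
      = (\<Sum>j\<in>{1..n}. tent (K / 2 ^ j) t / 2) + tent (K / 2 ^ Suc n) t / 2"
    by simp
  ultimately show ?case using Suc by linarith
qed simp

text \<open>The indicator of an integer interval is a superposition of tents whose widths decrease
  geometrically towards the two endpoints; this is what removes the logarithm that Weyl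
  differencing loses on sharply cut sums.\<close>

lemma one_eq_sum_tents:
  fixes N :: nat
  assumes "N < 2 ^ Suc J" and t: "t \<in> {1..real N - 1}"
  defines "K \<equiv> real N / 2"
  shows "1 = tent K t + (\<Sum>j\<in>{1..J}. tent (K / 2 ^ j) t / 2 + tent (K / 2 ^ j) (real N - t) / 2)"
proof -
  have "K > 0" using t by (simp add: K_def)
  have "real N < real (2 ^ Suc J)" using assms(1) by (simp only: of_nat_less_iff)
  then have "K / 2 ^ J \<le> 1" by (simp add: K_def field_simps)
  have halvings: "(\<Sum>j\<in>{1..J}. tent (K / 2 ^ j) u / 2) = 1 - min 1 (u / K)" if "u \<ge> 1" for u
  proof -
    have "1 \<le> u / (K / 2 ^ J)"
      using order_trans[OF \<open>K / 2 ^ J \<le> 1\<close> that] \<open>K > 0\<close> by (subst le_divide_eq_1_pos) auto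
    then show ?thesis using sum_tent_halvings[of K u J] that \<open>K > 0\<close> by simp
  qed
  have "tent K t = min 1 (t / K) + min 1 ((real N - t) / K) - 1"
    using t \<open>K > 0\<close> by (auto simp: tent_def min_def max_def abs_if K_def field_simps)
  then show ?thesis using halvings[of t] halvings[of "real N - t"] t by (simp add: sum.distrib)
qed

definition weyl_sum :: "nat \<Rightarrow> nat \<Rightarrow> real \<Rightarrow> complex" where
  "weyl_sum A M x = (\<Sum>t\<in>{1..M}. unit_exp ((real A + real t)\<^sup>2 * x))"

lemma tent_sum_eq_left:
  assumes "w > 0"
  shows "tent_sum w (Suc M) A x = (\<Sum>t\<in>{1..M}. of_real (tent w (real t)) * unit_exp ((A + real t)\<^sup>2 * x))"
  unfolding tent_sum_def using assms
  by (intro sum.mono_neutral_right) (auto simp: tent_0 Suc_le_eq)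

lemma tent_sum_eq_right:
  assumes "w > 0"
  shows "tent_sum w (Suc M) (- (A + real (Suc M))) x
    = (\<Sum>t\<in>{1..M}. of_real (tent w (real (Suc M) - real t)) * unit_exp ((A + real t)\<^sup>2 * x))"
  unfolding tent_sum_eq_left[OF assms]
proof (rule sum.reindex_bij_witness[of _ "\<lambda>t. Suc M - t" "\<lambda>t. Suc M - t"])
  fix l assume l: "l \<in> {1..M}"
  have "(- (A + real (Suc M)) + real l)\<^sup>2 = (A + real (Suc M - l))\<^sup>2"
    using l by (simp add: of_nat_diff power2_eq_square algebra_simps)
  then show "of_real (tent w (real (Suc M) - real (Suc M - l))) * unit_exp ((A + real (Suc M - l))\<^sup>2 * x)
      = of_real (tent w (real l)) * unit_exp ((- (A + real (Suc M)) + real l)\<^sup>2 * x)"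
    using l by (simp add: of_nat_diff)
qed auto

lemma weyl_sum_eq_tent_sums:
  assumes "Suc M < 2 ^ Suc J"
  defines "K \<equiv> real (Suc M) / 2"
  shows "weyl_sum A M x = tent_sum K (Suc M) (real A) x +
     (\<Sum>j\<in>{1..J}. 1/2 * tent_sum (K / 2 ^ j) (Suc M) (real A) x
       + 1/2 * tent_sum (K / 2 ^ j) (Suc M) (- (real A + real (Suc M))) x)"
proof -
  have pos: "K > 0" "K / 2 ^ j > 0" for j by (auto simp: K_def)
  define E where "E t = unit_exp ((real A + real t)\<^sup>2 * x)" for t
  define l where "l j t = complex_of_real (tent (K / 2 ^ j) (real t)) * E t" for j t
  define r where "r j t = complex_of_real (tent (K / 2 ^ j) (real (Suc M) - real t)) * E t" for j t
  have "E t = l 0 t + (\<Sum>j\<in>{1..J}. 1/2 * l j t + 1/2 * r j t)" if "t \<in> {1..M}" for t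
  proof -
    define W where "W = tent K (real t)
        + (\<Sum>j\<in>{1..J}. tent (K / 2 ^ j) (real t) / 2 + tent (K / 2 ^ j) (real (Suc M) - real t) / 2)"
    have "W = 1"
      unfolding W_def K_def using one_eq_sum_tents[OF assms(1), of "real t"] that by simp
    then have "E t = of_real W * E t" by simp
    also have "\<dots> = l 0 t + (\<Sum>j\<in>{1..J}. 1/2 * l j t + 1/2 * r j t)"
      by (simp add: W_def l_def r_def distrib_right sum_distrib_right)
    finally show ?thesis .
  qed
  then have "weyl_sum A M x = (\<Sum>t\<in>{1..M}. l 0 t) + (\<Sum>t\<in>{1..M}. \<Sum>j\<in>{1..J}. 1/2 * l j t + 1/2 * r j t)"
    by (simp add: weyl_sum_def E_def sum.distrib)
  also have "(\<Sum>t\<in>{1..M}. \<Sum>j\<in>{1..J}. 1/2 * l j t + 1/2 * r j t)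
      = (\<Sum>j\<in>{1..J}. 1/2 * (\<Sum>t\<in>{1..M}. l j t) + 1/2 * (\<Sum>t\<in>{1..M}. r j t))"
    unfolding sum.swap[of _ "{1..J}"] by (simp only: sum.distrib sum_distrib_left)
  finally show ?thesis
    unfolding l_def r_def E_def
    using tent_sum_eq_left[OF pos(1), of M "real A" x] tent_sum_eq_left[OF pos(2), of _ M "real A" x]
      tent_sum_eq_right[OF pos(2), of _ M "real A" x]
    by simp
qed

lemma weyl_rate_halving_le:
  assumes "p > 0" "K / 2 ^ j \<ge> 1/2"
  shows "weyl_rate p (K / 2 ^ j) \<le> weyl_rate p K * (1 / sqrt 2) ^ j"
proof -
  have "K \<ge> 1/2 * 2 ^ j" using assms by (simp add: field_simps)
  then have "K \<ge> 1/2" using one_le_power[of "2::real" j] by linarith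
  have "sqrt (K / 2 ^ j) = sqrt K * (1 / sqrt 2) ^ j"
    by (simp add: real_sqrt_divide real_sqrt_power power_divide)
  moreover have "growth p (K / 2 ^ j) powr (1/p) \<le> growth p K powr (1/p)"
    using assms \<open>K \<ge> 1/2\<close>
    by (intro powr_mono2 growth_mono less_imp_le[OF growth_pos]) (auto simp: divide_le_eq mult_left_le)
  ultimately show ?thesis
    unfolding weyl_rate_def using \<open>K \<ge> 1/2\<close> by (simp add: mult_left_mono mult_ac)
qed

lemma sum_weyl_rate_halvings_le:
  assumes "p > 0" "K / 2 ^ J \<ge> 1/2"
  shows "(\<Sum>j\<le>J. weyl_rate p (K / 2 ^ j)) \<le> 4 * weyl_rate p K"
proof -
  define q where "q = 1 / sqrt 2"
  have "4/3 \<le> sqrt (2::real)" by (rule real_le_rsqrt) (simp add: power2_eq_square)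
  then have q: "0 < q" "q \<le> 3/4" by (auto simp: q_def divide_le_eq)
  have K: "K / 2 ^ j \<ge> 1/2" if "j \<le> J" for j
  proof -
    have "0 < K / 2 ^ J" using assms(2) by linarith
    then have "K \<ge> 0" by (simp add: zero_less_divide_iff)
    then have "K / 2 ^ J \<le> K / 2 ^ j" using that by (intro divide_left_mono power_increasing) auto
    then show ?thesis using assms(2) by linarith
  qed
  have "weyl_rate p K \<ge> 0" using K[of 0] by (simp add: weyl_rate_nonneg)
  have "(\<Sum>j\<le>J. weyl_rate p (K / 2 ^ j)) \<le> (\<Sum>j\<le>J. weyl_rate p K * q ^ j)"
    unfolding q_def using assms(1) K by (intro sum_mono weyl_rate_halving_le) auto
  also have "\<dots> = weyl_rate p K * (\<Sum>j\<le>J. q ^ j)" by (simp add: sum_distrib_left)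
  also have "\<dots> \<le> weyl_rate p K * 4"
  proof (rule mult_left_mono)
    have "(\<Sum>j\<le>J. q ^ j) \<le> 1 / (1 - q)"
      using geometric_sum_less[of q "{..J}"] q by (simp add: less_imp_le)
    also have "\<dots> \<le> 4" using q by (simp add: divide_le_eq)
    finally show "(\<Sum>j\<le>J. q ^ j) \<le> 4" .
  qed fact
  finally show ?thesis by simp
qed

lemma Lp_bound_weyl_sum_of_tent_sum:
  assumes tent: "\<And>j D. j \<le> J \<Longrightarrow> Lp_bound p (tent_sum (real (Suc M) / 2 / 2 ^ j) (Suc M) D) (b j)"
    and "Suc M < 2 ^ Suc J" "1 \<le> p"
  shows "Lp_bound p (weyl_sum A M) (\<Sum>j\<le>J. b j)"
proof -
  define K where "K = real (Suc M) / 2"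
  have half: "Lp_bound p (\<lambda>x. 1/2 * tent_sum (K / 2 ^ j) (Suc M) D x) (1/2 * b j)" if "j \<le> J" for j D
    using Lp_bound_cmult[OF tent[OF that], of "1/2"] assms(3) by (simp add: norm_divide K_def)
  have "Lp_bound p (weyl_sum A M) (b 0 + (\<Sum>j\<in>{1..J}. 1/2 * b j + 1/2 * b j))"
    unfolding weyl_sum_eq_tent_sums[OF assms(2), abs_def, folded K_def] using tent[of 0] assms(3)
    by (intro Lp_bound_add Lp_bound_sum half) (auto simp: K_def)
  then show ?thesis by (simp add: atMost_atLeast0 sum.atLeast_Suc_atMost)
qed

lemma Lp_bound_weyl_sum_of_gt_2:
  assumes "p > 2"
  obtains C where "C > 0" "\<And>A M. M \<ge> 1 \<Longrightarrow> Lp_bound p (weyl_sum A M) (C * weyl_rate p (real M))"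
proof -
  obtain C where C: "C > 0"
    "\<And>w M D. w \<ge> 1/2 \<Longrightarrow> 2 * w \<le> real M \<Longrightarrow> Lp_bound p (tent_sum w M D) (C * weyl_rate p w)"
    using Lp_bound_tent_sum[OF assms] by metis
  have "Lp_bound p (weyl_sum A M) (4 * C * weyl_rate p (real M))" if "M \<ge> 1" for A M
  proof -
    define K where "K = real (Suc M) / 2"
    obtain J where J: "2 ^ J \<le> Suc M" "Suc M < 2 ^ Suc J"
      using ex_power_ivl1[of 2 "Suc M"] by auto
    have K: "K / 2 ^ j \<ge> 1/2" if "j \<le> J" for j
    proof -
      have "(2::nat) ^ j \<le> Suc M" by (rule order_trans[OF power_increasing[OF that] J(1)]) simp
      then have "real (2 ^ j) \<le> real (Suc M)" by (simp only: of_nat_le_iff)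
      then show ?thesis by (simp add: K_def field_simps)
    qed
    have "2 * (K / 2 ^ j) \<le> real (Suc M)" for j
    proof -
      have "2 * (K / 2 ^ j) \<le> 2 * (K / 1)"
        by (intro mult_left_mono divide_left_mono) (auto simp: K_def)
      also have "\<dots> = real (Suc M)" by (simp add: K_def)
      finally show ?thesis .
    qed
    then have sum_bound: "Lp_bound p (weyl_sum A M) (\<Sum>j\<le>J. C * weyl_rate p (K / 2 ^ j))"
      unfolding K_def using assms K by (intro Lp_bound_weyl_sum_of_tent_sum C J(2)) (auto simp: K_def)
    have "(\<Sum>j\<le>J. weyl_rate p (K / 2 ^ j)) \<le> 4 * weyl_rate p K"
      using assms K by (intro sum_weyl_rate_halvings_le) auto
    also have "weyl_rate p K \<le> weyl_rate p (real M)"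
      using assms that by (intro weyl_rate_mono) (auto simp: K_def)
    finally have "(\<Sum>j\<le>J. C * weyl_rate p (K / 2 ^ j)) \<le> 4 * C * weyl_rate p (real M)"
      using C(1) by (simp flip: sum_distrib_left)
    with sum_bound show ?thesis using assms by (auto intro: Lp_bound_mono)
  qed
  then show thesis using that[of "4 * C"] C(1) by simp
qed

text \<open>The case \<open>p = 2\<close> is inherited from \<open>p = 3\<close>, since \<open>growth\<close> is constant for \<open>p < 4\<close>.\<close>

lemma Lp_bound_weyl_sum:
  assumes "p \<ge> 2"
  obtains C where "C > 0" "\<And>A M. M \<ge> 1 \<Longrightarrow> Lp_bound p (weyl_sum A M) (C * weyl_rate p (real M))"
proof (cases "p = 2")
  case False
  then show thesis using Lp_bound_weyl_sum_of_gt_2[of p] assms that by auto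
next
  case True
  obtain C where C: "C > 0" "\<And>A M. M \<ge> 1 \<Longrightarrow> Lp_bound 3 (weyl_sum A M) (C * weyl_rate 3 (real M))"
    using Lp_bound_weyl_sum_of_gt_2[of 3] by auto
  have "Lp_bound 2 (weyl_sum A M) (C * weyl_rate 3 (real M))" if "M \<ge> 1" for A M
    by (rule Lp_bound_lower_exponent[OF C(2)[OF that]]) auto
  then show thesis using that[of C] C(1) True by (simp add: weyl_rate_def growth_def)
qed

section \<open>Tails of the series\<close>

lemma sum_mult_by_parts:
  fixes a z :: "nat \<Rightarrow> 'a::comm_ring_1"
  shows "(\<Sum>i\<le>m. a i * z i) = a m * (\<Sum>j\<le>m. z j) + (\<Sum>i<m. (a i - a (Suc i)) * (\<Sum>j\<le>i. z j))"
  by (induction m) (simp_all add: algebra_simps)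

lemma Lp_bound_sum_mult_antimono:
  fixes a :: "nat \<Rightarrow> real"
  assumes "\<And>i. i \<le> m \<Longrightarrow> Lp_bound p (\<lambda>x. \<Sum>j\<le>i. z j x) B"
    and "\<And>i. a (Suc i) \<le> a i" "\<And>i. 0 \<le> a i" "1 \<le> p"
  shows "Lp_bound p (\<lambda>x. \<Sum>i\<le>m. of_real (a i) * z i x) (a 0 * B)"
proof -
  have "Lp_bound p (\<lambda>x. of_real (a m) * (\<Sum>j\<le>m. z j x) + (\<Sum>i<m. of_real (a i - a (Suc i)) * (\<Sum>j\<le>i. z j x)))
    (cmod (of_real (a m)) * B + (\<Sum>i<m. cmod (of_real (a i - a (Suc i))) * B))"
    using assms by (intro Lp_bound_add Lp_bound_sum Lp_bound_cmult) auto
  moreover have "cmod (of_real (a m)) * B + (\<Sum>i<m. cmod (of_real (a i - a (Suc i))) * B) = a 0 * B"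
  proof -
    have "cmod (of_real (a m)) * B + (\<Sum>i<m. cmod (of_real (a i - a (Suc i))) * B)
        = a m * B + (\<Sum>i<m. a i - a (Suc i)) * B"
      using assms(2,3) by (simp del: of_real_diff add: sum_distrib_right)
    also have "(\<Sum>i<m. a i - a (Suc i)) = a 0 - a m" by (rule sum_lessThan_telescope')
    finally show ?thesis by (simp add: algebra_simps)
  qed
  ultimately show ?thesis by (simp add: sum_mult_by_parts)
qed

definition Rs_term :: "real \<Rightarrow> nat \<Rightarrow> real \<Rightarrow> complex" where
  "Rs_term s n x = of_real (real n powr (- 2 * s)) * unit_exp (of_int (int (n\<^sup>2)) * x)"

definition Rs_sum :: "real \<Rightarrow> nat \<Rightarrow> nat \<Rightarrow> real \<Rightarrow> complex" where
  "Rs_sum s L M x = (\<Sum>n\<in>{L..<M}. Rs_term s n x)"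

lemma continuous_on_Rs_sum: "continuous_on A (Rs_sum s L M)"
  unfolding Rs_sum_def Rs_term_def by (intro continuous_intros)

lemma borel_measurable_Rs_sum [measurable]: "Rs_sum s L M \<in> borel_measurable borel"
  by (intro borel_measurable_continuous_onI continuous_on_Rs_sum)

lemma Rs_sum_eq_0: "M \<le> L \<Longrightarrow> Rs_sum s L M = (\<lambda>x. 0)"
  by (simp add: Rs_sum_def fun_eq_iff)

lemma Rs_sum_concat:
  assumes "K \<le> L" "L \<le> M"
  shows "Rs_sum s K L x + Rs_sum s L M x = Rs_sum s K M x"
  unfolding Rs_sum_def using assms by (rule sum.atLeastLessThan_concat)

definition tail_rate :: "real \<Rightarrow> real \<Rightarrow> real \<Rightarrow> real" where
  "tail_rate p s L = L powr (1/2 - 2 * s) * growth p L powr (1 / p)"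

lemma tail_rate_nonneg: "tail_rate p s L \<ge> 0"
  by (simp add: tail_rate_def)

lemma tail_rate_eq_weyl_rate: "L \<ge> 0 \<Longrightarrow> tail_rate p s L = L powr (- 2 * s) * weyl_rate p L"
  by (simp add: tail_rate_def weyl_rate_def powr_add[of L "1/2" "- 2 * s", simplified] powr_half_sqrt)

lemma tail_rate_mult_le:
  assumes "x \<ge> 1" "y \<ge> 1" "p > 0"
  shows "tail_rate p s (x * y) \<le> tail_rate p s x * tail_rate p s y"
proof -
  have "x * y \<ge> 1" using mult_mono[of 1 x 1 y] assms by simp
  then have "growth p (x * y) powr (1 / p) \<le> (growth p x * growth p y) powr (1 / p)"
    using assms growth_pos[of "x * y" p] by (intro powr_mono2 growth_mult_le) auto
  then have "(x * y) powr (1/2 - 2 * s) * growth p (x * y) powr (1 / p)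
      \<le> (x * y) powr (1/2 - 2 * s) * (growth p x * growth p y) powr (1 / p)"
    by (intro mult_left_mono) auto
  also have "\<dots> = tail_rate p s x * tail_rate p s y"
    by (simp add: tail_rate_def powr_mult mult_ac)
  finally show ?thesis by (simp add: tail_rate_def)
qed

lemma growth_le_powr:
  assumes "\<epsilon> > 0"
  obtains C where "C > 0" "\<And>x. x \<ge> 1 \<Longrightarrow> growth p x \<le> C * x powr (max 0 (p/2 - 2) + \<epsilon>)"
proof
  show "2 + 1 / \<epsilon> > 0" using assms by (simp add: add_pos_pos)
  fix x :: real assume "x \<ge> 1"
  then have "1 \<le> x powr \<epsilon>" using assms by (intro ge_one_powr_ge_zero) auto
  moreover have "ln x \<le> x powr \<epsilon> / \<epsilon>" using \<open>x \<ge> 1\<close> assms by (intro ln_powr_bound) auto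
  ultimately have "2 + ln x \<le> (2 + 1 / \<epsilon>) * x powr \<epsilon>" "1 \<le> (2 + 1 / \<epsilon>) * x powr \<epsilon>"
    using assms by (auto simp: distrib_right intro: order_trans[of _ "2 * x powr \<epsilon>"] add_increasing2)
  moreover have "x powr (p/2 - 2) * 1 \<le> x powr (p/2 - 2) * ((2 + 1 / \<epsilon>) * x powr \<epsilon>)"
    using calculation(2) by (intro mult_left_mono) auto
  ultimately show "growth p x \<le> (2 + 1 / \<epsilon>) * x powr (max 0 (p/2 - 2) + \<epsilon>)"
    by (auto simp: growth_def max_def powr_add mult_ac)
qed

lemma s_star_eq_max: "p > 0 \<Longrightarrow> s_star p = 1/4 + max 0 (1/4 - 1/p)"
  by (auto simp: s_star_def max_def field_simps)

lemma tail_rate_le_powr: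
  assumes "p > 0" "s > s_star p"
  obtains C \<delta> where "C > 0" "\<delta> > 0" "\<And>x. x \<ge> 1 \<Longrightarrow> tail_rate p s x \<le> C * x powr (- \<delta>)"
proof -
  define \<delta> where "\<delta> = s - s_star p"
  have "\<delta> > 0" using assms by (simp add: \<delta>_def)
  then have "p * \<delta> > 0" using assms by simp
  then obtain C where C: "C > 0" "\<And>x. x \<ge> 1 \<Longrightarrow> growth p x \<le> C * x powr (max 0 (p/2 - 2) + p * \<delta>)"
    using growth_le_powr[of "p * \<delta>" p] by metis
  have "(max 0 (p/2 - 2) + p * \<delta>) * (1 / p) = max 0 (1/2 - 2/p) + \<delta>"
    using assms by (simp add: max_def field_simps)
  then have exponent: "1/2 - 2 * s + (max 0 (p/2 - 2) + p * \<delta>) * (1 / p) = - \<delta>"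
    using s_star_eq_max[of p] assms by (simp add: \<delta>_def max_def)
  have "tail_rate p s x \<le> C powr (1 / p) * x powr (- \<delta>)" if "x \<ge> 1" for x
  proof -
    have "growth p x powr (1 / p) \<le> (C * x powr (max 0 (p/2 - 2) + p * \<delta>)) powr (1 / p)"
      using assms that growth_pos[of x p] by (intro powr_mono2 C) auto
    then have "tail_rate p s x
        \<le> x powr (1/2 - 2 * s) * (C * x powr (max 0 (p/2 - 2) + p * \<delta>)) powr (1 / p)"
      unfolding tail_rate_def by (intro mult_left_mono) auto
    also have "\<dots> = C powr (1 / p) * x powr (1/2 - 2 * s + (max 0 (p/2 - 2) + p * \<delta>) * (1 / p))"
      unfolding powr_mult powr_powr powr_add[of x "1/2 - 2 * s"] by (simp only: mult_ac)
    finally show ?thesis unfolding exponent .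
  qed
  then show thesis using that[of "C powr (1 / p)" \<delta>] C(1) \<open>\<delta> > 0\<close> by simp
qed

lemma tail_rate_tendsto_0:
  assumes "p > 0" "s > s_star p"
  shows "(\<lambda>n. tail_rate p s (real n)) \<longlonglongrightarrow> 0"
proof -
  obtain C \<delta> where C: "C > 0" "\<delta> > 0" "\<And>x. x \<ge> 1 \<Longrightarrow> tail_rate p s x \<le> C * x powr (- \<delta>)"
    using tail_rate_le_powr[OF assms] by metis
  have "(\<lambda>n. C * real n powr (- \<delta>)) \<longlonglongrightarrow> C * 0"
    using C by (intro tendsto_intros tendsto_neg_powr filterlim_real_sequentially) auto
  then have upper: "(\<lambda>n. C * real n powr (- \<delta>)) \<longlonglongrightarrow> 0" by simp
  show ?thesis
  proof (rule tendsto_sandwich[OF _ _ tendsto_const upper])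
    show "\<forall>\<^sub>F n in sequentially. 0 \<le> tail_rate p s (real n)" by (simp add: tail_rate_nonneg)
    show "\<forall>\<^sub>F n in sequentially. tail_rate p s (real n) \<le> C * real n powr (- \<delta>)"
      using eventually_ge_at_top[of 1] by eventually_elim (simp add: C(3))
  qed
qed

lemma sum_tail_rate_dyadic_le:
  assumes "p > 0" "s > s_star p"
  obtains B where "B > 0" "\<And>L j. L \<ge> 1 \<Longrightarrow> (\<Sum>k<j. tail_rate p s (2 ^ k * L)) \<le> B * tail_rate p s L"
proof -
  obtain C \<delta> where C: "C > 0" "\<delta> > 0" "\<And>x. x \<ge> 1 \<Longrightarrow> tail_rate p s x \<le> C * x powr (- \<delta>)"
    using tail_rate_le_powr[OF assms] by metis
  define q where "q = 2 powr (- \<delta>)"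
  have q: "0 < q" "q < 1" using C powr_less_mono[of "- \<delta>" 0 2] by (auto simp: q_def)
  have "(\<Sum>k<j. tail_rate p s (2 ^ k * L)) \<le> C / (1 - q) * tail_rate p s L" if "L \<ge> 1" for L j
  proof -
    have "(\<Sum>k<j. tail_rate p s (2 ^ k * L)) \<le> (\<Sum>k<j. C * q ^ k * tail_rate p s L)"
    proof (rule sum_mono)
      fix k
      have "(2 ^ k) powr (- \<delta>) = q ^ k"
        by (simp add: q_def powr_powr mult.commute flip: powr_realpow)
      then have "tail_rate p s (2 ^ k) \<le> C * q ^ k" using C(3)[of "2 ^ k"] by simp
      then have "tail_rate p s (2 ^ k) * tail_rate p s L \<le> C * q ^ k * tail_rate p s L"
        by (intro mult_right_mono tail_rate_nonneg)
      then show "tail_rate p s (2 ^ k * L) \<le> C * q ^ k * tail_rate p s L"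
        using tail_rate_mult_le[of "2 ^ k" L p s] that assms by simp
    qed
    also have "\<dots> = C * tail_rate p s L * (\<Sum>k<j. q ^ k)"
      by (simp add: sum_distrib_left mult_ac)
    also have "\<dots> \<le> C * tail_rate p s L * (1 / (1 - q))"
      using geometric_sum_less[of q "{..<j}"] q C by (intro mult_left_mono) (auto simp: tail_rate_nonneg)
    finally show ?thesis by simp
  qed
  then show thesis using that[of "C / (1 - q)"] C q by simp
qed

lemma Lp_bound_Rs_sum_dyadic_block:
  assumes "p \<ge> 2" "s \<ge> 0"
  obtains C where "C > 0"
    "\<And>L M. L \<ge> 1 \<Longrightarrow> M \<le> 2 * L \<Longrightarrow> Lp_bound p (Rs_sum s L M) (C * tail_rate p s (real L))"
proof -
  obtain C where C: "C > 0" "\<And>A M. M \<ge> 1 \<Longrightarrow> Lp_bound p (weyl_sum A M) (C * weyl_rate p (real M))"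
    using Lp_bound_weyl_sum[OF assms(1)] by metis
  have "Lp_bound p (Rs_sum s L M) (C * tail_rate p s (real L))" if "L \<ge> 1" "L < M" "M \<le> 2 * L" for L M
  proof -
    define m where "m = M - L - 1"
    define a where "a i = real (L + i) powr (- 2 * s)" for i
    define z where "z i x = unit_exp (of_int (int ((L + i)\<^sup>2)) * x)" for i x
    have "m < L" using that by (simp add: m_def)
    have "Lp_bound p (\<lambda>x. \<Sum>i\<le>m. of_real (a i) * z i x) (a 0 * (C * weyl_rate p (real L)))"
    proof (rule Lp_bound_sum_mult_antimono)
      fix i assume "i \<le> m"
      have "(\<lambda>x. \<Sum>j\<le>i. z j x) = weyl_sum (L - 1) (i + 1)"
        unfolding weyl_sum_def z_def using that
        by (intro ext sum.reindex_bij_witness[of _ "\<lambda>t. t - 1" Suc]) (auto simp: of_nat_diff)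
      moreover have "Lp_bound p (weyl_sum (L - 1) (i + 1)) (C * weyl_rate p (real L))"
        using C \<open>i \<le> m\<close> \<open>m < L\<close> assms
        by (intro Lp_bound_mono[OF C(2)] mult_left_mono weyl_rate_mono) auto
      ultimately show "Lp_bound p (\<lambda>x. \<Sum>j\<le>i. z j x) (C * weyl_rate p (real L))" by simp
    qed (use that assms in \<open>auto simp: a_def intro: powr_mono2'\<close>)
    moreover have "(\<lambda>x. \<Sum>i\<le>m. of_real (a i) * z i x) = Rs_sum s L M"
      unfolding Rs_sum_def Rs_term_def a_def z_def using that
      by (intro ext sum.reindex_bij_witness[of _ "\<lambda>n. n - L" "\<lambda>i. L + i"]) (auto simp: m_def)
    moreover have "a 0 * (C * weyl_rate p (real L)) = C * tail_rate p s (real L)"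
      by (simp add: a_def tail_rate_eq_weyl_rate)
    ultimately show ?thesis by simp
  qed
  moreover have "Lp_bound p (Rs_sum s L M) (C * tail_rate p s (real L))" if "M \<le> L" for L M
    using Lp_bound_mono[OF Lp_bound_zero] C(1) assms that by (simp add: Rs_sum_eq_0 tail_rate_nonneg)
  ultimately show thesis using that[of C] C(1) by (meson not_le)
qed

lemma Lp_bound_Rs_sum_dyadic_union:
  assumes block: "\<And>L M. L \<ge> 1 \<Longrightarrow> M \<le> 2 * L \<Longrightarrow> Lp_bound p (Rs_sum s L M) (b (real L))"
    and "L \<ge> 1" "p \<ge> 1"
  shows "M \<le> 2 ^ j * L \<Longrightarrow> Lp_bound p (Rs_sum s L M) (\<Sum>k<j. b (2 ^ k * real L))"
proof (induction j arbitrary: M)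
  case 0
  then show ?case by (simp add: Rs_sum_eq_0 Lp_bound_zero)
next
  case (Suc j)
  have "2 ^ j * L \<ge> 1" using \<open>L \<ge> 1\<close> by simp
  define K where "K = min M (2 ^ j * L)"
  have "Lp_bound p (Rs_sum s L K) (\<Sum>k<j. b (2 ^ k * real L))" by (rule Suc.IH) (simp add: K_def)
  moreover have "Lp_bound p (Rs_sum s (2 ^ j * L) M) (b (real (2 ^ j * L)))"
    using Suc.prems \<open>2 ^ j * L \<ge> 1\<close> by (intro block) auto
  ultimately have "Lp_bound p (\<lambda>x. Rs_sum s L K x + Rs_sum s (2 ^ j * L) M x)
      (\<Sum>k<Suc j. b (2 ^ k * real L))"
    using Lp_bound_add \<open>p \<ge> 1\<close> by fastforce
  moreover have "Rs_sum s L K x + Rs_sum s (2 ^ j * L) M x = Rs_sum s L M x" for x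
  proof (cases "M \<le> 2 ^ j * L")
    case True
    then show ?thesis by (simp add: K_def Rs_sum_eq_0)
  next
    case False
    then show ?thesis using Rs_sum_concat[of L "2 ^ j * L" M s x] \<open>L \<ge> 1\<close> by (simp add: K_def)
  qed
  ultimately show ?case by simp
qed

lemma Lp_bound_Rs_sum:
  assumes "p \<ge> 2" "s > s_star p"
  obtains C where "C > 0" "\<And>L M. L \<ge> 1 \<Longrightarrow> Lp_bound p (Rs_sum s L M) (C * tail_rate p s (real L))"
proof -
  have "s \<ge> 0" using assms s_star_eq_max[of p] by simp
  then obtain C where C: "C > 0"
    "\<And>L M. L \<ge> 1 \<Longrightarrow> M \<le> 2 * L \<Longrightarrow> Lp_bound p (Rs_sum s L M) (C * tail_rate p s (real L))"
    using Lp_bound_Rs_sum_dyadic_block[OF assms(1)] by metis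
  obtain B where B: "B > 0" "\<And>L j. L \<ge> 1 \<Longrightarrow> (\<Sum>k<j. tail_rate p s (2 ^ k * L)) \<le> B * tail_rate p s L"
    using sum_tail_rate_dyadic_le[of p s] assms by auto
  have "Lp_bound p (Rs_sum s L M) (C * B * tail_rate p s (real L))" if "L \<ge> 1" for L M
  proof (rule Lp_bound_mono)
    have "M \<le> 2 ^ M * L" using less_exp[of M] mult_le_mono[of M "2 ^ M" 1 L] that by simp
    then show "Lp_bound p (Rs_sum s L M) (\<Sum>k<M. C * tail_rate p s (2 ^ k * real L))"
      using that assms by (intro Lp_bound_Rs_sum_dyadic_union C) auto
    show "(\<Sum>k<M. C * tail_rate p s (2 ^ k * real L)) \<le> C * B * tail_rate p s (real L)"
      using mult_left_mono[OF B(2)[of "real L" M], of C] that C(1) by (simp add: sum_distrib_left mult_ac)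
  qed (use assms in auto)
  then show thesis using that[of "C * B"] C(1) B(1) by simp
qed

lemma ex_Lp_limit_Rs_sum:
  assumes "p \<ge> 2" "s > s_star p" "L \<ge> 1"
  shows "\<exists>g. Lp_limit p (Rs_sum s L) g"
proof -
  obtain C where C: "C > 0" "\<And>L M. L \<ge> 1 \<Longrightarrow> Lp_bound p (Rs_sum s L M) (C * tail_rate p s (real L))"
    using Lp_bound_Rs_sum[OF assms(1,2)] by metis
  show ?thesis
  proof (rule ex_Lp_limit_of_Cauchy)
    fix M N assume "L \<le> M" "M \<le> N"
    then have "Rs_sum s L N x - Rs_sum s L M x = Rs_sum s M N x" for x
      using Rs_sum_concat[of L M N s x] by (simp add: algebra_simps)
    then show "Lp_bound p (\<lambda>x. Rs_sum s L N x - Rs_sum s L M x) (C * tail_rate p s (real M))"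
      using C(2)[of M N] \<open>L \<le> M\<close> \<open>L \<ge> 1\<close> by simp
  next
    show "(\<lambda>M. C * tail_rate p s (real M)) \<longlonglongrightarrow> 0"
      using tendsto_mult_right_zero[OF tail_rate_tendsto_0[of p s]] assms by simp
  qed (use assms in auto)
qed

section \<open>Equal sums of two squares\<close>

lemma card_multiples_ge:
  fixes d P R :: nat
  assumes "d > 0"
  shows "R div d \<le> card {b \<in> {P<..P + R}. d dvd b}"
proof -
  have image: "(*) d ` {P div d<..(P + R) div d} \<subseteq> {b \<in> {P<..P + R}. d dvd b}"
    using assms by (auto simp: div_less_iff_less_mult less_eq_div_iff_mult_less_eq mult.commute)
  have "(P div d + R div d) * d \<le> P + R"
    by (simp add: distrib_right add_mono)
  then have "P div d + R div d \<le> (P + R) div d"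
    by (simp only: less_eq_div_iff_mult_less_eq[OF assms])
  then have "R div d \<le> (P + R) div d - P div d" by linarith
  also have "\<dots> = card ((*) d ` {P div d<..(P + R) div d})"
    using assms by (subst card_image) (auto simp: inj_on_def)
  also have "\<dots> \<le> card {b \<in> {P<..P + R}. d dvd b}"
    by (intro card_mono image) auto
  finally show ?thesis .
qed

lemma sum_dirichlet_prod_le:
  fixes f g :: "nat \<Rightarrow> real"
  assumes "\<And>n. 0 \<le> f n" "\<And>n. 0 \<le> g n"
  shows "(\<Sum>m\<in>{1..X}. \<Sum>d | d dvd m. f d * g (m div d)) \<le> (\<Sum>d\<in>{1..X}. f d) * (\<Sum>k\<in>{1..X}. g k)"
proof -
  define S where "S = (SIGMA m:{1..X}. {d. d dvd m})"
  define h where "h = (\<lambda>(m, d). (d, m div d :: nat))"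
  have "inj_on h S" by (auto simp: inj_on_def h_def S_def)
  have "(\<Sum>m\<in>{1..X}. \<Sum>d | d dvd m. f d * g (m div d)) = (\<Sum>(m, d)\<in>S. f d * g (m div d))"
    unfolding S_def by (rule sum.Sigma) (auto intro!: finite_divisors_nat)
  also have "\<dots> = (\<Sum>(d, k)\<in>h ` S. f d * g k)"
    by (subst sum.reindex[OF \<open>inj_on h S\<close>]) (auto simp: h_def intro!: sum.cong)
  also have "\<dots> \<le> (\<Sum>(d, k)\<in>{1..X} \<times> {1..X}. f d * g k)"
  proof (rule sum_mono2)
    show "h ` S \<subseteq> {1..X} \<times> {1..X}"
    proof (rule image_subsetI)
      fix t assume "t \<in> S"
      then obtain m d where t: "t = (m, d)" "0 < m" "m \<le> X" "d dvd m" by (auto simp: S_def)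
      have "d \<le> m" "0 < d" using dvd_imp_le dvd_pos_nat t by blast+
      then have "0 < m div d" by (simp add: div_greater_zero_iff)
      with \<open>d \<le> m\<close> \<open>0 < d\<close> \<open>m \<le> X\<close> show "h t \<in> {1..X} \<times> {1..X}"
        using le_trans[OF div_le_dividend \<open>m \<le> X\<close>, of d] by (simp add: h_def t(1))
    qed
  qed (use assms in auto)
  also have "\<dots> = (\<Sum>d\<in>{1..X}. f d) * (\<Sum>k\<in>{1..X}. g k)"
    unfolding sum_product by (rule sum.cartesian_product[symmetric])
  finally show ?thesis .
qed

lemma sum_totient_div_square_ge:
  "ln (real X + 1) / 2 \<le> (\<Sum>d\<in>{1..X}. real (totient d) / (real d)\<^sup>2)"
proof -
  have "1 / real m = (\<Sum>d | d dvd m. real (totient d) / (real d)\<^sup>2 * (1 / (real (m div d))\<^sup>2))"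
    if "m \<in> {1..X}" for m
  proof -
    have "(\<Sum>d | d dvd m. real (totient d) / (real d)\<^sup>2 * (1 / (real (m div d))\<^sup>2))
        = (\<Sum>d | d dvd m. real (totient d) / (real m)\<^sup>2)"
      using that by (intro sum.cong) (auto simp: power_mult_distrib)
    also have "\<dots> = real (\<Sum>d | d dvd m. totient d) / (real m)\<^sup>2"
      by (simp add: sum_divide_distrib)
    also have "\<dots> = 1 / real m" using that by (simp add: totient_divisor_sum power2_eq_square)
    finally show ?thesis ..
  qed
  then have "ln (real X + 1)
      \<le> (\<Sum>m\<in>{1..X}. \<Sum>d | d dvd m. real (totient d) / (real d)\<^sup>2 * (1 / (real (m div d))\<^sup>2))"
    using ln_le_harm[of X] by (simp add: harm_def inverse_eq_divide)
  also have "\<dots> \<le> (\<Sum>d\<in>{1..X}. real (totient d) / (real d)\<^sup>2) * (\<Sum>k\<in>{1..X}. 1 / (real k)\<^sup>2)"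
    by (rule sum_dirichlet_prod_le) auto
  also have "\<dots> \<le> (\<Sum>d\<in>{1..X}. real (totient d) / (real d)\<^sup>2) * 2"
    by (intro mult_left_mono sum_inverse_squares_le sum_nonneg) auto
  finally show ?thesis by simp
qed

lemma sum_totient_card_multiples_le_sum_gcd:
  fixes A :: "nat set"
  assumes "finite A" "0 \<notin> A" "finite D"
  shows "(\<Sum>d\<in>D. totient d * (card {b \<in> A. d dvd b})\<^sup>2) \<le> (\<Sum>a\<in>A. \<Sum>c\<in>A. gcd a c)"
proof -
  have "(\<Sum>d\<in>D. totient d * (card {b \<in> A. d dvd b})\<^sup>2)
      = (\<Sum>d\<in>D. \<Sum>a\<in>A. \<Sum>c\<in>A. if d dvd a \<and> d dvd c then totient d else 0)"
  proof (rule sum.cong[OF refl])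
    fix d
    have card: "card {b \<in> A. d dvd b} = (\<Sum>b\<in>A. if d dvd b then 1 else 0)"
      using assms(1) by (simp add: sum.If_cases Int_def)
    have "totient d * (card {b \<in> A. d dvd b})\<^sup>2
        = (\<Sum>a\<in>A. \<Sum>c\<in>A. totient d * ((if d dvd a then 1 else 0) * (if d dvd c then 1 else 0)))"
      unfolding card power2_eq_square by (subst sum_product) (simp only: sum_distrib_left)
    also have "\<dots> = (\<Sum>a\<in>A. \<Sum>c\<in>A. if d dvd a \<and> d dvd c then totient d else 0)"
      by (intro sum.cong refl) auto
    finally show "totient d * (card {b \<in> A. d dvd b})\<^sup>2
        = (\<Sum>a\<in>A. \<Sum>c\<in>A. if d dvd a \<and> d dvd c then totient d else 0)" .
  qed
  also have "\<dots> = (\<Sum>a\<in>A. \<Sum>c\<in>A. \<Sum>d\<in>D. if d dvd a \<and> d dvd c then totient d else 0)"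
    by (rule trans[OF sum.swap]) (intro sum.cong refl sum.swap)
  also have "\<dots> \<le> (\<Sum>a\<in>A. \<Sum>c\<in>A. gcd a c)"
  proof (intro sum_mono)
    fix a c assume "a \<in> A" "c \<in> A"
    then have "gcd a c > 0" using assms(2) by (auto intro!: Nat.gr0I)
    have "(\<Sum>d\<in>D. if d dvd a \<and> d dvd c then totient d else 0) = (\<Sum>d\<in>{d\<in>D. d dvd a \<and> d dvd c}. totient d)"
      by (rule sum.inter_filter[symmetric]) fact
    also have "\<dots> \<le> (\<Sum>d | d dvd gcd a c. totient d)"
      using \<open>gcd a c > 0\<close> by (intro sum_mono2 finite_divisors_nat) auto
    also have "\<dots> = gcd a c" by (rule totient_divisor_sum)
    finally show "(\<Sum>d\<in>D. if d dvd a \<and> d dvd c then totient d else 0) \<le> gcd a c" .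
  qed
  finally show ?thesis .
qed

lemma sum_gcd_ge:
  "(real X)\<^sup>2 * ln (real X + 1) / 8 \<le> real (\<Sum>a\<in>{X<..2*X}. \<Sum>c\<in>{X<..2*X}. gcd a c)"
proof -
  have "(real X)\<^sup>2 * ln (real X + 1) / 8 = (real X)\<^sup>2 / 4 * (ln (real X + 1) / 2)" by simp
  also have "\<dots> \<le> (real X)\<^sup>2 / 4 * (\<Sum>d\<in>{1..X}. real (totient d) / (real d)\<^sup>2)"
    by (intro mult_left_mono sum_totient_div_square_ge) auto
  also have "\<dots> = (\<Sum>d\<in>{1..X}. real (totient d) * (real X / (2 * real d))\<^sup>2)"
    by (simp add: sum_distrib_left power_divide power_mult_distrib mult_ac)
  also have "\<dots> \<le> (\<Sum>d\<in>{1..X}. real (totient d) * (real (card {b \<in> {X<..2*X}. d dvd b}))\<^sup>2)"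
  proof (intro sum_mono mult_left_mono power_mono)
    fix d assume d: "d \<in> {1..X}"
    then have "d * 1 \<le> d * (X div d)" by (intro mult_le_mono2) (simp add: Suc_le_eq div_greater_zero_iff)
    moreover have "X < d * (X div d) + d"
      using d dividend_less_div_times[of d X] by (simp add: mult.commute add.commute)
    ultimately have "X \<le> 2 * (d * (X div d))" by linarith
    then have "real X \<le> real (2 * (d * (X div d)))" by (simp only: of_nat_le_iff)
    then have "real X / (2 * real d) \<le> real (X div d)" using d by (simp add: field_simps)
    also have "\<dots> \<le> real (card {b \<in> {X<..2*X}. d dvd b})"
      using card_multiples_ge[of d X X] d by (simp add: mult_2)
    finally show "real X / (2 * real d) \<le> real (card {b \<in> {X<..2*X}. d dvd b})" .
  qed auto
  also have "\<dots> = real (\<Sum>d\<in>{1..X}. totient d * (card {b \<in> {X<..2*X}. d dvd b})\<^sup>2)" by simp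
  also have "\<dots> \<le> real (\<Sum>a\<in>{X<..2*X}. \<Sum>c\<in>{X<..2*X}. gcd a c)"
    unfolding of_nat_le_iff by (rule sum_totient_card_multiples_le_sum_gcd) auto
  finally show ?thesis .
qed

lemma gcd_le_card_dvd_mult:
  fixes a c P R :: nat
  assumes "0 < c" "c \<le> R"
  shows "gcd a c \<le> card {b \<in> {P<..P + R}. c dvd a * b}"
proof -
  define c' where "c' = c div gcd a c"
  have c: "c = gcd a c * c'" by (simp add: c'_def)
  then have "c' > 0" using assms(1) by (metis gr0I mult_0_right less_irrefl)
  have "gcd a c = c div c'" using c \<open>c' > 0\<close> by (metis nonzero_mult_div_cancel_right less_irrefl)
  also have "\<dots> \<le> R div c'" by (rule div_le_mono) fact
  also have "\<dots> \<le> card {b \<in> {P<..P + R}. c' dvd b}" by (rule card_multiples_ge) fact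
  also have "\<dots> \<le> card {b \<in> {P<..P + R}. c dvd a * b}"
  proof (intro card_mono subsetI)
    fix b assume b: "b \<in> {b \<in> {P<..P + R}. c' dvd b}"
    then have "gcd a c * c' dvd a * b" by (intro mult_dvd_mono) auto
    with b c show "b \<in> {b \<in> {P<..P + R}. c dvd a * b}" by simp
  qed auto
  finally show ?thesis .
qed

definition equal_square_sums :: "nat set \<Rightarrow> ((nat \<times> nat) \<times> (nat \<times> nat)) set" where
  "equal_square_sums A = {((k, l), (m, n)) | k l m n.
     {k, l, m, n} \<subseteq> A \<and> k\<^sup>2 + l\<^sup>2 = m\<^sup>2 + n\<^sup>2}"

lemma finite_equal_square_sums: "finite A \<Longrightarrow> finite (equal_square_sums A)"
  by (rule finite_subset[of _ "(A \<times> A) \<times> (A \<times> A)"]) (auto simp: equal_square_sums_def)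

lemma square_sums_eq_of_mult_eq:
  fixes a b c d :: nat
  assumes "a \<le> b" "c \<le> d" "a * b = c * d"
  shows "(b + a)\<^sup>2 + (d - c)\<^sup>2 = (b - a)\<^sup>2 + (d + c)\<^sup>2"
proof -
  have "int a * int b = int c * int d" using assms(3) by (metis of_nat_mult)
  then have "(int b + int a)\<^sup>2 + (int d - int c)\<^sup>2 = (int b - int a)\<^sup>2 + (int d + int c)\<^sup>2"
    by (simp add: power2_eq_square algebra_simps)
  then have "int ((b + a)\<^sup>2 + (d - c)\<^sup>2) = int ((b - a)\<^sup>2 + (d + c)\<^sup>2)"
    by (simp only: of_nat_add of_nat_power of_nat_diff[OF assms(1)] of_nat_diff[OF assms(2)])
  then show ?thesis by (simp only: of_nat_eq_iff)
qed

text \<open>The parameters \<open>(a, c, b)\<close> stand for the factorisations \<open>a b = c d\<close>.\<close>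

definition factorisations :: "nat \<Rightarrow> nat \<Rightarrow> (nat \<times> nat \<times> nat) set" where
  "factorisations X L = (SIGMA a:{X<..2*X}. SIGMA c:{X<..2*X}. {b \<in> {4*L<..8*L}. c dvd a * b})"

lemma factorisation_bounds:
  assumes "(a, c, b) \<in> factorisations X L" "2 * X \<le> L"
  obtains d where "a * b = c * d" "0 < a" "a \<le> L" "0 < c" "c \<le> L"
    "4 * L < b" "b \<le> 8 * L" "2 * L \<le> d" "d \<le> 16 * L"
proof -
  have t: "a \<in> {X<..2*X}" "c \<in> {X<..2*X}" "4 * L < b" "b \<le> 8 * L" "c dvd a * b"
    using assms(1) by (auto simp: factorisations_def)
  then obtain d where d: "a * b = c * d" by blast
  have "c > 0" using t by auto
  have "c * (2 * L) \<le> (2 * a) * (2 * L)" using t by (intro mult_le_mono) auto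
  also have "\<dots> = a * (4 * L)" by simp
  also have "\<dots> \<le> c * d" unfolding d[symmetric] using t by (intro mult_le_mono) auto
  finally have "2 * L \<le> d" using \<open>c > 0\<close> by simp
  have "c * d \<le> (2 * c) * (8 * L)" unfolding d[symmetric] using t by (intro mult_le_mono) auto
  then have "d \<le> 16 * L" using \<open>c > 0\<close> by (simp add: mult.left_commute)
  with d t \<open>2 * L \<le> d\<close> assms(2) show thesis by (intro that) auto
qed

lemma card_factorisations_le:
  assumes "2 * X \<le> L"
  shows "card (factorisations X L) \<le> card (equal_square_sums {L..17*L})"
proof (rule card_inj_on_le)
  define h where "h = (\<lambda>(a, c, b). ((b + a, a * b div c - c), (b - a, a * b div c + c :: nat)))"
  show "h ` factorisations X L \<subseteq> equal_square_sums {L..17*L}"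
  proof (rule image_subsetI)
    fix t assume "t \<in> factorisations X L"
    moreover obtain a c b where t: "t = (a, c, b)" by (metis prod_cases3)
    ultimately obtain d where d: "a * b = c * d" "a \<le> L" "0 < c" "c \<le> L"
      "4 * L < b" "b \<le> 8 * L" "2 * L \<le> d" "d \<le> 16 * L"
      using factorisation_bounds assms by metis
    have "a * b div c = d" using d by simp
    moreover have "(b + a)\<^sup>2 + (d - c)\<^sup>2 = (b - a)\<^sup>2 + (d + c)\<^sup>2"
      using d by (intro square_sums_eq_of_mult_eq) auto
    ultimately show "h t \<in> equal_square_sums {L..17*L}"
      using d by (auto simp: h_def t equal_square_sums_def)
  qed
  show "inj_on h (factorisations X L)"
  proof (rule inj_onI)
    fix t t' assume tt: "t \<in> factorisations X L" "t' \<in> factorisations X L" "h t = h t'"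
    obtain a c b a' c' b' where e: "t = (a, c, b)" "t' = (a', c', b')" by (metis prod_cases3)
    obtain d where d: "a * b = c * d" "a \<le> L" "0 < c" "c \<le> L" "4 * L < b" "2 * L \<le> d"
      using factorisation_bounds[OF tt(1)[unfolded e] assms] by metis
    obtain d' where d': "a' * b' = c' * d'" "a' \<le> L" "0 < c'" "c' \<le> L" "4 * L < b'" "2 * L \<le> d'"
      using factorisation_bounds[OF tt(2)[unfolded e] assms] by metis
    have "b + a = b' + a'" "b - a = b' - a'" "d - c = d' - c'" "d + c = d' + c'"
      using tt(3) d(1,3) d'(1,3) by (auto simp: e h_def)
    then show "t = t'" using d d' by (auto simp: e)
  qed
qed (simp add: finite_equal_square_sums)

lemma card_equal_square_sums_ge:
  assumes "L \<ge> 2"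
  shows "(real L)\<^sup>2 * ln (real L) / 256 \<le> real (card (equal_square_sums {L..17*L}))"
proof -
  define X where "X = L div 2"
  have X: "2 * X \<le> L" "L \<le> 4 * X" using assms by (auto simp: X_def)
  then have "real L \<le> real (4 * X)" by (simp only: of_nat_le_iff)
  then have L4: "real L / 4 \<le> real X" by simp
  have "(real L)\<^sup>2 * ln (real L) / 256 = (real L / 4)\<^sup>2 * (ln (real L) / 2) / 8"
    by (simp add: power_divide)
  also have "\<dots> \<le> (real X)\<^sup>2 * ln (real X + 1) / 8"
  proof (intro divide_right_mono mult_mono power_mono L4)
    have "real L \<le> (real L / 4 + 1)\<^sup>2" using zero_le_power2[of "real L / 4 - 1"]
      by (simp add: power2_eq_square algebra_simps)
    then have "ln (real L) \<le> ln ((real L / 4 + 1)\<^sup>2)" using assms by (intro ln_mono) auto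
    also have "\<dots> = 2 * ln (real L / 4 + 1)" by (simp add: ln_realpow)
    also have "ln (real L / 4 + 1) \<le> ln (real X + 1)" using L4 by (intro ln_mono) auto
    finally show "ln (real L) / 2 \<le> ln (real X + 1)" by simp
  qed (use assms in auto)
  also have "\<dots> \<le> real (\<Sum>a\<in>{X<..2*X}. \<Sum>c\<in>{X<..2*X}. gcd a c)" by (rule sum_gcd_ge)
  also have "\<dots> \<le> real (\<Sum>a\<in>{X<..2*X}. \<Sum>c\<in>{X<..2*X}. card {b \<in> {4*L<..4*L + 4*L}. c dvd a * b})"
    unfolding of_nat_le_iff using X by (intro sum_mono gcd_le_card_dvd_mult) auto
  also have "\<dots> = real (card (factorisations X L))"
    unfolding factorisations_def by (simp add: card_SigmaI)
  also have "\<dots> \<le> real (card (equal_square_sums {L..17*L}))"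
    unfolding of_nat_le_iff using X assms by (intro card_factorisations_le) auto
  finally show ?thesis .
qed

section \<open>Lower bounds\<close>

lemma Lp_pow_4_trig_poly:
  fixes k :: "'i \<Rightarrow> int" and c :: "'i \<Rightarrow> real"
  assumes "finite I"
  shows "Lp_pow 4 (\<lambda>x. \<Sum>i\<in>I. of_real (c i) * unit_exp (of_int (k i) * x)) =
    ennreal (\<Sum>(u, v)\<in>(I \<times> I) \<times> (I \<times> I). if k (fst u) + k (snd u) = k (fst v) + k (snd v)
      then c (fst u) * c (snd u) * (c (fst v) * c (snd v)) else 0)"
proof (rule Lp_pow_eq_of_has_integral)
  define f where "f x = (\<Sum>i\<in>I. of_real (c i) * unit_exp (of_int (k i) * x))" for x
  define c2 where "c2 u = c (fst u) * c (snd u)" for u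
  define k2 where "k2 u = k (fst u) + k (snd u)" for u
  have "(f x)\<^sup>2 = (\<Sum>u\<in>I \<times> I. of_real (c2 u) * unit_exp (of_int (k2 u) * x))" for x
    unfolding f_def power2_eq_square sum_product sum.cartesian_product c2_def k2_def
    by (intro sum.cong refl) (auto simp: distrib_right unit_exp_add)
  then have "((\<lambda>x. (cmod ((f x)\<^sup>2))\<^sup>2) has_integral
      (\<Sum>u\<in>I \<times> I. \<Sum>v\<in>I \<times> I. if k2 u = k2 v then c2 u * c2 v else 0)) {0..1}"
    using has_integral_norm_square_trig_poly[of "I \<times> I" c2 k2] assms by simp
  then show "((\<lambda>x. cmod (f x) powr 4) has_integral
      (\<Sum>(u, v)\<in>(I \<times> I) \<times> (I \<times> I). if k (fst u) + k (snd u) = k (fst v) + k (snd v)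
        then c (fst u) * c (snd u) * (c (fst v) * c (snd v)) else 0)) {0..1}"
    unfolding c2_def k2_def sum.cartesian_product by (simp add: norm_power)
qed

lemma Lp_pow_4_Rs_sum_ge:
  assumes "s \<ge> 0" "L \<ge> 1" "K < M"
  shows "ennreal (real K powr (- 8 * s) * real (card (equal_square_sums {L..K})))
      \<le> Lp_pow 4 (Rs_sum s L M)"
proof -
  define a where "a n = real n powr (- 2 * s)" for n
  define k where "k n = int (n\<^sup>2)" for n
  define F where "F = (\<lambda>(u, v). if k (fst u) + k (snd u) = k (fst v) + k (snd v)
      then a (fst u) * a (snd u) * (a (fst v) * a (snd v)) else 0)"
  have "a n \<ge> 0" for n by (simp add: a_def)
  then have "F q \<ge> 0" for q by (auto simp: F_def split: prod.split)
  have "real K powr (- 8 * s) \<le> F q" if "q \<in> equal_square_sums {L..K}" for q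
  proof -
    obtain n1 n2 n3 n4 where q: "q = ((n1, n2), (n3, n4))" "{n1, n2, n3, n4} \<subseteq> {L..K}"
      "n1\<^sup>2 + n2\<^sup>2 = n3\<^sup>2 + n4\<^sup>2"
      using \<open>q \<in> equal_square_sums {L..K}\<close> by (auto simp: equal_square_sums_def)
    have ge: "real K powr (- 2 * s) \<le> a n" if "n \<in> {L..K}" for n
      unfolding a_def using that assms by (intro powr_mono2') auto
    have "real K powr (- 8 * s)
        = (real K powr (- 2 * s) * real K powr (- 2 * s)) * (real K powr (- 2 * s) * real K powr (- 2 * s))"
      by (simp flip: powr_add)
    also have "\<dots> \<le> (a n1 * a n2) * (a n3 * a n4)"
      using q(2) by (intro mult_mono ge mult_nonneg_nonneg \<open>\<And>n. a n \<ge> 0\<close>) auto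
    also have "\<dots> = F q"
      using q(3) by (simp add: F_def q(1) k_def flip: of_nat_add of_nat_power)
    finally show ?thesis .
  qed
  then have "real K powr (- 8 * s) * real (card (equal_square_sums {L..K}))
      \<le> (\<Sum>q\<in>equal_square_sums {L..K}. F q)"
    using sum_bounded_below[of "equal_square_sums {L..K}" "real K powr (- 8 * s)" F]
    by (simp add: mult.commute)
  also have "\<dots> \<le> (\<Sum>q\<in>({L..<M} \<times> {L..<M}) \<times> ({L..<M} \<times> {L..<M}). F q)"
    using assms \<open>\<And>q. F q \<ge> 0\<close> by (intro sum_mono2) (auto simp: equal_square_sums_def)
  finally show ?thesis
    using Lp_pow_4_trig_poly[of "{L..<M}" a k]
    by (simp add: F_def a_def k_def Rs_sum_def[abs_def] Rs_term_def ennreal_leI)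
qed

lemma Lp_pow_ge_of_test_function:
  assumes "continuous_on {0..1} f" and \<phi>: "(\<phi> has_integral 1) {0..1}" "\<And>x. 0 \<le> \<phi> x" "\<And>x. \<phi> x \<le> B"
    and f\<phi>: "((\<lambda>x. Re (f x) * \<phi> x) has_integral y) {0..1}" and "0 < b" "b \<le> y" "0 < B" "1 \<le> p"
  shows "ennreal (b powr p / B) \<le> Lp_pow p f"
proof -
  define I where "I = integral {0..1} (\<lambda>x. cmod (f x) powr p)"
  have "(\<lambda>x. cmod (f x) powr p) integrable_on {0..1}"
    using assms(1) \<open>1 \<le> p\<close>
    by (intro integrable_continuous_real continuous_on_powr' continuous_intros) auto
  then have I: "((\<lambda>x. cmod (f x) powr p) has_integral I) {0..1}"
    unfolding I_def by (rule integrable_integral)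
  define h where "h x = b powr p * ((1 - p) * \<phi> x + p / b * (Re (f x) * \<phi> x))" for x
  have h: "(h has_integral b powr p * ((1 - p) * 1 + p / b * y)) {0..1}"
    unfolding h_def by (intro has_integral_mult_right has_integral_add \<phi>(1) f\<phi>)
  have "h x \<le> B * cmod (f x) powr p" for x
  proof -
    have "h x = b powr p * (1 + p * (Re (f x) / b - 1)) * \<phi> x"
      using \<open>0 < b\<close> by (simp add: h_def algebra_simps)
    also have "\<dots> \<le> b powr p * (1 + p * (cmod (f x) / b - 1)) * \<phi> x"
      using assms complex_Re_le_cmod
      by (intro mult_right_mono mult_left_mono add_left_mono diff_right_mono divide_right_mono) auto
    also have "\<dots> \<le> cmod (f x) powr p * \<phi> x"
      using assms by (intro mult_right_mono powr_ge_tangent) auto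
    also have "\<dots> \<le> cmod (f x) powr p * B"
      by (intro mult_left_mono \<phi>) auto
    finally show ?thesis by (simp add: mult.commute)
  qed
  then have upper: "b powr p * ((1 - p) * 1 + p / b * y) \<le> B * I"
    by (intro has_integral_le[OF h has_integral_mult_right[OF I]])
  have "b powr p = b powr p * ((1 - p) * 1 + p / b * b)"
    using \<open>0 < b\<close> by simp
  also have "\<dots> \<le> b powr p * ((1 - p) * 1 + p / b * y)"
    using assms by (intro mult_left_mono add_left_mono) auto
  also note upper
  finally have "b powr p / B \<le> I"
    using \<open>0 < B\<close> by (simp add: divide_le_eq mult.commute)
  then show ?thesis
    unfolding Lp_pow_eq_of_has_integral[OF I] by (rule ennreal_leI)
qed

text \<open>Testing against the Fejer kernel of degree \<open>8 L\<^sup>2\<close>, which concentrates on \<open>\<bar>x\<bar> \<lesssim> L\<^bsup>-2\<^esup>\<close>, avoids any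
  pointwise control of the infinite tail near the origin.\<close>

lemma Lp_pow_Rs_sum_ge:
  assumes "s \<ge> 0" "L \<ge> 1" "2 * L \<le> M" "p \<ge> 1"
  shows "ennreal ((real L * (2 * real L) powr (- 2 * s) / 2) powr p / (8 * (real L)\<^sup>2))
      \<le> Lp_pow p (Rs_sum s L M)"
proof (rule Lp_pow_ge_of_test_function)
  define Q where "Q = 8 * L\<^sup>2"
  define a where "a n = real n powr (- 2 * s)" for n :: nat
  define y where "y = (\<Sum>n\<in>{L..<M}. a n * (real (Q - n\<^sup>2) / real Q))"
  have "Q > 0" and Q: "real Q = 8 * (real L)\<^sup>2" using assms by (auto simp: Q_def)
  show "(Fejer_kernel Q has_integral 1) {0..1}" using \<open>Q > 0\<close> by (rule has_integral_Fejer_kernel)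
  show "Fejer_kernel Q x \<le> 8 * (real L)\<^sup>2" for x using Fejer_kernel_le[of Q x] by (simp add: Q)
  have "((\<lambda>x. \<Sum>n\<in>{L..<M}. a n * (Re (unit_exp (of_int (int (n\<^sup>2)) * x)) * Fejer_kernel Q x))
      has_integral y) {0..1}"
    unfolding y_def by (intro has_integral_sum has_integral_mult_right has_integral_unit_exp_mult_Fejer_kernel) auto
  also have "(\<lambda>x. \<Sum>n\<in>{L..<M}. a n * (Re (unit_exp (of_int (int (n\<^sup>2)) * x)) * Fejer_kernel Q x))
      = (\<lambda>x. Re (Rs_sum s L M x) * Fejer_kernel Q x)"
    unfolding Rs_sum_def Rs_term_def a_def Re_sum sum_distrib_right by (simp add: mult_ac)
  finally show "((\<lambda>x. Re (Rs_sum s L M x) * Fejer_kernel Q x) has_integral y) {0..1}" .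
  have "real L * (2 * real L) powr (- 2 * s) / 2 = (\<Sum>n\<in>{L..<2*L}. (2 * real L) powr (- 2 * s) * (1/2))"
    by simp
  also have "\<dots> \<le> (\<Sum>n\<in>{L..<2*L}. a n * (real (Q - n\<^sup>2) / real Q))"
  proof (intro sum_mono mult_mono)
    fix n assume n: "n \<in> {L..<2*L}"
    show "(2 * real L) powr (- 2 * s) \<le> a n"
      unfolding a_def using n assms by (intro powr_mono2') auto
    have "n\<^sup>2 \<le> (2 * L)\<^sup>2" using n by (intro power_mono) auto
    then have "2 * n\<^sup>2 \<le> Q" by (simp add: Q_def power_mult_distrib)
    then have "real (2 * n\<^sup>2) \<le> real Q" by (simp only: of_nat_le_iff)
    then show "1/2 \<le> real (Q - n\<^sup>2) / real Q"
      using \<open>2 * n\<^sup>2 \<le> Q\<close> \<open>Q > 0\<close> by (simp add: le_divide_eq of_nat_diff)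
  qed (auto simp: a_def)
  also have "\<dots> \<le> y" unfolding y_def using assms by (intro sum_mono2) (auto simp: a_def)
  finally show "real L * (2 * real L) powr (- 2 * s) / 2 \<le> y" .
qed (use assms in \<open>auto simp: Fejer_kernel_nonneg continuous_on_Rs_sum\<close>)

lemma Lp_pow_2_Rs_sum_ge:
  assumes "s \<ge> 0" "2 * L \<le> M"
  shows "ennreal (real L * (2 * real L) powr (- 4 * s)) \<le> Lp_pow 2 (Rs_sum s L M)"
proof -
  have "Lp_pow 2 (Rs_sum s L M) = ennreal (\<Sum>n\<in>{L..<M}. (real n powr (- 2 * s))\<^sup>2)"
    unfolding Rs_sum_def Rs_term_def by (rule Lp_pow_2_trig_poly) (auto simp: inj_on_def)
  moreover have "real L * (2 * real L) powr (- 4 * s) \<le> (\<Sum>n\<in>{L..<M}. (real n powr (- 2 * s))\<^sup>2)"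
  proof -
    have "real L * (2 * real L) powr (- 4 * s) = (\<Sum>n\<in>{L..<2*L}. (2 * real L) powr (- 4 * s))" by simp
    also have "\<dots> \<le> (\<Sum>n\<in>{L..<2*L}. (real n powr (- 2 * s))\<^sup>2)"
    proof (rule sum_mono)
      fix n assume n: "n \<in> {L..<2*L}"
      then have "(2 * real L) powr (- 4 * s) \<le> real n powr (- 4 * s)"
        using assms by (intro powr_mono2') auto
      then show "(2 * real L) powr (- 4 * s) \<le> (real n powr (- 2 * s))\<^sup>2"
        by (simp add: power2_eq_square flip: powr_add)
    qed
    also have "\<dots> \<le> (\<Sum>n\<in>{L..<M}. (real n powr (- 2 * s))\<^sup>2)" using assms by (intro sum_mono2) auto
    finally show ?thesis .
  qed
  ultimately show ?thesis by (simp add: ennreal_leI)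
qed

section \<open>Flatness\<close>

lemma flat_rate_square:
  "flat_rate p (L\<^sup>2)
      = (if p < 4 then 1 else if p = 4 then 2 * ln (real L) else real L powr (p/2 - 2))"
proof -
  have "real (L\<^sup>2) powr (p/4 - 1) = (real L powr 2) powr (p/4 - 1)" by simp
  also have "\<dots> = real L powr (p/2 - 2)" unfolding powr_powr by (simp add: algebra_simps)
  finally show ?thesis by (cases "L = 0") (simp_all add: flat_rate_def ln_realpow)
qed

lemma flat_rate_mono: "1 \<le> M \<Longrightarrow> M \<le> N \<Longrightarrow> flat_rate p M \<le> flat_rate p N"
  by (auto simp: flat_rate_def intro!: powr_mono2)

lemma flat_rate_pos: "2 \<le> N \<Longrightarrow> 0 < flat_rate p N"
  by (simp add: flat_rate_def)

lemma flat_rate_mult_4_le: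
  assumes "N \<ge> 2"
  shows "flat_rate p (4 * N) \<le> max 3 (4 powr (p/4 - 1)) * flat_rate p N"
proof -
  have "4 * real N \<le> real N ^ 3"
    using assms mult_mono[of 2 "real N" 2 "real N"] mult_right_mono[of 4 "real N * real N" "real N"]
    by (simp add: power3_eq_cube)
  then have "ln (4 * real N) \<le> ln (real N ^ 3)" using assms by (intro ln_mono) auto
  then have "ln (4 * real N) \<le> 3 * ln (real N)" using assms by (simp add: ln_realpow)
  also have "\<dots> \<le> max 3 (4 powr (p/4 - 1)) * ln (real N)" using assms by (intro mult_right_mono) auto
  finally have "ln (4 * real N) \<le> max 3 (4 powr (p/4 - 1)) * ln (real N)" .
  then show ?thesis by (auto simp: flat_rate_def powr_mult intro!: mult_right_mono)
qed

lemma growth_le_flat_rate_square: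
  assumes "L \<ge> 2"
  shows "growth p (real L) \<le> 3 * flat_rate p (L\<^sup>2)"
proof -
  have "1/2 \<le> ln (2::real)" using ln_le_minus_one[of "1/2 :: real"] by (simp add: ln_div)
  also have "\<dots> \<le> ln (real L)" using assms by (intro ln_mono) auto
  finally have "2 + ln (real L) \<le> 3 * (2 * ln (real L))" by simp
  then show ?thesis using assms by (simp add: flat_rate_square growth_def)
qed

text \<open>\<open>tail_power p s L\<close> is the order of magnitude of \<open>\<parallel>f\<parallel>\<^sub>p\<^sup>p\<close> for the tail \<open>f\<close> of \<open>R\<^sub>s\<close> starting at \<open>n = L\<close>.\<close>

definition tail_power :: "real \<Rightarrow> real \<Rightarrow> nat \<Rightarrow> real" where
  "tail_power p s L = real L powr (p * (1/2 - 2 * s)) * flat_rate p (L\<^sup>2)"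

lemma tail_rate_powr_le:
  assumes "L \<ge> 2" "p > 0"
  shows "tail_rate p s (real L) powr p \<le> 3 * tail_power p s L"
proof -
  have "tail_rate p s (real L) powr p = real L powr (p * (1/2 - 2 * s)) * growth p (real L)"
    using assms growth_pos[of "real L" p] by (simp add: tail_rate_def powr_mult powr_powr mult.commute)
  also have "\<dots> \<le> real L powr (p * (1/2 - 2 * s)) * (3 * flat_rate p (L\<^sup>2))"
    using assms by (intro mult_left_mono growth_le_flat_rate_square) auto
  finally show ?thesis by (simp add: tail_power_def)
qed

lemma tail_power_le_Lp_pow_of_lt_4:
  assumes "Lp_bound p (Rs_sum s L M) b" "s \<ge> 0" "2 \<le> p" "p < 4" "2 * L \<le> M"
  shows "2 powr (- 2 * s * p) * tail_power p s L \<le> enn2real (Lp_pow p (Rs_sum s L M))"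
proof -
  have "real L * (2 * real L) powr (- 4 * s) = 2 powr (- 4 * s) * real L powr (1 - 4 * s)"
    using assms by (simp add: powr_mult powr_diff powr_minus field_simps)
  then have "(real L * (2 * real L) powr (- 4 * s)) powr (p/2)
      = 2 powr (- 4 * s * (p/2)) * real L powr ((1 - 4 * s) * (p/2))"
    by (simp only: powr_mult powr_powr)
  also have "\<dots> = 2 powr (- 2 * s * p) * tail_power p s L"
    using assms by (simp add: tail_power_def flat_rate_def algebra_simps)
  finally show ?thesis
    using powr_le_enn2real_Lp_pow[OF assms(1) _ _ _ Lp_pow_2_Rs_sum_ge] assms by simp
qed

lemma tail_power_le_Lp_pow_4:
  assumes "Lp_bound 4 (Rs_sum s L M) b" "s \<ge> 0" "L \<ge> 2" "17 * L < M"
  shows "17 powr (- 8 * s) / 512 * tail_power 4 s L \<le> enn2real (Lp_pow 4 (Rs_sum s L M))"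
proof -
  have "real L powr (4 * (1/2 - 2 * s)) = real L powr 2 * real L powr (- 8 * s)"
    unfolding powr_add[symmetric] by (simp add: algebra_simps)
  then have "17 powr (- 8 * s) / 512 * tail_power 4 s L
      = (17 * real L) powr (- 8 * s) * ((real L)\<^sup>2 * ln (real L) / 256)"
    using assms by (simp add: tail_power_def flat_rate_square powr_mult)
  also have "\<dots> \<le> (17 * real L) powr (- 8 * s) * real (card (equal_square_sums {L..17*L}))"
    using assms by (intro mult_left_mono card_equal_square_sums_ge) auto
  also have "\<dots> \<le> enn2real (Lp_pow 4 (Rs_sum s L M))"
    using le_enn2real_Lp_pow[OF assms(1)] Lp_pow_4_Rs_sum_ge[of s L "17 * L" M] assms by simp
  finally show ?thesis .
qed

lemma tail_power_le_Lp_pow_of_gt_4: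
  assumes "Lp_bound p (Rs_sum s L M) b" "s \<ge> 0" "p > 4" "L \<ge> 1" "2 * L \<le> M"
  shows "(2 powr (- 2 * s) / 2) powr p / 8 * tail_power p s L \<le> enn2real (Lp_pow p (Rs_sum s L M))"
proof -
  have "real L * (2 * real L) powr (- 2 * s) / 2 = 2 powr (- 2 * s) / 2 * real L powr (1 - 2 * s)"
    using assms by (simp add: powr_mult powr_diff powr_minus field_simps)
  then have "(real L * (2 * real L) powr (- 2 * s) / 2) powr p
      = (2 powr (- 2 * s) / 2) powr p * real L powr ((1 - 2 * s) * p)"
    by (simp only: powr_mult powr_powr)
  moreover have "real L powr (p * (1/2 - 2 * s)) * real L powr (p/2 - 2)
      = real L powr ((1 - 2 * s) * p) / real L powr 2"
    unfolding powr_add[symmetric] powr_diff[symmetric] by (simp add: algebra_simps)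
  ultimately have "(2 powr (- 2 * s) / 2) powr p / 8 * tail_power p s L
      = (real L * (2 * real L) powr (- 2 * s) / 2) powr p / (8 * (real L)\<^sup>2)"
    using assms by (simp add: tail_power_def flat_rate_square)
  also have "\<dots> \<le> enn2real (Lp_pow p (Rs_sum s L M))"
    using assms by (intro le_enn2real_Lp_pow[OF assms(1)] Lp_pow_Rs_sum_ge) auto
  finally show ?thesis .
qed

lemma tail_power_le_Lp_pow:
  assumes "p \<ge> 2" "s \<ge> 0"
  obtains c where "c > 0"
    "\<And>L M b. L \<ge> 2 \<Longrightarrow> 17 * L < M \<Longrightarrow> Lp_bound p (Rs_sum s L M) b \<Longrightarrow>
      c * tail_power p s L \<le> enn2real (Lp_pow p (Rs_sum s L M))"
proof -
  consider (less) "p < 4" | (equal) "p = 4" | (greater) "p > 4" by linarith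
  then show thesis
  proof cases
    case less
    show thesis
      by (rule that[of "2 powr (- 2 * s * p)"]) (use assms less tail_power_le_Lp_pow_of_lt_4 in auto)
  next
    case equal
    show thesis
      by (rule that[of "17 powr (- 8 * s) / 512"]) (use assms equal tail_power_le_Lp_pow_4 in auto)
  next
    case greater
    show thesis
      by (rule that[of "(2 powr (- 2 * s) / 2) powr p / 8"])
        (use assms greater tail_power_le_Lp_pow_of_gt_4 in auto)
  qed
qed

lemma Lp_pow_tail_bounds:
  assumes "p \<ge> 2" "s > s_star p"
  obtains c C where "c > 0" "C > 0"
    "\<And>L g. L \<ge> 2 \<Longrightarrow> Lp_limit p (Rs_sum s L) g \<Longrightarrow>
      c * tail_power p s L \<le> enn2real (Lp_pow p g) \<and> enn2real (Lp_pow p g) \<le> C * tail_power p s L"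
proof -
  have "s \<ge> 0" using assms s_star_eq_max[of p] by simp
  then obtain c where c: "c > 0" "\<And>L M b. L \<ge> 2 \<Longrightarrow> 17 * L < M \<Longrightarrow> Lp_bound p (Rs_sum s L M) b \<Longrightarrow>
      c * tail_power p s L \<le> enn2real (Lp_pow p (Rs_sum s L M))"
    using tail_power_le_Lp_pow[OF assms(1)] by metis
  obtain C where C: "C > 0" "\<And>L M. L \<ge> 1 \<Longrightarrow> Lp_bound p (Rs_sum s L M) (C * tail_rate p s (real L))"
    using Lp_bound_Rs_sum[OF assms] by metis
  show thesis
  proof (rule that[of c "3 * C powr p"])
    fix L g assume L: "L \<ge> 2" and lim: "Lp_limit p (Rs_sum s L) g"
    have bound: "Lp_bound p (Rs_sum s L M) (C * tail_rate p s (real L))" for M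
      using C(2) L by simp
    have "c * tail_power p s L \<le> enn2real (Lp_pow p g)"
    proof (rule tendsto_lowerbound[OF enn2real_Lp_pow_tendsto[OF lim bound]])
      show "\<forall>\<^sub>F M in sequentially. c * tail_power p s L \<le> enn2real (Lp_pow p (Rs_sum s L M))"
        using eventually_gt_at_top[of "17 * L"] by eventually_elim (rule c(2)[OF L _ bound])
    qed (use assms in auto)
    moreover have "enn2real (Lp_pow p g) \<le> 3 * C powr p * tail_power p s L"
    proof -
      have "Lp_norm p g \<le> C * tail_rate p s (real L)"
        using Lp_norm_le[OF Lp_bound_Lp_limit[OF lim bound]] assms by simp
      then have "Lp_norm p g powr p \<le> (C * tail_rate p s (real L)) powr p"
        using assms by (intro powr_mono2 Lp_norm_nonneg) auto
      also have "\<dots> \<le> C powr p * (3 * tail_power p s L)"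
        unfolding powr_mult using L assms by (intro mult_left_mono tail_rate_powr_le) auto
      finally show ?thesis using assms by (simp add: Lp_norm_powr mult_ac)
    qed
    ultimately show "c * tail_power p s L \<le> enn2real (Lp_pow p g)
        \<and> enn2real (Lp_pow p g) \<le> 3 * C powr p * tail_power p s L" ..
  qed (use c C in auto)
qed

lemma tail_power_eq_mult_tail_power_2:
  "tail_power p s L = tail_power 2 s L powr (p/2) * flat_rate p (L\<^sup>2)"
proof -
  have "tail_power 2 s L = real L powr (2 * (1/2 - 2 * s))"
    by (simp add: tail_power_def flat_rate_def)
  also have "\<dots> powr (p/2) = real L powr (p * (1/2 - 2 * s))"
    unfolding powr_powr by (rule arg_cong[where f = "(powr) (real L)"]) (simp add: algebra_simps)
  finally show ?thesis by (simp add: tail_power_def)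
qed

lemma flatness_bounds_of_Lp_pow_bounds:
  assumes square: "c\<^sub>2 * W \<le> enn2real (Lp_pow 2 g)" "enn2real (Lp_pow 2 g) \<le> C\<^sub>2 * W"
    and power: "c * (W powr (p/2) * F) \<le> enn2real (Lp_pow p g)"
      "enn2real (Lp_pow p g) \<le> C * (W powr (p/2) * F)"
    and pos: "0 < c\<^sub>2" "0 < W" "0 \<le> F" "0 \<le> C" "0 \<le> p"
  shows "c / C\<^sub>2 powr (p/2) * F \<le> flatness p g" "flatness p g \<le> C / c\<^sub>2 powr (p/2) * F"
proof -
  define E where "E = enn2real (Lp_pow 2 g) powr (p/2)"
  have E: "c\<^sub>2 powr (p/2) * W powr (p/2) \<le> E" "E \<le> C\<^sub>2 powr (p/2) * W powr (p/2)"
    unfolding E_def powr_mult[symmetric] using square pos by (auto intro!: powr_mono2)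
  have "0 < c\<^sub>2 powr (p/2) * W powr (p/2)" using pos by simp
  then have "E > 0" using E(1) by linarith
  have "c / C\<^sub>2 powr (p/2) * F = c * (W powr (p/2) * F) / (C\<^sub>2 powr (p/2) * W powr (p/2))"
    using pos by simp
  also have "\<dots> \<le> enn2real (Lp_pow p g) / E"
    using power E \<open>E > 0\<close> by (intro frac_le) auto
  finally show "c / C\<^sub>2 powr (p/2) * F \<le> flatness p g" by (simp add: flatness_def E_def)
  have "enn2real (Lp_pow p g) / E \<le> C * (W powr (p/2) * F) / (c\<^sub>2 powr (p/2) * W powr (p/2))"
    using power E pos by (intro frac_le) auto
  then show "flatness p g \<le> C / c\<^sub>2 powr (p/2) * F" using pos by (simp add: flatness_def E_def)
qed

lemma flatness_tail_bounds:
  assumes "p \<ge> 2" "s > s_star p"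
  obtains c C where "c > 0" "C > 0"
    "\<And>L g. L \<ge> 2 \<Longrightarrow> Lp_limit p (Rs_sum s L) g \<Longrightarrow>
      c * flat_rate p (L\<^sup>2) \<le> flatness p g \<and> flatness p g \<le> C * flat_rate p (L\<^sup>2)"
proof -
  obtain c C where pos: "c > 0" "C > 0" and bounds: "\<And>L g. L \<ge> 2 \<Longrightarrow> Lp_limit p (Rs_sum s L) g \<Longrightarrow>
      c * tail_power p s L \<le> enn2real (Lp_pow p g) \<and> enn2real (Lp_pow p g) \<le> C * tail_power p s L"
    using Lp_pow_tail_bounds[OF assms] by metis
  have "s > s_star 2" using assms s_star_eq_max[of p] s_star_eq_max[of 2] by simp
  then obtain c\<^sub>2 C\<^sub>2 where pos\<^sub>2: "c\<^sub>2 > 0" "C\<^sub>2 > 0"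
    and bounds\<^sub>2: "\<And>L g. L \<ge> 2 \<Longrightarrow> Lp_limit 2 (Rs_sum s L) g \<Longrightarrow>
      c\<^sub>2 * tail_power 2 s L \<le> enn2real (Lp_pow 2 g) \<and> enn2real (Lp_pow 2 g) \<le> C\<^sub>2 * tail_power 2 s L"
    using Lp_pow_tail_bounds[of 2 s] by (metis order_refl)
  show thesis
  proof (rule that[of "c / C\<^sub>2 powr (p/2)" "C / c\<^sub>2 powr (p/2)"])
    fix L g assume L: "L \<ge> 2" and lim: "Lp_limit p (Rs_sum s L) g"
    have "2 \<le> L\<^sup>2" using power_mono[OF L, of 2] by simp
    then have F: "0 < flat_rate p (L\<^sup>2)" by (rule flat_rate_pos)
    have W: "0 < tail_power 2 s L" using L by (simp add: tail_power_def flat_rate_def)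
    have "Lp_limit 2 (Rs_sum s L) g" using assms by (intro Lp_limit_lower_exponent[OF lim]) auto
    then have square: "c\<^sub>2 * tail_power 2 s L \<le> enn2real (Lp_pow 2 g)"
      "enn2real (Lp_pow 2 g) \<le> C\<^sub>2 * tail_power 2 s L"
      using bounds\<^sub>2[OF L] by auto
    have power: "c * (tail_power 2 s L powr (p/2) * flat_rate p (L\<^sup>2)) \<le> enn2real (Lp_pow p g)"
      "enn2real (Lp_pow p g) \<le> C * (tail_power 2 s L powr (p/2) * flat_rate p (L\<^sup>2))"
      using bounds[OF L lim] unfolding tail_power_eq_mult_tail_power_2[of p] by auto
    show "c / C\<^sub>2 powr (p/2) * flat_rate p (L\<^sup>2) \<le> flatness p g
        \<and> flatness p g \<le> C / c\<^sub>2 powr (p/2) * flat_rate p (L\<^sup>2)"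
      using flatness_bounds_of_Lp_pow_bounds[OF square power] F W pos pos\<^sub>2 assms by simp
  qed (use pos pos\<^sub>2 in auto)
qed

definition sqrt_ceil :: "nat \<Rightarrow> nat" where
  "sqrt_ceil N = max 1 (nat \<lceil>sqrt (real N)\<rceil>)"

lemma sqrt_ceil_le_iff: "sqrt_ceil N \<le> n \<longleftrightarrow> 1 \<le> n \<and> N \<le> n\<^sup>2"
proof -
  have "nat \<lceil>sqrt (real N)\<rceil> \<le> n \<longleftrightarrow> sqrt (real N) \<le> real n"
    by (simp add: nat_le_iff ceiling_le_iff)
  also have "\<dots> \<longleftrightarrow> sqrt (real N) \<le> sqrt ((real n)\<^sup>2)" by simp
  also have "\<dots> \<longleftrightarrow> real N \<le> real (n\<^sup>2)" by (simp only: real_sqrt_le_iff of_nat_power)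
  finally show ?thesis by (simp add: sqrt_ceil_def)
qed

lemma sqrt_ceil_square_bounds:
  assumes "N \<ge> 1"
  shows "N \<le> (sqrt_ceil N)\<^sup>2" "(sqrt_ceil N)\<^sup>2 \<le> 4 * N"
proof -
  show "N \<le> (sqrt_ceil N)\<^sup>2" using sqrt_ceil_le_iff[of N "sqrt_ceil N"] by simp
  have "sqrt (real N) \<ge> 1" using assms by simp
  then have "real (sqrt_ceil N) \<le> 2 * sqrt (real N)" unfolding sqrt_ceil_def by linarith
  then have "(real (sqrt_ceil N))\<^sup>2 \<le> (2 * sqrt (real N))\<^sup>2" by (intro power_mono) auto
  then have "real ((sqrt_ceil N)\<^sup>2) \<le> real (4 * N)" by (simp add: power_mult_distrib)
  then show "(sqrt_ceil N)\<^sup>2 \<le> 4 * N" by (simp only: of_nat_le_iff)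
qed

lemma flat_rate_sqrt_ceil_bounds:
  assumes "N \<ge> 2"
  shows "flat_rate p N \<le> flat_rate p ((sqrt_ceil N)\<^sup>2)"
    and "flat_rate p ((sqrt_ceil N)\<^sup>2) \<le> max 3 (4 powr (p/4 - 1)) * flat_rate p N"
proof -
  show "flat_rate p N \<le> flat_rate p ((sqrt_ceil N)\<^sup>2)"
    using assms by (intro flat_rate_mono sqrt_ceil_square_bounds) auto
  have "flat_rate p ((sqrt_ceil N)\<^sup>2) \<le> flat_rate p (4 * N)"
    using assms sqrt_ceil_square_bounds[of N] by (intro flat_rate_mono) auto
  also note flat_rate_mult_4_le[OF assms]
  finally show "flat_rate p ((sqrt_ceil N)\<^sup>2) \<le> max 3 (4 powr (p/4 - 1)) * flat_rate p N" .
qed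

lemma Rs_high_partial_eq_Rs_sum: "Rs_high_partial s N M = Rs_sum s (sqrt_ceil N) (Suc M)"
proof -
  have "{n. 1 \<le> n \<and> N \<le> n\<^sup>2 \<and> n \<le> M} = {sqrt_ceil N..<Suc M}"
    by (auto simp: sqrt_ceil_le_iff)
  then show ?thesis
    by (simp add: fun_eq_iff Rs_high_partial_def Rs_sum_def Rs_term_def unit_exp_def mult.assoc)
qed

lemma Lp_limit_Rs_high_partial_iff:
  "Lp_limit p (Rs_high_partial s N) g \<longleftrightarrow> Lp_limit p (Rs_sum s (sqrt_ceil N)) g"
  unfolding Lp_limit_def Rs_high_partial_eq_Rs_sum
  using filterlim_sequentially_Suc[of "\<lambda>M. Lp_pow p (\<lambda>x. Rs_sum s (sqrt_ceil N) M x - g x)" "nhds 0"]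
  by simp

lemma flatness_Rs_high_partial_bounds:
  assumes "p \<ge> 2" "s > s_star p"
  obtains c C where "c > 0" "C > 0"
    "\<And>N g. N \<ge> 2 \<Longrightarrow> Lp_limit p (Rs_high_partial s N) g \<Longrightarrow>
      c * flat_rate p N \<le> flatness p g \<and> flatness p g \<le> C * flat_rate p N"
proof -
  obtain c C where cC: "c > 0" "C > 0" and bounds: "\<And>L g. L \<ge> 2 \<Longrightarrow> Lp_limit p (Rs_sum s L) g \<Longrightarrow>
      c * flat_rate p (L\<^sup>2) \<le> flatness p g \<and> flatness p g \<le> C * flat_rate p (L\<^sup>2)"
    using flatness_tail_bounds[OF assms] by metis
  define D where "D = max 3 (4 powr (p/4 - 1))"
  have "c * flat_rate p N \<le> flatness p g \<and> flatness p g \<le> C * D * flat_rate p N"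
    if "N \<ge> 2" "Lp_limit p (Rs_high_partial s N) g" for N g
  proof -
    define L where "L = sqrt_ceil N"
    have "\<not> L \<le> 1" using that(1) by (simp add: L_def sqrt_ceil_le_iff)
    then have "c * flat_rate p (L\<^sup>2) \<le> flatness p g" "flatness p g \<le> C * flat_rate p (L\<^sup>2)"
      using bounds[of L g] that(2) by (auto simp: Lp_limit_Rs_high_partial_iff L_def)
    moreover have "c * flat_rate p N \<le> c * flat_rate p (L\<^sup>2)"
      "C * flat_rate p (L\<^sup>2) \<le> C * (D * flat_rate p N)"
      unfolding L_def D_def using cC that(1) by (intro mult_left_mono flat_rate_sqrt_ceil_bounds; simp)+
    ultimately show ?thesis by (simp add: mult.assoc)
  qed
  then show thesis using that[of c "C * D"] cC by (simp add: D_def)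
qed

theorem theoremA:
  fixes p s :: real
  assumes "p \<ge> 2" and "s > s_star p"
  shows "(\<forall>N. \<exists>g. Lp_limit p (Rs_high_partial s N) g) \<and>
    (\<exists>c C. c > 0 \<and> C > 0 \<and>
      (\<forall>\<^sub>F N in sequentially. \<forall>g. Lp_limit p (Rs_high_partial s N) g \<longrightarrow>
          c * flat_rate p N \<le> flatness p g \<and> flatness p g \<le> C * flat_rate p N))"
proof
  show "\<forall>N. \<exists>g. Lp_limit p (Rs_high_partial s N) g"
    using ex_Lp_limit_Rs_sum[OF assms] by (simp add: Lp_limit_Rs_high_partial_iff sqrt_ceil_def)
  obtain c C where "c > 0" "C > 0" and bounds: "\<And>N g. N \<ge> 2 \<Longrightarrow> Lp_limit p (Rs_high_partial s N) g \<Longrightarrow>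
      c * flat_rate p N \<le> flatness p g \<and> flatness p g \<le> C * flat_rate p N"
    using flatness_Rs_high_partial_bounds[OF assms] by metis
  moreover have "\<forall>\<^sub>F N in sequentially. \<forall>g. Lp_limit p (Rs_high_partial s N) g \<longrightarrow>
      c * flat_rate p N \<le> flatness p g \<and> flatness p g \<le> C * flat_rate p N"
    using eventually_ge_at_top[of 2] by eventually_elim (use bounds in blast)
  ultimately show "\<exists>c C. c > 0 \<and> C > 0 \<and>
      (\<forall>\<^sub>F N in sequentially. \<forall>g. Lp_limit p (Rs_high_partial s N) g \<longrightarrow>
          c * flat_rate p N \<le> flatness p g \<and> flatness p g \<le> C * flat_rate p N)"
    by blast
qed

end
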